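(* Let $q$ be a fixed prime power. The $n\to\infty$ limit of the probability that a uniformly random element of $GL(n,q)$ is semisimple is $$\prod_{\substack{r\ge 1\\ r\equiv 0,\pm 2\ (\mathrm{mod}\ 5)}} \frac{1-\frac{1}{q^{r-1}}}{1-\frac{1}{q^{r}}}.$$
   Context: $GL(n,q)$ is the group of invertible $n\times n$ matrices over the finite field $F_q$. A matrix is semisimple if it is diagonalizable over $\overline{F_q}$, the algebraic closure of $F_q$. *)

theory Defs
  imports
    "HOL-Probability.Probability_Mass_Function"
    "HOL-Algebra.Algebraic_Closure_Type"
    "Jordan_Normal_Form.Matrix"
begin

definition GL :: "nat \<Rightarrow> 'a :: field mat set" where
  "GL n = {A \<in> carrier_mat n n. invertible_mat A}"

definition diagonalizable_mat :: "'a :: field mat \<Rightarrow> bool" where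
  "diagonalizable_mat A \<longleftrightarrow> (\<exists>D. diagonal_mat D \<and> similar_mat A D)"

definition semisimple_mat :: "'a :: field mat \<Rightarrow> bool" where
  "semisimple_mat A \<longleftrightarrow> diagonalizable_mat (map_mat to_ac A)"

(* pmf_of_set is only meaningful on finite nonempty sets; the next two lemmas ensure this for GL. *)

lemma GL_nonempty: "GL n \<noteq> ({} :: 'a :: field mat set)"
proof -
  have "(1\<^sub>m n :: 'a mat) \<in> GL n"
    unfolding GL_def invertible_mat_def inverts_mat_def by (auto intro!: exI[of _ "1\<^sub>m n"])
  thus ?thesis by blast
qed

lemma finite_GL: "finite (GL n :: 'a :: {field, finite} mat set)"
proof -
  define I where "I = {..<n} \<times> {..<n}"
  have "(GL n :: 'a mat set) \<subseteq> mat n n ` (I \<rightarrow>\<^sub>E UNIV)"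
  proof
    fix A :: "'a mat"
    assume "A \<in> GL n"
    hence "A \<in> carrier_mat n n"
      by (simp add: GL_def)
    hence "A = mat n n (restrict (\<lambda>ij. A $$ ij) I)"
      by (intro eq_matI) (auto simp: I_def)
    moreover have "restrict (\<lambda>ij. A $$ ij) I \<in> I \<rightarrow>\<^sub>E UNIV"
      by simp
    ultimately show "A \<in> mat n n ` (I \<rightarrow>\<^sub>E UNIV)"
      by (rule image_eqI[where f = "mat n n"])
  qed
  moreover have "finite (I \<rightarrow>\<^sub>E (UNIV :: 'a set))"
    by (intro finite_PiE) (auto simp: I_def)
  ultimately show ?thesis
    by (meson finite_imageI finite_subset)
qed

definition prob_semisimple :: "'a :: {field, finite} itself \<Rightarrow> nat \<Rightarrow> real" where
  "prob_semisimple _ n =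
     measure_pmf.prob (pmf_of_set (GL n :: 'a mat set)) {A. semisimple_mat A}"

(* The residues 0, 2, 3 are the classes 0 and +-2 modulo 5; all other factors are 1. *)
definition rr_factor :: "nat \<Rightarrow> nat \<Rightarrow> real" where
  "rr_factor q r =
     (if r \<ge> 1 \<and> r mod 5 \<in> {0, 2, 3}
      then (1 - 1 / real q ^ (r - 1)) / (1 - 1 / real q ^ r)
      else 1)"

end

(*
Let s_n be the probability that an element of GL(n,q) is semisimple. A matrix is semisimple and
invertible iff it is annihilated by a product of distinct monic irreducible polynomials other than X.
Splitting the space into the corresponding kernels, and counting operators annihilated by one
irreducible polynomial of degree d through ordered bases over the field with q^d elements, gives
  sum_n s_n u^n = prod_{phi /= X} sum_m u^(m deg phi) / |GL(m, q^(deg phi))|.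
Unique factorisation gives prod_{phi /= X} (1 - (u/q)^(deg phi)) = (1 - u) / (1 - u/q), so multiplying
by 1 - u and distributing this product over the factors leaves a product whose coefficients are
absolutely summable; its value at u = 1 is lim s_n. By the first Rogers-Ramanujan identity each factor
at u = 1 is prod_{r = +-1 mod 5, r >= 4} 1 / (1 - q^(-r deg phi)), and interchanging the products over
phi and r reduces every r to the same formula for the product over all phi at u = q^(1-r).
*)

theory Submission
  imports
    Defs
    "HOL-Library.Function_Algebras"
    "Jordan_Normal_Form.Char_Poly"
begin

hide_const (open) Divisibility.irreducible Divisibility.prime up_ring.coeff up_ring.monom
  Polynomials.lead_coeff Polynomials.degree module.smult
hide_fact (open) Divisibility.irreducibleI Divisibility.irreducibleD
unbundle no vec_syntax
no_notation Matrix.vec_index (infixl \<open>$\<close> 100)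

section \<open>The first Rogers-Ramanujan identity\<close>

text \<open>The product over phi cannot be evaluated at u = 1 factor by factor: a factor of degree d
  begins with 1 + u^d / (q^d - 1), and roughly q^d / d polynomials have that degree. The weight 1 -
  (u/q)^d reduces this first coefficient to the order q^(-2d), which is summable over all phi. Every
  product is truncated at deg phi <= d. Together with the weight of X the truncated weights multiply
  to 1 - u times the rescaled series that counts polynomials without factors of degree at most d.
  That series is 1 + O(u^(d+1)), so the coefficients up to d are already the differences s_n -
  s_(n-1), and a majorant independent of d allows d to tend to infinity at u = 1. With x = 1/Q one
  has 1 / |GL(m,Q)| = x^(m^2) / ((1 - x) ... (1 - x^m)), which is the term of the Rogers-Ramanujan
  sum. Its product side also contains r = 1, for which the product over phi would diverge; the
  weight at u = 1 is exactly the factor that removes it. All remaining factors are at least 1, so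
  the two products are interchanged by monotonicity alone.\<close>

definition qfac :: "real \<Rightarrow> nat \<Rightarrow> real" where
  "qfac x n = (\<Prod>i<n. 1 - x ^ Suc i)"

text \<open>The q-binomial coefficient in the base \<open>x\<close>, where \<open>qfac x n\<close>
  is the q-Pochhammer product \<open>(x;x)_n\<close>. The q-Pascal recursion serves as the
  definition, so that no division occurs; the quotient formula is recovered in
  \<open>gauss_binomial_eq\<close>.\<close>

fun gauss_binomial :: "real \<Rightarrow> nat \<Rightarrow> nat \<Rightarrow> real" where
  "gauss_binomial x n 0 = 1"
| "gauss_binomial x 0 (Suc k) = 0"
| "gauss_binomial x (Suc n) (Suc k) = x ^ Suc k * gauss_binomial x n (Suc k) + gauss_binomial x n k"

lemma qfac_0 [simp]: "qfac x 0 = 1"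
  and qfac_Suc: "qfac x (Suc n) = qfac x n * (1 - x ^ Suc n)"
  by (simp_all add: qfac_def)

lemma gauss_binomial_eq_0: "n < k \<Longrightarrow> gauss_binomial x n k = 0"
  by (induction x n k rule: gauss_binomial.induct) auto

lemma gauss_binomial_same [simp]: "gauss_binomial x n n = 1"
  by (induction n) (auto simp: gauss_binomial_eq_0)

lemma gauss_binomial_qfac:
  "k \<le> n \<Longrightarrow> gauss_binomial x n k * qfac x k * qfac x (n - k) = qfac x n"
proof (induction x n k rule: gauss_binomial.induct)
  case (3 x n k)
  show ?case
  proof (cases "k = n")
    case False
    with 3 have k: "Suc k \<le> n" by simp
    then obtain d where d: "n = Suc k + d" using le_Suc_ex by blast
    have 1: "gauss_binomial x n (Suc k) * qfac x (Suc k) * qfac x d = qfac x n"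
      using 3(1) d by simp
    have 2: "gauss_binomial x n k * qfac x k * qfac x (Suc d) = qfac x n"
      using 3(2) d by simp
    have "gauss_binomial x (Suc n) (Suc k) * qfac x (Suc k) * qfac x (Suc n - Suc k)
        = x ^ Suc k * (1 - x ^ Suc d) * (gauss_binomial x n (Suc k) * qfac x (Suc k) * qfac x d)
          + (1 - x ^ Suc k) * (gauss_binomial x n k * qfac x k * qfac x (Suc d))"
      using d by (simp add: qfac_Suc algebra_simps)
    also have "\<dots> = qfac x n * (1 - x ^ Suc k * x ^ Suc d)"
      unfolding 1 2 by (simp add: algebra_simps)
    also have "x ^ Suc k * x ^ Suc d = x ^ Suc n"
      using d by (simp add: power_add)
    finally show ?thesis by (simp add: qfac_Suc)
  qed (simp add: gauss_binomial_eq_0)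
qed auto

lemma zero_choose_two [simp]: "0 choose 2 = 0"
  by (simp add: numeral_2_eq_2)

lemma choose_two_Suc: "Suc k choose 2 = (k choose 2) + k"
  by (simp add: numeral_2_eq_2)

text \<open>This and \<open>choose_two_diff\<close> are the exponent arithmetic for recentring the
  q-binomial theorem at the middle index: they describe the power of \<open>x\<close> at the indices
  \<open>n + j\<close> and \<open>n - j\<close> after the substitution
  \<open>w = - z / x ^ n\<close>.\<close>

lemma choose_two_add: "(n + j choose 2) + (Suc n choose 2) = (j choose 2) + n * (n + j)"
proof (induction j)
  case 0
  show ?case by (induction n) (simp_all add: choose_two_Suc)
qed (simp add: choose_two_Suc)

lemma choose_two_diff: "(m choose 2) + (Suc (m + j) choose 2) = (Suc j choose 2) + (m + j) * m"
  by (induction m) (simp_all add: choose_two_Suc)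

text \<open>The q-binomial theorem. Splitting off the factor with \<open>i = 0\<close> leaves the
  same product with \<open>w * x\<close> in place of \<open>w\<close>, which is why the induction
  generalises over \<open>w\<close>; comparing coefficients is then the q-Pascal recursion.\<close>

lemma gauss_binomial_theorem:
  "(\<Prod>i<M. 1 + w * x ^ i) = (\<Sum>k\<le>M. x ^ (k choose 2) * gauss_binomial x M k * w ^ k)"
proof (induction M arbitrary: w)
  case (Suc M)
  let ?t = "\<lambda>M k. x ^ (k choose 2) * gauss_binomial x M k * w ^ k"
  have "(\<Prod>i<Suc M. 1 + w * x ^ i) = (1 + w) * (\<Prod>i<M. 1 + (w * x) * x ^ i)"
    by (subst prod.lessThan_Suc_shift) (simp add: mult_ac)
  also have "\<dots> = (1 + w) * (\<Sum>k\<le>M. x ^ k * ?t M k)"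
    unfolding Suc.IH by (simp add: mult_ac power_mult_distrib)
  also have "\<dots> = (\<Sum>k\<le>M. x ^ k * ?t M k) + (\<Sum>k\<le>M. w * (x ^ k * ?t M k))"
    by (simp add: distrib_right sum_distrib_left sum.distrib)
  also have "(\<Sum>k\<le>M. x ^ k * ?t M k) = (\<Sum>k\<le>Suc M. x ^ k * ?t M k)"
    by (simp add: gauss_binomial_eq_0)
  also have "\<dots> = 1 + (\<Sum>k\<le>M. x ^ Suc k * ?t M (Suc k))"
    by (subst sum.atMost_Suc_shift) simp
  also have "\<dots> + (\<Sum>k\<le>M. w * (x ^ k * ?t M k))
      = 1 + (\<Sum>k\<le>M. x ^ Suc k * ?t M (Suc k) + w * (x ^ k * ?t M k))"
    by (simp add: sum.distrib)
  also have "(\<Sum>k\<le>M. x ^ Suc k * ?t M (Suc k) + w * (x ^ k * ?t M k)) = (\<Sum>k\<le>M. ?t (Suc M) (Suc k))"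
    by (intro sum.cong) (simp_all add: choose_two_Suc power_add algebra_simps)
  also have "1 + \<dots> = (\<Sum>k\<le>Suc M. ?t (Suc M) k)"
    by (subst sum.atMost_Suc_shift) simp
  finally show ?case .
qed (simp add: binomial_eq_0)

lemma prod_lessThan_add:
  fixes f :: "nat \<Rightarrow> 'a :: comm_monoid_mult"
  shows "(\<Prod>i<n + m. f i) = (\<Prod>i<n. f i) * (\<Prod>i<m. f (n + i))"
  by (induction m) (simp_all add: mult_ac)

lemma sum_symmetric_split:
  fixes f :: "nat \<Rightarrow> real"
  shows "(\<Sum>k\<le>2 * n. f k) = f n + (\<Sum>j=1..n. f (n + j) + f (n - j))"
proof -
  have "(\<Sum>k\<le>2 * n. f k) = (\<Sum>k\<in>{..<n} \<union> {n} \<union> {Suc n..2 * n}. f k)"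
    by (intro sum.cong) auto
  also have "\<dots> = (\<Sum>k<n. f k) + f n + (\<Sum>k=Suc n..2 * n. f k)"
    by (subst sum.union_disjoint; auto)+
  also have "(\<Sum>k=Suc n..2 * n. f k) = (\<Sum>j=1..n. f (n + j))"
    by (rule sum.reindex_bij_witness[of _ "\<lambda>j. n + j" "\<lambda>k. k - n"]) auto
  also have "(\<Sum>k<n. f k) = (\<Sum>j=1..n. f (n - j))"
    by (rule sum.reindex_bij_witness[of _ "\<lambda>j. n - j" "\<lambda>k. n - k"]) auto
  finally show ?thesis by (simp add: sum.distrib)
qed

text \<open>Take \<open>2 * n\<close> factors of the q-binomial theorem at
  \<open>w = - z / x ^ n\<close>. The upper half gives \<open>1 - z * x ^ i\<close> directly, each
  factor of the lower half is a monomial times \<open>1 - x ^ Suc i / z\<close>, and the sum is read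
  outwards from its middle term.\<close>

lemma finite_jacobi_triple_product:
  assumes x: "x \<noteq> 0" and z: "z \<noteq> 0"
  shows "(\<Prod>i<n. (1 - z * x ^ i) * (1 - x ^ Suc i / z)) =
    gauss_binomial x (2 * n) n +
    (\<Sum>j=1..n. (-1) ^ j * (gauss_binomial x (2 * n) (n + j) * (z ^ j * x ^ (j choose 2))
       + gauss_binomial x (2 * n) (n - j) * (x ^ (Suc j choose 2) / z ^ j)))"
    (is "?P = ?R")
proof -
  define w where "w = - z / x ^ n"
  \<comment> \<open>The product of the monomials split off from the lower \<open>n\<close> factors.
    Every term of the sum contains it too, so it cancels at the end.\<close>
  define K where "K = (-z) ^ n / x ^ (Suc n choose 2)"
  let ?t = "\<lambda>k. x ^ (k choose 2) * gauss_binomial x (2 * n) k * w ^ k"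
  have K: "K \<noteq> 0" using x z by (simp add: K_def)
  have low: "(\<Prod>i<n. 1 + w * x ^ i) = K * (\<Prod>i<n. 1 - x ^ Suc i / z)"
  proof -
    have "(\<Prod>i<n. 1 + w * x ^ i) = (\<Prod>i<n. 1 + w * x ^ (n - Suc i))"
      by (rule prod.nat_diff_reindex[symmetric])
    also have "\<dots> = (\<Prod>i<n. (- z / x ^ Suc i) * (1 - x ^ Suc i / z))"
    proof (intro prod.cong refl)
      fix i assume "i \<in> {..<n}"
      then have "x ^ n = x ^ (n - Suc i) * x ^ Suc i"
        by (metis Suc_leI lessThan_iff le_add_diff_inverse2 power_add)
      then show "1 + w * x ^ (n - Suc i) = (- z / x ^ Suc i) * (1 - x ^ Suc i / z)"
        using x z by (simp add: w_def field_simps)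
    qed
    also have "\<dots> = (\<Prod>i<n. - z / x ^ Suc i) * (\<Prod>i<n. 1 - x ^ Suc i / z)"
      by (rule prod.distrib)
    also have "(\<Prod>i<n. - z / x ^ Suc i) = K"
    proof -
      have "(\<Prod>i<n. x ^ Suc i) = x ^ (Suc n choose 2)"
        by (induction n) (simp_all add: choose_two_Suc binomial_eq_0 power_add mult_ac)
      then show ?thesis by (simp only: K_def prod_dividef prod_constant card_lessThan)
    qed
    finally show ?thesis .
  qed
  have high: "(\<Prod>i<n. 1 + w * x ^ (n + i)) = (\<Prod>i<n. 1 - z * x ^ i)"
    using x by (intro prod.cong) (simp_all add: w_def power_add)
  have "K * ?P = (\<Prod>i<n. 1 + w * x ^ i) * (\<Prod>i<n. 1 + w * x ^ (n + i))"
    unfolding low high by (simp add: prod.distrib)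
  also have "\<dots> = (\<Prod>i<n + n. 1 + w * x ^ i)"
    by (rule prod_lessThan_add [symmetric])
  also have "\<dots> = (\<Sum>k\<le>2 * n. ?t k)"
    unfolding mult_2 [symmetric] by (rule gauss_binomial_theorem)
  also have "\<dots> = ?t n + (\<Sum>j=1..n. ?t (n + j) + ?t (n - j))"
    by (rule sum_symmetric_split)
  also have "\<dots> = K * ?R"
  proof -
    have t_add: "?t (n + j) = K * ((-1) ^ j * (gauss_binomial x (2 * n) (n + j) * (z ^ j * x ^ (j choose 2))))" for j
    proof -
      have "x ^ (n + j choose 2) * x ^ (Suc n choose 2) = x ^ (j choose 2) * x ^ (n * (n + j))"
        by (metis choose_two_add power_add)
      then have "x ^ (n + j choose 2) / (x ^ n) ^ (n + j) = x ^ (j choose 2) / x ^ (Suc n choose 2)"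
        using x by (simp add: field_simps flip: power_mult)
      moreover have "(-z) ^ (n + j) = (-z) ^ n * ((-1) ^ j * z ^ j)"
        by (simp add: power_add flip: power_mult_distrib)
      moreover have "?t (n + j) = gauss_binomial x (2 * n) (n + j) * (x ^ (n + j choose 2) / (x ^ n) ^ (n + j)) * (-z) ^ (n + j)"
        unfolding w_def power_divide by (simp only: mult_ac times_divide_eq_right times_divide_eq_left)
      ultimately show ?thesis
        by (simp only: K_def) simp
    qed
    have t_diff: "?t (n - j) = K * ((-1) ^ j * (gauss_binomial x (2 * n) (n - j) * (x ^ (Suc j choose 2) / z ^ j)))"
      if j: "j \<in> {1..n}" for j
    proof -
      have "j \<le> n" using j by simp
      then obtain m where n: "n = m + j" by (metis le_add_diff_inverse2)
      have "x ^ (m choose 2) * x ^ (Suc n choose 2) = x ^ (Suc j choose 2) * x ^ (n * m)"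
        unfolding n by (metis choose_two_diff power_add)
      then have "x ^ (m choose 2) / (x ^ n) ^ m = x ^ (Suc j choose 2) / x ^ (Suc n choose 2)"
        using x by (simp add: field_simps flip: power_mult)
      moreover have "(-z) ^ n * (-1) ^ j / z ^ j = (-z) ^ m"
      proof -
        have "(-1) ^ j * (-1) ^ j = (1 :: real)"
          by (simp flip: power_mult_distrib)
        then show ?thesis
          using z unfolding n power_add power_minus [of z j] by (simp add: mult.assoc)
      qed
      moreover have "?t m = gauss_binomial x (2 * n) m * (x ^ (m choose 2) / (x ^ n) ^ m) * (-z) ^ m"
        unfolding w_def power_divide by (simp only: mult_ac times_divide_eq_right times_divide_eq_left)
      moreover have "K * ((-1) ^ j * (G * (B / z ^ j))) = G * (B / x ^ (Suc n choose 2)) * ((-z) ^ n * (-1) ^ j / z ^ j)" for G B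
        by (simp add: K_def)
      moreover have "n - j = m" by (simp add: n)
      ultimately show ?thesis by (simp only:)
    qed
    have "?t n = K * gauss_binomial x (2 * n) n"
      using t_add [of 0] by simp
    moreover have "(\<Sum>j=1..n. ?t (n + j) + ?t (n - j)) = (\<Sum>j=1..n. K * ((-1) ^ j * (gauss_binomial x (2 * n) (n + j) * (z ^ j * x ^ (j choose 2))
       + gauss_binomial x (2 * n) (n - j) * (x ^ (Suc j choose 2) / z ^ j))))"
      by (intro sum.cong refl) (simp add: t_add t_diff distrib_left)
    ultimately show ?thesis
      by (simp add: distrib_left sum_distrib_left)
  qed
  finally show ?thesis using K by simp
qed

section \<open>q-Vandermonde summation and Bailey pairs\<close>

lemma qfac_pos: "0 < x \<Longrightarrow> x < 1 \<Longrightarrow> qfac x n > 0"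
  unfolding qfac_def by (intro prod_pos) (simp add: power_Suc_less_one del: power_Suc)

lemma gauss_binomial_eq:
  assumes "0 < x" "x < 1" "k \<le> n"
  shows "gauss_binomial x n k = qfac x n / (qfac x k * qfac x (n - k))"
  using gauss_binomial_qfac[OF assms(3), of x] qfac_pos[OF assms(1,2), of k] qfac_pos[OF assms(1,2), of "n - k"]
  by (simp add: field_simps)

text \<open>A form of the q-Vandermonde sum. Expanding the coefficient by q-Pascal splits the sum
  for \<open>Suc N\<close> and \<open>m\<close> into two, and these recombine term by term into the
  sum for \<open>N\<close> and \<open>Suc m\<close>.\<close>

lemma q_vandermonde:
  assumes "0 < x" "x < 1"
  shows "(\<Sum>k\<le>N. x ^ (k * (k + m)) * gauss_binomial x N k / qfac x (k + m)) = 1 / qfac x (N + m)"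
proof (induction N arbitrary: m)
  case (Suc N)
  note nz = qfac_pos[OF assms, THEN less_imp_neq, symmetric]
  let ?t = "\<lambda>k. x ^ (k * (k + Suc m)) * gauss_binomial x N k / qfac x (k + Suc m)"
  \<comment> \<open>Rewrite \<open>1 / qfac x (k + m)\<close> as
    \<open>(1 - x ^ Suc (k + m)) / qfac x (Suc (k + m))\<close>. The subtracted part is exactly what
    the other half of the q-Pascal recursion contributes.\<close>
  have step: "x ^ (k * (k + m)) * x ^ k * gauss_binomial x N k / qfac x (k + m)
      = ?t k - x ^ (Suc k * (Suc k + m)) * gauss_binomial x N k / qfac x (Suc k + m)" for k
    using nz[of "k + m"] nz[of "Suc (k + m)"]
    by (simp add: qfac_Suc power_add divide_simps del: power_Suc) (simp add: algebra_simps power_add)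
  have "(\<Sum>k\<le>Suc N. x ^ (k * (k + m)) * gauss_binomial x (Suc N) k / qfac x (k + m))
      = 1 / qfac x m + (\<Sum>k\<le>N. x ^ (Suc k * (Suc k + m)) * gauss_binomial x (Suc N) (Suc k) / qfac x (Suc k + m))"
    by (subst sum.atMost_Suc_shift) simp
  also have "\<dots> = (1 / qfac x m + (\<Sum>k\<le>N. x ^ (Suc k * (Suc k + m)) * x ^ Suc k * gauss_binomial x N (Suc k) / qfac x (Suc k + m)))
      + (\<Sum>k\<le>N. x ^ (Suc k * (Suc k + m)) * gauss_binomial x N k / qfac x (Suc k + m))"
    by (simp add: sum.distrib[symmetric] add_divide_distrib distrib_left mult_ac)
  also have "1 / qfac x m + (\<Sum>k\<le>N. x ^ (Suc k * (Suc k + m)) * x ^ Suc k * gauss_binomial x N (Suc k) / qfac x (Suc k + m))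
     = (\<Sum>k\<le>Suc N. x ^ (k * (k + m)) * x ^ k * gauss_binomial x N k / qfac x (k + m))"
    by (subst sum.atMost_Suc_shift) simp
  also have "\<dots> = (\<Sum>k\<le>N. x ^ (k * (k + m)) * x ^ k * gauss_binomial x N k / qfac x (k + m))"
    by (simp add: gauss_binomial_eq_0)
  also have "\<dots> + (\<Sum>k\<le>N. x ^ (Suc k * (Suc k + m)) * gauss_binomial x N k / qfac x (Suc k + m)) = (\<Sum>k\<le>N. ?t k)"
    unfolding step by (simp add: sum_subtractf)
  also have "\<dots> = 1 / qfac x (Suc N + m)"
    using Suc.IH[of "Suc m"] by simp
  finally show ?case .
qed simp

text \<open>One step along the Bailey chain; the Rogers-Ramanujan identity arises from two steps that start at the unit Bailey pair.\<close>

lemma bailey_step: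
  assumes x: "0 < x" "x < 1"
    and \<beta>: "\<And>n. \<beta> n = (\<Sum>r\<le>n. \<alpha> r / (qfac x (n - r) * qfac x (n + r)))"
  shows "(\<Sum>s\<le>n. x ^ s\<^sup>2 * \<beta> s / qfac x (n - s)) =
    (\<Sum>r\<le>n. x ^ r\<^sup>2 * \<alpha> r / (qfac x (n - r) * qfac x (n + r)))"
proof -
  note nz = qfac_pos[OF x, THEN less_imp_neq, symmetric]
  let ?f = "\<lambda>r s. x ^ s\<^sup>2 * \<alpha> r / (qfac x (s - r) * qfac x (s + r) * qfac x (n - s))"
  have "(\<Sum>s\<le>n. x ^ s\<^sup>2 * \<beta> s / qfac x (n - s)) = (\<Sum>s\<le>n. \<Sum>r\<le>s. ?f r s)"
    unfolding \<beta> by (simp add: sum_distrib_left sum_divide_distrib)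
  also have "\<dots> = (\<Sum>r\<le>n. \<Sum>s=r..n. ?f r s)"
    by (simp add: sum.Sigma) (rule sum.reindex_bij_witness[of _ prod.swap prod.swap]; auto)
  also have "\<dots> = (\<Sum>r\<le>n. x ^ r\<^sup>2 * \<alpha> r / (qfac x (n - r) * qfac x (n + r)))"
  proof (intro sum.cong refl)
    fix r assume r: "r \<in> {..n}"
    have "(\<Sum>s=r..n. ?f r s) = (\<Sum>k\<le>n - r. ?f r (r + k))"
      by (rule sum.reindex_bij_witness[of _ "\<lambda>k. r + k" "\<lambda>s. s - r"]) (use r in auto)
    \<comment> \<open>Since \<open>(r + k)\<^sup>2 = r\<^sup>2 + k * (k + 2 * r)\<close>, the inner
      sum is an instance of \<open>q_vandermonde\<close> with upper limit \<open>n - r\<close> and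
      shift \<open>2 * r\<close>.\<close>
    also have "\<dots> = (\<Sum>k\<le>n - r. x ^ r\<^sup>2 * \<alpha> r / qfac x (n - r) *
        (x ^ (k * (k + 2 * r)) * gauss_binomial x (n - r) k / qfac x (k + 2 * r)))"
    proof (intro sum.cong refl)
      fix k assume k: "k \<in> {..n - r}"
      have "(r + k)\<^sup>2 = r\<^sup>2 + k * (k + 2 * r)"
        by (simp add: power2_eq_square algebra_simps)
      then have "x ^ (r + k)\<^sup>2 = x ^ r\<^sup>2 * x ^ (k * (k + 2 * r))"
        by (simp add: power_add)
      moreover have "r + k + r = k + 2 * r" by simp
      ultimately show "?f r (r + k) = x ^ r\<^sup>2 * \<alpha> r / qfac x (n - r) *
        (x ^ (k * (k + 2 * r)) * gauss_binomial x (n - r) k / qfac x (k + 2 * r))"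
        using k by (simp only: gauss_binomial_eq[OF x] atMost_iff) (simp add: nz mult_ac)
    qed
    also have "\<dots> = x ^ r\<^sup>2 * \<alpha> r / (qfac x (n - r) * qfac x (n + r))"
      unfolding sum_distrib_left [symmetric] q_vandermonde[OF x] using r by (simp add: add.commute)
    finally show "(\<Sum>s=r..n. ?f r s) = \<dots>" .
  qed
  finally show ?thesis .
qed

text \<open>The two-sided sequence \<open>(-1)^r x^(r(r-1)/2)\<close> folded onto the nonnegative
  indices: for r > 0 the second summand is the contribution of -r.\<close>

definition unit_bailey :: "real \<Rightarrow> nat \<Rightarrow> real" where
  "unit_bailey x r = (if r = 0 then 1 else (-1) ^ r * (x ^ (r choose 2) + x ^ (Suc r choose 2)))"

text \<open>With the q-binomials written as quotients, the triple product acquires the shape of a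
  Bailey pair. It is used twice: at \<open>z = 1\<close> it yields the unit pair, and in the base
  \<open>x ^ 5\<close> with \<open>z = x\<^sup>2\<close> it yields the product side of
  Rogers-Ramanujan.\<close>

lemma finite_jacobi_qfac:
  assumes x: "0 < x" "x < 1" and z: "z \<noteq> 0"
  shows "(\<Prod>i<n. (1 - z * x ^ i) * (1 - x ^ Suc i / z)) =
    qfac x (2 * n) * (\<Sum>j\<le>n. (if j = 0 then 1 else
      (-1) ^ j * (z ^ j * x ^ (j choose 2) + x ^ (Suc j choose 2) / z ^ j)) / (qfac x (n - j) * qfac x (n + j)))"
proof -
  have "(\<Prod>i<n. (1 - z * x ^ i) * (1 - x ^ Suc i / z)) = gauss_binomial x (2 * n) n +
    (\<Sum>j=1..n. (-1) ^ j * (gauss_binomial x (2 * n) (n + j) * (z ^ j * x ^ (j choose 2))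
       + gauss_binomial x (2 * n) (n - j) * (x ^ (Suc j choose 2) / z ^ j)))"
    using x z by (intro finite_jacobi_triple_product) auto
  also have "gauss_binomial x (2 * n) n = qfac x (2 * n) / (qfac x (n - 0) * qfac x (n + 0))"
    using x by (simp add: gauss_binomial_eq)
  also have "(\<Sum>j=1..n. (-1) ^ j * (gauss_binomial x (2 * n) (n + j) * (z ^ j * x ^ (j choose 2))
       + gauss_binomial x (2 * n) (n - j) * (x ^ (Suc j choose 2) / z ^ j))) =
       (\<Sum>j=1..n. qfac x (2 * n) * (((-1) ^ j * (z ^ j * x ^ (j choose 2) + x ^ (Suc j choose 2) / z ^ j)) / (qfac x (n - j) * qfac x (n + j))))"
  proof (intro sum.cong refl)
    fix j assume "j \<in> {1..n}"
    then have "gauss_binomial x (2 * n) (n + j) = qfac x (2 * n) / (qfac x (n + j) * qfac x (n - j))"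
      "gauss_binomial x (2 * n) (n - j) = qfac x (2 * n) / (qfac x (n - j) * qfac x (n + j))"
      using x by (simp_all add: gauss_binomial_eq)
    then show "(-1) ^ j * (gauss_binomial x (2 * n) (n + j) * (z ^ j * x ^ (j choose 2))
       + gauss_binomial x (2 * n) (n - j) * (x ^ (Suc j choose 2) / z ^ j)) =
       qfac x (2 * n) * (((-1) ^ j * (z ^ j * x ^ (j choose 2) + x ^ (Suc j choose 2) / z ^ j)) / (qfac x (n - j) * qfac x (n + j)))"
      by (simp only:) (simp add: distrib_left add_divide_distrib mult_ac)
  qed
  also have "{..n} = insert 0 {1..n}" by auto
  then have "qfac x (2 * n) / (qfac x (n - 0) * qfac x (n + 0)) + (\<Sum>j=1..n. qfac x (2 * n) * (((-1) ^ j * (z ^ j * x ^ (j choose 2) + x ^ (Suc j choose 2) / z ^ j)) / (qfac x (n - j) * qfac x (n + j))))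
     = qfac x (2 * n) * (\<Sum>j\<le>n. (if j = 0 then 1 else
      (-1) ^ j * (z ^ j * x ^ (j choose 2) + x ^ (Suc j choose 2) / z ^ j)) / (qfac x (n - j) * qfac x (n + j)))"
    by (simp add: distrib_left sum_distrib_left)
  finally show ?thesis .
qed

lemma unit_bailey_pair:
  assumes x: "0 < x" "x < 1"
  shows "(\<Sum>r\<le>n. unit_bailey x r / (qfac x (n - r) * qfac x (n + r))) = (if n = 0 then 1 else 0)"
proof (cases "n = 0")
  case False
  \<comment> \<open>At \<open>z = 1\<close> the factor with \<open>i = 0\<close> is zero.\<close>
  have "(\<Prod>i<n. (1 - 1 * x ^ i) * (1 - x ^ Suc i / 1)) = 0"
    using False by (intro prod_zero) (auto intro!: bexI[of _ 0])
  then show ?thesis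
    using finite_jacobi_qfac[OF x, of 1 n] qfac_pos[OF x, of "2 * n"] False
    unfolding unit_bailey_def by (simp only:) (simp cong: if_cong)
qed (simp add: unit_bailey_def)

text \<open>On the unit pair the first step leaves only the term \<open>s = 0\<close>, so the new
  right member is \<open>1 / qfac x n\<close>; a second step turns it into the finite
  Rogers-Ramanujan sum. Each step contributes a factor \<open>x ^ r\<^sup>2\<close>, hence the
  exponent \<open>2 * r\<^sup>2\<close>.\<close>

lemma bailey_chain_two:
  assumes x: "0 < x" "x < 1"
  shows "(\<Sum>s\<le>n. x ^ s\<^sup>2 / (qfac x s * qfac x (n - s))) =
    (\<Sum>r\<le>n. x ^ (2 * r\<^sup>2) * unit_bailey x r / (qfac x (n - r) * qfac x (n + r)))"
proof -
  have 1: "1 / qfac x n = (\<Sum>r\<le>n. x ^ r\<^sup>2 * unit_bailey x r / (qfac x (n - r) * qfac x (n + r)))" for n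
    unfolding bailey_step[OF x unit_bailey_pair[OF x, symmetric], symmetric]
    by (simp add: sum.delta if_distrib if_distribR cong: if_cong)
  show ?thesis
    using bailey_step[OF x 1, of n] by (simp add: mult_2 power_add mult.assoc)
qed

section \<open>Infinite q-products and the interchange of limits\<close>

lemma summable_imp_LIMSEQ_prod:
  fixes a :: "nat \<Rightarrow> real"
  assumes "summable a" "\<And>n. 0 \<le> a n" "\<And>n. a n < 1"
  obtains L where "L > 0" "(\<lambda>n. \<Prod>i<n. 1 - a i) \<longlonglongrightarrow> L"
proof -
  have "summable (\<lambda>n. norm (1 - a n - 1))"
    using assms by simp
  then have "abs_convergent_prod (\<lambda>n. 1 - a n)"
    by (simp add: abs_convergent_prod_conv_summable)
  then have c: "convergent_prod (\<lambda>n. 1 - a n)"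
    by (rule abs_convergent_prod_imp_convergent_prod)
  have pos: "1 - a n > 0" for n using assms(3)[of n] by simp
  have lim: "(\<lambda>n. \<Prod>i<n. 1 - a i) \<longlonglongrightarrow> prodinf (\<lambda>n. 1 - a n)"
    using convergent_prod_LIMSEQ[OF c] by (simp add: LIMSEQ_lessThan_iff_atMost)
  have "prodinf (\<lambda>n. 1 - a n) \<noteq> 0"
    using c pos by (intro prodinf_nonzero) (auto simp: less_le)
  moreover have "prodinf (\<lambda>n. 1 - a n) \<ge> 0"
    using lim by (rule LIMSEQ_le_const) (intro exI[of _ 0] allI impI prod_nonneg less_imp_le pos)
  ultimately show ?thesis using lim by (intro that[of "prodinf (\<lambda>n. 1 - a n)"]) auto
qed

lemma qfac_antimono:
  assumes x: "0 < x" "x < 1" and "m \<le> n"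
  shows "qfac x n \<le> qfac x m"
  using \<open>m \<le> n\<close>
proof (rule lift_Suc_antimono_le[rotated])
  show "qfac x (Suc n) \<le> qfac x n" for n
    unfolding qfac_Suc using x qfac_pos[OF x, of n] by (intro mult_left_le) auto
qed

lemma qfac_LIMSEQ:
  assumes x: "0 < x" "x < 1"
  shows "\<exists>L>0. qfac x \<longlonglongrightarrow> L \<and> (\<forall>n. L \<le> qfac x n)"
proof -
  have "summable (\<lambda>i. x ^ Suc i)"
    using x by (subst summable_Suc_iff) (simp add: summable_geometric)
  then obtain L where L: "L > 0" "(\<lambda>n. \<Prod>i<n. 1 - x ^ Suc i) \<longlonglongrightarrow> L"
    by (rule summable_imp_LIMSEQ_prod) (use x in \<open>simp_all add: power_Suc_less_one del: power_Suc\<close>)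
  then have "qfac x \<longlonglongrightarrow> L" by (simp add: qfac_def [abs_def])
  moreover from this have "L \<le> qfac x n" for n
    by (rule LIMSEQ_le_const2) (use qfac_antimono[OF x] in blast)
  ultimately show ?thesis using L(1) by blast
qed

text \<open>Tannery's theorem for sums whose length grows together with the parameter: extend the
  summands by zero beyond \<open>n\<close>, which changes no pointwise limit.\<close>

lemma tannery_atMost:
  fixes a :: "nat \<Rightarrow> nat \<Rightarrow> real"
  assumes "\<And>k. (\<lambda>n. a k n) \<longlonglongrightarrow> b k" "\<And>k n. k \<le> n \<Longrightarrow> \<bar>a k n\<bar> \<le> M k" "summable M"
  shows "(\<lambda>n. \<Sum>k\<le>n. a k n) \<longlonglongrightarrow> suminf b" "summable b"
proof -
  let ?a = "\<lambda>k n. if k \<le> n then a k n else 0"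
  have M: "M k \<ge> 0" for k using assms(2)[of k k] by simp
  have "(\<lambda>n. ?a k n) \<longlonglongrightarrow> b k" for k
    by (rule Lim_transform_eventually[OF assms(1)[of k]])
       (use eventually_ge_at_top[of k] in eventually_elim, auto)
  moreover have "eventually (\<lambda>(k,n). norm (?a k n) \<le> M k) (at_top \<times>\<^sub>F sequentially)"
    using assms(2) M by (intro always_eventually) auto
  ultimately have *: "summable (\<lambda>n. norm (b n)) \<and> (\<lambda>n. suminf (\<lambda>k. ?a k n)) \<longlonglongrightarrow> suminf b"
    using tannerys_theorem[of ?a b sequentially M] assms(3) by simp
  have "suminf (\<lambda>k. ?a k n) = (\<Sum>k\<le>n. a k n)" for n
    by (subst suminf_finite[of "{..n}"]) auto
  with * show "(\<lambda>n. \<Sum>k\<le>n. a k n) \<longlonglongrightarrow> suminf b" "summable b"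
    by (auto intro: summable_norm_cancel)
qed

lemma summable_power_ge:
  fixes x :: real
  assumes "0 < x" "x < 1" "\<And>n. n \<le> f n"
  shows "summable (\<lambda>n. x ^ f n)"
proof (rule summable_comparison_test'[of "\<lambda>n. x ^ n" 0])
  show "summable (\<lambda>n. x ^ n)" using assms by (simp add: summable_geometric)
  show "norm (x ^ f n) \<le> x ^ n" for n
    using assms by (simp add: power_decreasing)
qed

lemma summable_rr_series:
  fixes x :: real
  assumes x: "0 < x" "x < 1"
  shows "summable (\<lambda>s. x ^ s\<^sup>2 / qfac x s)"
proof -
  obtain L where L: "L > 0" "\<forall>n. L \<le> qfac x n" using qfac_LIMSEQ[OF x] by blast
  show ?thesis
  proof (rule summable_comparison_test'[of "\<lambda>s. x ^ s\<^sup>2 / L" 0])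
    show "summable (\<lambda>s. x ^ s\<^sup>2 / L)"
      using x by (intro summable_divide summable_power_ge) (auto simp: power2_eq_square)
    show "norm (x ^ s\<^sup>2 / qfac x s) \<le> x ^ s\<^sup>2 / L" for s
      using x L(1) L(2)[rule_format, of s] by (auto intro!: divide_left_mono simp: qfac_pos)
  qed
qed

text \<open>The limit of \<open>bailey_chain_two\<close>. With \<open>L\<close> the infinite product
  \<open>(x;x)_infinity\<close>, the left side picks up \<open>L\<close> once in the denominator and
  the right side twice, so one \<open>L\<close> survives below the theta series.\<close>

lemma rogers_ramanujan_theta:
  fixes x :: real
  assumes x: "0 < x" "x < 1" and L: "L > 0" "qfac x \<longlonglongrightarrow> L" "\<forall>n. L \<le> qfac x n"
  shows "(\<Sum>s. x ^ s\<^sup>2 / qfac x s) = (\<Sum>r. x ^ (2 * r\<^sup>2) * unit_bailey x r) / L"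
    and "summable (\<lambda>r. x ^ (2 * r\<^sup>2) * unit_bailey x r)"
    and "\<And>r. \<bar>x ^ (2 * r\<^sup>2) * unit_bailey x r\<bar> \<le> 2 * x ^ r"
proof -
  have qpos: "qfac x n > 0" for n using qfac_pos[OF x] .
  have lim_diff: "(\<lambda>n. qfac x (n - r)) \<longlonglongrightarrow> L" for r
    by (rule LIMSEQ_offset[of _ r]) (simp add: L)
  have lim_add: "(\<lambda>n. qfac x (n + r)) \<longlonglongrightarrow> L" for r
    by (rule LIMSEQ_ignore_initial_segment) fact
  show bnd: "\<bar>x ^ (2 * r\<^sup>2) * unit_bailey x r\<bar> \<le> 2 * x ^ r" for r
  proof -
    have le1: "x ^ m \<le> 1" "x ^ m \<ge> 0" for m using x by (auto simp: power_le_one)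
    have "\<bar>unit_bailey x r\<bar> \<le> 2"
      using le1[of "r choose 2"] le1[of "Suc r choose 2"] by (auto simp: unit_bailey_def abs_mult)
    moreover have "x ^ (2 * r\<^sup>2) \<le> x ^ r"
      using x by (intro power_decreasing) (auto simp: power2_eq_square)
    ultimately show ?thesis
      using le1 mult_mono[of "x ^ (2 * r\<^sup>2)" "x ^ r" "\<bar>unit_bailey x r\<bar>" 2] by (simp add: abs_mult)
  qed
  show sm: "summable (\<lambda>r. x ^ (2 * r\<^sup>2) * unit_bailey x r)"
    by (rule summable_comparison_test'[of "\<lambda>r. 2 * x ^ r" 0])
       (use bnd x in \<open>auto intro!: summable_mult simp: summable_geometric\<close>)
  have "(\<lambda>n. \<Sum>s\<le>n. x ^ s\<^sup>2 / (qfac x s * qfac x (n - s))) \<longlonglongrightarrow> (\<Sum>s. x ^ s\<^sup>2 / (qfac x s * L))"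
  proof (rule tannery_atMost)
    show "(\<lambda>n. x ^ s\<^sup>2 / (qfac x s * qfac x (n - s))) \<longlonglongrightarrow> x ^ s\<^sup>2 / (qfac x s * L)" for s
      using L qpos[of s] by (intro tendsto_intros lim_diff) auto
    show "\<bar>x ^ s\<^sup>2 / (qfac x s * qfac x (n - s))\<bar> \<le> x ^ s\<^sup>2 / qfac x s / L" for s n
    proof -
      have "x ^ s\<^sup>2 / qfac x s / qfac x (n - s) \<le> x ^ s\<^sup>2 / qfac x s / L"
        using x qpos[of s] qpos[of "n - s"] L(1) L(3)[rule_format, of "n - s"]
        by (intro divide_left_mono) auto
      moreover have "x ^ s\<^sup>2 / qfac x s / qfac x (n - s) \<ge> 0"
        using x qpos[of s] qpos[of "n - s"] by simp
      ultimately show ?thesis by (simp only: divide_divide_eq_left)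
    qed
    show "summable (\<lambda>s. x ^ s\<^sup>2 / qfac x s / L)"
      by (intro summable_divide summable_rr_series x)
  qed
  moreover have "(\<lambda>n. \<Sum>r\<le>n. x ^ (2 * r\<^sup>2) * unit_bailey x r / (qfac x (n - r) * qfac x (n + r)))
       \<longlonglongrightarrow> (\<Sum>r. x ^ (2 * r\<^sup>2) * unit_bailey x r / (L * L))"
  proof (rule tannery_atMost)
    show "(\<lambda>n. x ^ (2 * r\<^sup>2) * unit_bailey x r / (qfac x (n - r) * qfac x (n + r)))
       \<longlonglongrightarrow> x ^ (2 * r\<^sup>2) * unit_bailey x r / (L * L)" for r
      using L by (intro tendsto_intros lim_diff lim_add) auto
    show "\<bar>x ^ (2 * r\<^sup>2) * unit_bailey x r / (qfac x (n - r) * qfac x (n + r))\<bar> \<le> 2 * x ^ r / (L * L)" for r n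
    proof -
      have "L * L \<le> qfac x (n - r) * qfac x (n + r)"
        using L(1) L(3)[rule_format, of "n - r"] L(3)[rule_format, of "n + r"] by (intro mult_mono) auto
      then have "\<bar>x ^ (2 * r\<^sup>2) * unit_bailey x r\<bar> / (qfac x (n - r) * qfac x (n + r)) \<le> 2 * x ^ r / (L * L)"
        using bnd[of r] L(1) x by (intro frac_le) auto
      moreover have "\<bar>qfac x (n - r) * qfac x (n + r)\<bar> = qfac x (n - r) * qfac x (n + r)"
        using qpos[of "n - r"] qpos[of "n + r"] by (intro abs_of_nonneg) simp
      ultimately show ?thesis by (simp only: abs_divide)
    qed
    show "summable (\<lambda>r. 2 * x ^ r / (L * L))"
      using x by (intro summable_divide summable_mult) (simp add: summable_geometric)
  qed
  ultimately have "(\<Sum>s. x ^ s\<^sup>2 / (qfac x s * L)) = (\<Sum>r. x ^ (2 * r\<^sup>2) * unit_bailey x r / (L * L))"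
    unfolding bailey_chain_two[OF x] by (rule LIMSEQ_unique)
  also have "(\<Sum>s. x ^ s\<^sup>2 / (qfac x s * L)) = (\<Sum>s. x ^ s\<^sup>2 / qfac x s) / L"
    using suminf_divide[OF summable_rr_series[OF x], of L] by simp
  also have "(\<Sum>r. x ^ (2 * r\<^sup>2) * unit_bailey x r / (L * L)) = (\<Sum>r. x ^ (2 * r\<^sup>2) * unit_bailey x r) / (L * L)"
    by (rule suminf_divide[OF sm])
  finally show "(\<Sum>s. x ^ s\<^sup>2 / qfac x s) = (\<Sum>r. x ^ (2 * r\<^sup>2) * unit_bailey x r) / L"
    using L(1) by (simp add: field_simps)
qed

text \<open>In the base \<open>x ^ 5\<close> with \<open>z = x\<^sup>2\<close> the exponents of the
  triple product become \<open>2 * j + 5 * (j choose 2) = 2 * j\<^sup>2 + (j choose 2)\<close> and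
  its mirror image. Its sum is thus the same theta series that the Bailey chain produces, and the
  limits of \<open>qfac (x ^ 5)\<close> cancel.\<close>

lemma jacobi_product_limit:
  fixes x :: real
  assumes x: "0 < x" "x < 1"
  shows "(\<lambda>n. qfac (x ^ 5) n * (\<Prod>i<n. (1 - x ^ (5 * i + 2)) * (1 - x ^ (5 * i + 3))))
           \<longlonglongrightarrow> (\<Sum>r. x ^ (2 * r\<^sup>2) * unit_bailey x r)"
proof -
  define y where "y = x ^ 5"
  have y: "0 < y" "y < 1" using x power_Suc_less_one[of x 4] by (simp_all add: y_def)
  obtain K where K: "K > 0" "qfac x \<longlonglongrightarrow> K" "\<forall>n. K \<le> qfac x n"
    using qfac_LIMSEQ[OF x] by (elim exE conjE)
  note theta = rogers_ramanujan_theta[OF x K]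
  obtain L where L: "L > 0" "qfac y \<longlonglongrightarrow> L" "\<forall>n. L \<le> qfac y n"
    using qfac_LIMSEQ[OF y] by (elim exE conjE)
  have qpos: "qfac y n > 0" for n using qfac_pos[OF y] .
  have qle: "qfac y n \<le> 1" for n using qfac_antimono[OF y, of 0 n] by simp
  have lim_diff: "(\<lambda>n. qfac y (n - r)) \<longlonglongrightarrow> L" for r
    by (rule LIMSEQ_offset[of _ r]) (simp add: L)
  have lim_add: "(\<lambda>n. qfac y (n + r)) \<longlonglongrightarrow> L" for r
    by (rule LIMSEQ_ignore_initial_segment) fact
  have lim2: "(\<lambda>n. qfac y (2 * n)) \<longlonglongrightarrow> L"
    using LIMSEQ_subseq_LIMSEQ[OF L(2), of "\<lambda>n. 2 * n"] by (simp add: strict_mono_def o_def)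
  let ?\<theta> = "\<lambda>r. x ^ (2 * r\<^sup>2) * unit_bailey x r"
  have \<theta>: "(if j = 0 then 1 else (-1) ^ j * ((x ^ 2) ^ j * y ^ (j choose 2) + y ^ (Suc j choose 2) / (x ^ 2) ^ j)) = ?\<theta> j" for j
  proof -
    have e1: "2 * j + 5 * (j choose 2) = 2 * j\<^sup>2 + (j choose 2)"
      by (induction j) (simp_all add: choose_two_Suc power2_eq_square)
    have e2: "5 * (Suc j choose 2) = 2 * j\<^sup>2 + (Suc j choose 2) + 2 * j"
      by (induction j) (simp_all add: choose_two_Suc power2_eq_square)
    have "(x ^ 2) ^ j * y ^ (j choose 2) = x ^ (2 * j\<^sup>2) * x ^ (j choose 2)"
      unfolding y_def power_mult [symmetric] power_add [symmetric] e1 ..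
    moreover have "y ^ (Suc j choose 2) / (x ^ 2) ^ j = x ^ (2 * j\<^sup>2) * x ^ (Suc j choose 2)"
      unfolding y_def power_mult [symmetric] e2 using x by (simp add: power_add)
    ultimately show ?thesis
      unfolding unit_bailey_def by (simp only: distrib_left mult.left_commute [of "x ^ _"] if_distrib) simp
  qed
  have prod_eq: "(\<Prod>i<n. (1 - x ^ (5 * i + 2)) * (1 - x ^ (5 * i + 3))) =
      qfac y (2 * n) * (\<Sum>j\<le>n. ?\<theta> j / (qfac y (n - j) * qfac y (n + j)))" for n
  proof -
    have "(1 - x ^ (5 * i + 2)) * (1 - x ^ (5 * i + 3)) = (1 - x\<^sup>2 * y ^ i) * (1 - y ^ Suc i / x\<^sup>2)" for i
    proof -
      have "y ^ Suc i = x ^ (5 * i + 3) * x\<^sup>2"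
        unfolding y_def power_mult [symmetric] power_add [symmetric] by simp
      moreover have "x ^ (5 * i + 2) = x\<^sup>2 * y ^ i"
        unfolding y_def power_mult [symmetric] power_add [symmetric] by simp
      ultimately show ?thesis using x by simp
    qed
    then show ?thesis
      using finite_jacobi_qfac[OF y, of "x\<^sup>2" n] x unfolding \<theta> by simp
  qed
  have lim_sum: "(\<lambda>n. \<Sum>j\<le>n. ?\<theta> j / (qfac y (n - j) * qfac y (n + j))) \<longlonglongrightarrow> (\<Sum>j. ?\<theta> j / (L * L))"
  proof (rule tannery_atMost)
    show "(\<lambda>n. ?\<theta> r / (qfac y (n - r) * qfac y (n + r))) \<longlonglongrightarrow> ?\<theta> r / (L * L)" for r
      using L by (intro tendsto_intros lim_diff lim_add) auto
    show "\<bar>?\<theta> r / (qfac y (n - r) * qfac y (n + r))\<bar> \<le> 2 * x ^ r / (L * L)" for r n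
    proof -
      have "L * L \<le> qfac y (n - r) * qfac y (n + r)"
        using L(1) L(3)[rule_format, of "n - r"] L(3)[rule_format, of "n + r"] by (intro mult_mono) auto
      then have "\<bar>?\<theta> r\<bar> / (qfac y (n - r) * qfac y (n + r)) \<le> 2 * x ^ r / (L * L)"
        using theta(3)[of r] L(1) x by (intro frac_le) auto
      moreover have "\<bar>qfac y (n - r) * qfac y (n + r)\<bar> = qfac y (n - r) * qfac y (n + r)"
        using qpos[of "n - r"] qpos[of "n + r"] by (intro abs_of_nonneg) simp
      ultimately show ?thesis by (simp only: abs_divide)
    qed
    show "summable (\<lambda>r. 2 * x ^ r / (L * L))"
      using x by (intro summable_divide summable_mult) (simp add: summable_geometric)
  qed
  have "(\<lambda>n. qfac y n * (\<Prod>i<n. (1 - x ^ (5 * i + 2)) * (1 - x ^ (5 * i + 3))))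
      \<longlonglongrightarrow> L * (L * (\<Sum>j. ?\<theta> j / (L * L)))"
    unfolding prod_eq by (rule tendsto_mult[OF L(2) tendsto_mult[OF lim2 lim_sum]])
  also have "L * (L * (\<Sum>j. ?\<theta> j / (L * L))) = (\<Sum>j. ?\<theta> j)"
    using L(1) by (subst suminf_divide[OF theta(2)]) simp
  finally show ?thesis unfolding y_def .
qed

lemma qfac_mult_5:
  "qfac x (5 * n) = qfac (x ^ 5) n * (\<Prod>i<n. (1 - x ^ (5 * i + 2)) * (1 - x ^ (5 * i + 3)))
     * (\<Prod>i<n. (1 - x ^ (5 * i + 1)) * (1 - x ^ (5 * i + 4)))"
proof (induction n)
  case (Suc n)
  have e: "5 * Suc n = Suc (Suc (Suc (Suc (Suc (5 * n)))))" "5 * n + 1 = Suc (5 * n)"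
    "5 * n + 2 = Suc (Suc (5 * n))" "5 * n + 3 = Suc (Suc (Suc (5 * n)))"
    "5 * n + 4 = Suc (Suc (Suc (Suc (5 * n))))" "5 * n + 5 = Suc (Suc (Suc (Suc (Suc (5 * n)))))"
    by simp_all
  have 1: "qfac x (5 * Suc n) = qfac x (5 * n) * (1 - x ^ (5 * n + 1)) * (1 - x ^ (5 * n + 2))
      * (1 - x ^ (5 * n + 3)) * (1 - x ^ (5 * n + 4)) * (1 - x ^ (5 * n + 5))"
    unfolding e qfac_Suc ..
  have 2: "(x ^ 5) ^ Suc n = x ^ (5 * n + 5)"
    unfolding power_mult [symmetric] e ..
  have alg: "A * P * Q * a * b * c * d * f = A * f * (P * (b * c)) * (Q * (a * d))"
    for A P Q a b c d f :: real
    by simp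
  show ?case
    unfolding 1 Suc.IH prod.lessThan_Suc qfac_Suc[of "x ^ 5"] 2 by (rule alg)
qed simp

text \<open>The sum equals the theta series divided by \<open>(x;x)_infinity\<close>. The theta
  series is the product over the exponents congruent to 0, 2, 3 modulo 5, so the quotient keeps the
  exponents congruent to 1 and 4 in the denominator.\<close>

theorem rogers_ramanujan:
  fixes x :: real
  assumes x: "0 < x" "x < 1"
  shows "(\<lambda>n. \<Prod>i<n. 1 / ((1 - x ^ (5 * i + 1)) * (1 - x ^ (5 * i + 4)))) \<longlonglongrightarrow> (\<Sum>s. x ^ s\<^sup>2 / qfac x s)"
proof -
  obtain L where L: "L > 0" "qfac x \<longlonglongrightarrow> L" "\<forall>n. L \<le> qfac x n"
    using qfac_LIMSEQ[OF x] by (elim exE conjE)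
  have lim5: "(\<lambda>n. qfac x (5 * n)) \<longlonglongrightarrow> L"
    using LIMSEQ_subseq_LIMSEQ[OF L(2), of "\<lambda>n. 5 * n"] by (simp add: strict_mono_def o_def)
  have "(\<lambda>n. qfac (x ^ 5) n * (\<Prod>i<n. (1 - x ^ (5 * i + 2)) * (1 - x ^ (5 * i + 3))) / qfac x (5 * n))
      \<longlonglongrightarrow> (\<Sum>r. x ^ (2 * r\<^sup>2) * unit_bailey x r) / L"
    using L(1) by (intro tendsto_divide jacobi_product_limit x lim5) auto
  moreover have "qfac (x ^ 5) n * (\<Prod>i<n. (1 - x ^ (5 * i + 2)) * (1 - x ^ (5 * i + 3))) / qfac x (5 * n)
      = (\<Prod>i<n. 1 / ((1 - x ^ (5 * i + 1)) * (1 - x ^ (5 * i + 4))))" for n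
  proof -
    have eq: "qfac x (5 * n) = A * B \<Longrightarrow> A / qfac x (5 * n) = 1 / B" for A B
      using qfac_pos[OF x, of "5 * n"] by auto
    show ?thesis unfolding eq[OF qfac_mult_5] by (simp add: prod_dividef)
  qed
  ultimately show ?thesis
    unfolding rogers_ramanujan_theta(1)[OF x L] by simp
qed

section \<open>Monic irreducible polynomials over a finite field\<close>

text \<open>A nonzero element \<open>g\<close> of least degree in the ideal generated by
  \<open>p\<close> and \<open>a\<close> divides both, by division with remainder. Irreducibility
  makes \<open>g\<close> or its cofactor in \<open>p\<close> a unit; the latter would give
  \<open>p dvd a\<close>.\<close>

lemma irreducible_bezout:
  fixes p a :: "'a :: field poly"
  assumes irr: "irreducible p" and nd: "\<not> p dvd a"
  shows "\<exists>u v. u * p + v * a = 1"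
proof -
  define I where "I = {u * p + v * a | u v. True}"
  have p0: "p \<noteq> 0" using irr by auto
  have "1 * p + 0 * a \<in> I" unfolding I_def by blast
  then have "p \<in> I" by simp
  have "0 * p + 1 * a \<in> I" unfolding I_def by blast
  then have "a \<in> I" by simp
  obtain g where g: "g \<in> I" "g \<noteq> 0" "\<And>h. h \<in> I \<Longrightarrow> h \<noteq> 0 \<Longrightarrow> degree g \<le> degree h"
    using ex_has_least_nat[of "\<lambda>h. h \<in> I \<and> h \<noteq> 0" p degree] \<open>p \<in> I\<close> p0 by blast
  have dvd: "g dvd x" if x: "x \<in> I" for x
  proof (rule ccontr)
    assume "\<not> g dvd x"
    then have nz: "x mod g \<noteq> 0" by (simp add: dvd_eq_mod_eq_0)
    obtain u v u' v' where "x = u * p + v * a" "g = u' * p + v' * a"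
      using x g(1) by (auto simp: I_def)
    then have "x mod g = (u - x div g * u') * p + (v - x div g * v') * a"
      by (simp add: minus_div_mult_eq_mod [symmetric] algebra_simps)
    then have "x mod g \<in> I" unfolding I_def by blast
    with g(3) nz have "degree g \<le> degree (x mod g)" by blast
    with degree_mod_less'[OF g(2) nz] show False by simp
  qed
  obtain h where h: "p = g * h" using dvd[OF \<open>p \<in> I\<close>] by (rule dvdE)
  have "\<not> h dvd 1"
  proof
    assume "h dvd 1"
    then have "p dvd g" using h by (simp add: dvd_mult_unit_iff)
    then show False using dvd[OF \<open>a \<in> I\<close>] nd dvd_trans by blast
  qed
  then have "g dvd 1" using irreducibleD[OF irr h] by blast
  then obtain k where "1 = g * k" by (rule dvdE)
  moreover obtain u v where "g = u * p + v * a" using g(1) by (auto simp: I_def)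
  ultimately have "(k * u) * p + (k * v) * a = 1" by (simp add: algebra_simps)
  then show ?thesis by blast
qed

definition monic_irreducible :: "'a :: field poly \<Rightarrow> bool" where
  "monic_irreducible p \<longleftrightarrow> irreducible p \<and> lead_coeff p = 1"

definition monic_polys :: "nat \<Rightarrow> 'a :: field poly set" where
  "monic_polys n = {p. lead_coeff p = 1 \<and> degree p = n}"

lemma irreducible_degree_pos:
  fixes p :: "'a :: field poly"
  assumes "irreducible p" shows "degree p > 0"
proof (rule ccontr)
  assume "\<not> degree p > 0"
  then have "p dvd 1" using assms by (subst is_unit_iff_degree) auto
  then show False using assms irreducible_not_unit by blast
qed

lemma monic_dvd_degree_le:
  fixes p g :: "'a :: field poly"
  assumes "p dvd g" "degree g \<le> degree p" "lead_coeff p = 1" "lead_coeff g = 1"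
  shows "p = g"
proof -
  obtain h where h: "g = p * h" using assms(1) by (rule dvdE)
  have "p \<noteq> 0" "h \<noteq> 0" using assms h by auto
  then have "degree h = 0" using h assms(2) by (simp add: degree_mult_eq)
  then obtain c where c: "h = [:c:]" by (rule degree_eq_zeroE)
  with h assms show ?thesis by (cases "c = 0") auto
qed

lemma monic_irreducible_dvd_eq:
  assumes "monic_irreducible p" "monic_irreducible r" "p dvd r"
  shows "p = r"
proof -
  obtain h where h: "r = p * h" using assms(3) by (rule dvdE)
  have "\<not> p dvd 1" using assms irreducible_not_unit by (auto simp: monic_irreducible_def)
  then have "h dvd 1" using irreducibleD[OF _ h] assms by (auto simp: monic_irreducible_def)
  then have "degree h = 0" using is_unit_iff_degree[of h] by force
  then have "degree r \<le> degree p" using h degree_mult_le[of p h] by simp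
  then show ?thesis using assms by (intro monic_dvd_degree_le) (auto simp: monic_irreducible_def)
qed

lemma monic_irreducible_dvd_prod:
  assumes "finite S" "\<forall>r\<in>S. monic_irreducible r" "monic_irreducible p" "p dvd \<Prod>S"
  shows "p \<in> S"
proof -
  have "prime_elem p" using assms by (auto simp: monic_irreducible_def field_poly_irreducible_imp_prime)
  have "\<exists>r\<in>S. p dvd r"
    using assms(1,4)
  proof (induction S rule: finite_induct)
    case empty
    then show ?case using prime_elem_not_unit[OF \<open>prime_elem p\<close>] unfolding prod.empty by blast
  next
    case (insert r S)
    then show ?case using \<open>prime_elem p\<close> by (auto simp: prime_elem_dvd_mult_iff)
  qed
  then obtain r where "r \<in> S" "p dvd r" by blast
  then show ?thesis using assms monic_irreducible_dvd_eq by metis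
qed

text \<open>A nonconstant divisor of least degree is irreducible; dividing by its leading
  coefficient makes it monic.\<close>

lemma exists_monic_irreducible_factor:
  fixes p :: "'a :: field poly"
  assumes "degree p > 0"
  shows "\<exists>r. monic_irreducible r \<and> r dvd p \<and> degree r \<le> degree p"
proof -
  have "p dvd p \<and> degree p > 0" using assms by simp
  from ex_has_least_nat[of "\<lambda>h. h dvd p \<and> degree h > 0", OF this, of degree]
  obtain g where g: "g dvd p" "degree g > 0" "\<forall>h. h dvd p \<and> degree h > 0 \<longrightarrow> degree g \<le> degree h"
    by (elim exE conjE)
  have g0: "g \<noteq> 0" using g(2) by auto
  have "irreducible g"
  proof (rule irreducibleI)
    show "\<not> g dvd 1" using g(2) g0 by (simp add: is_unit_iff_degree)
    fix a b assume ab: "g = a * b"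
    then have nz: "a \<noteq> 0" "b \<noteq> 0" using g0 by auto
    have "a dvd p" "b dvd p" using g(1) ab by (auto dest: dvd_mult_left dvd_mult_right)
    then have "degree a = 0 \<or> degree g \<le> degree a" "degree b = 0 \<or> degree g \<le> degree b"
      using g(3) gr0I by blast+
    moreover have "degree g = degree a + degree b" using ab nz by (simp add: degree_mult_eq)
    ultimately have "degree a = 0 \<or> degree b = 0" by linarith
    then show "a dvd 1 \<or> b dvd 1" using nz by (simp add: is_unit_iff_degree)
  qed (use g0 in simp)
  let ?c = "inverse (lead_coeff g)"
  have c: "?c \<noteq> 0" using g0 by simp
  have "irreducible (smult ?c g)"
  proof -
    have "[:?c:] dvd 1" using c by (simp add: is_unit_pCons_iff)
    then have "irreducible ([:?c:] * g)" using \<open>irreducible g\<close> irreducible_mult_unit_left by blast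
    then show ?thesis by simp
  qed
  moreover have "lead_coeff (smult ?c g) = 1" using g0 by simp
  moreover have "smult ?c g dvd p" using g(1) c by (simp add: smult_dvd)
  moreover have "degree (smult ?c g) \<le> degree p" using g(3)[rule_format, of p] assms c by simp
  ultimately show ?thesis unfolding monic_irreducible_def by blast
qed

lemma monic_polys_0: "monic_polys 0 = {1 :: 'a :: field poly}"
  by (auto simp: monic_polys_def elim!: degree_eq_zeroE)

lemma monic_polys_Suc:
  "monic_polys (Suc n) = (\<lambda>(a, p). pCons a p) ` (UNIV \<times> (monic_polys n :: 'a :: field poly set))"
proof (intro Set.set_eqI iffI)
  fix p :: "'a poly" assume p: "p \<in> monic_polys (Suc n)"
  obtain a r where r: "p = pCons a r" by (cases p)
  then have "r \<noteq> 0" using p by (auto simp: monic_polys_def)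
  then have "r \<in> monic_polys n" using p r by (auto simp: monic_polys_def)
  then show "p \<in> (\<lambda>(a, p). pCons a p) ` (UNIV \<times> monic_polys n)" using r by auto
next
  fix p assume "p \<in> (\<lambda>(a, p). pCons a p) ` (UNIV \<times> (monic_polys n :: 'a :: field poly set))"
  then obtain a r where "p = pCons a r" "r \<in> monic_polys n" by auto
  moreover from this have "r \<noteq> 0" by (auto simp: monic_polys_def)
  ultimately show "p \<in> monic_polys (Suc n)" by (auto simp: monic_polys_def)
qed

lemma card_monic_polys:
  "finite (monic_polys n :: 'a :: {field, finite} poly set) \<and>
   card (monic_polys n :: 'a poly set) = CARD('a) ^ n"
proof (induction n)
  case (Suc n)
  have "inj_on (\<lambda>(a, p). pCons a p) (UNIV \<times> (monic_polys n :: 'a poly set))"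
    by (auto simp: inj_on_def)
  then show ?case using Suc by (simp add: monic_polys_Suc card_image card_cartesian_product)
qed (simp add: monic_polys_0)

section \<open>The sieve and its Euler product\<close>

definition irreducibles_upto :: "nat \<Rightarrow> 'a :: field poly set" where
  "irreducibles_upto D = {p. monic_irreducible p \<and> degree p \<le> D}"

lemma finite_irreducibles_upto: "finite (irreducibles_upto D :: 'a :: {field, finite} poly set)"
proof (rule finite_subset)
  show "irreducibles_upto D \<subseteq> (\<Union>n\<le>D. monic_polys n :: 'a poly set)"
    by (auto simp: irreducibles_upto_def monic_polys_def monic_irreducible_def)
qed (use card_monic_polys in auto)

text \<open>Sieving the monic polynomials by the multiples of finitely many irreducible ones
  replaces the Euler product over all irreducible polynomials.\<close>

definition sifted :: "'a :: field poly set \<Rightarrow> nat \<Rightarrow> 'a poly set" where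
  "sifted S n = {p \<in> monic_polys n. \<forall>r\<in>S. \<not> r dvd p}"

lemma finite_sifted: "finite (sifted S n :: 'a :: {field, finite} poly set)"
  unfolding sifted_def using card_monic_polys[where 'a = 'a, of n] by auto

text \<open>The survivors lost by adding \<open>p\<close> are the multiples \<open>p * h\<close>
  with \<open>h\<close> itself surviving: a member of \<open>S\<close> dividing \<open>p * h\<close>
  is prime, hence divides \<open>h\<close> or coincides with \<open>p\<close>, and both are
  excluded.\<close>

lemma card_sifted_insert:
  fixes S :: "'a :: {field, finite} poly set"
  assumes S: "\<forall>r\<in>S. monic_irreducible r" and p: "monic_irreducible p" "p \<notin> S"
  shows "card (sifted S n) = card (sifted (insert p S) n) +
     (if n < degree p then 0 else card (sifted S (n - degree p)))"
proof -
  have p0: "p \<noteq> 0" and lp: "lead_coeff p = 1" using p by (auto simp: monic_irreducible_def)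
  let ?M = "{g \<in> sifted S n. p dvd g}"
  have "card (sifted S n) = card (sifted (insert p S) n) + card ?M"
  proof -
    have "sifted S n = sifted (insert p S) n \<union> ?M" "sifted (insert p S) n \<inter> ?M = {}"
      by (auto simp: sifted_def)
    moreover have "finite ?M" using finite_sifted[of S n] by simp
    ultimately show ?thesis
      using card_Un_disjoint[of "sifted (insert p S) n" ?M] finite_sifted[of "insert p S" n] by simp
  qed
  moreover have "card ?M = (if n < degree p then 0 else card (sifted S (n - degree p)))"
  proof (cases "n < degree p")
    case True
    then have "?M = {}" using p0
      by (auto simp: sifted_def monic_polys_def dest!: dvd_imp_degree_le)
    then show ?thesis using True by (simp only: card.empty if_True)
  next
    case False
    have "?M = (\<lambda>g. p * g) ` sifted S (n - degree p)"
    proof (intro Set.set_eqI iffI)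
      fix g assume g: "g \<in> ?M"
      then obtain h where h: "g = p * h" by blast
      have "g \<noteq> 0" using g by (auto simp: sifted_def monic_polys_def)
      then have "p \<noteq> 0" "h \<noteq> 0" using h by auto
      have "lead_coeff g = lead_coeff p * lead_coeff h" unfolding h by (rule lead_coeff_mult)
      moreover have "degree g = degree p + degree h" unfolding h by (rule degree_mult_eq) fact+
      ultimately have "h \<in> monic_polys (n - degree p)"
        using g lp by (auto simp: sifted_def monic_polys_def)
      moreover have "\<not> r dvd h" if "r \<in> S" for r
      proof
        assume "r dvd h"
        then have "r dvd g" unfolding h by (rule dvd_mult)
        with g that show False by (auto simp: sifted_def)
      qed
      ultimately have "h \<in> sifted S (n - degree p)" by (simp add: sifted_def)
      then show "g \<in> (\<lambda>g. p * g) ` sifted S (n - degree p)" using h by blast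
    next
      fix g assume "g \<in> (\<lambda>g. p * g) ` sifted S (n - degree p)"
      then obtain h where h: "g = p * h" "h \<in> sifted S (n - degree p)" by blast
      have "h \<noteq> 0" using h by (auto simp: sifted_def monic_polys_def)
      moreover have "\<not> r dvd p * h" if "r \<in> S" for r
      proof
        assume "r dvd p * h"
        moreover have "prime_elem r" using S that by (auto simp: monic_irreducible_def field_poly_irreducible_imp_prime)
        ultimately have "r dvd p \<or> r dvd h" by (simp add: prime_elem_dvd_mult_iff)
        moreover have "\<not> r dvd h" using h(2) that by (auto simp: sifted_def)
        moreover have "monic_irreducible r" using S that by blast
        ultimately have "r = p" using monic_irreducible_dvd_eq[of r p] p(1) by simp
        then show False using p(2) that by simp
      qed
      moreover have "lead_coeff g = lead_coeff p * lead_coeff h" unfolding h(1) by (rule lead_coeff_mult)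
      moreover have "degree g = degree p + degree h" unfolding h(1) by (rule degree_mult_eq) fact+
      ultimately show "g \<in> ?M" using h lp False
        by (auto simp: sifted_def monic_polys_def)
    qed
    then show ?thesis using False p0 by (simp add: card_image inj_on_def)
  qed
  ultimately show ?thesis by simp
qed

text \<open>For empty \<open>S\<close> the series is geometric, since there are
  \<open>CARD('a) ^ n\<close> monic polynomials of degree \<open>n\<close>. Each added polynomial
  multiplies the series by \<open>1 - fps_X ^ degree p\<close>.\<close>

lemma sifted_euler_product:
  fixes S :: "'a :: {field, finite} poly set"
  assumes "finite S" "\<forall>r\<in>S. monic_irreducible r"
  shows "Abs_fps (\<lambda>n. real (card (sifted S n))) * (1 - fps_const (real CARD('a)) * fps_X)
    = (\<Prod>r\<in>S. 1 - fps_X ^ degree r)"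
  using assms
proof (induction S rule: finite_induct)
  case empty
  have "Abs_fps (\<lambda>n. real (card (sifted {} n :: 'a poly set))) * (1 - fps_const (real CARD('a)) * fps_X) = 1"
    (is "?f * _ = 1")
  proof (rule fps_ext)
    fix n
    have "(?f * (1 - fps_const (real CARD('a)) * fps_X)) $ n
      = ?f $ n - real CARD('a) * (fps_X * ?f) $ n"
      by (simp add: algebra_simps)
    then show "(?f * (1 - fps_const (real CARD('a)) * fps_X)) $ n = (1 :: real fps) $ n"
      using card_monic_polys[where 'a = 'a] by (cases n) (simp_all add: sifted_def)
  qed
  then show ?case by simp
next
  case (insert p S)
  let ?f = "\<lambda>S. Abs_fps (\<lambda>n. real (card (sifted S n)))"
  have "?f (insert p S) = (1 - fps_X ^ degree p) * ?f S"
    using card_sifted_insert[of S p] insert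
    by (intro fps_ext) (simp add: left_diff_distrib fps_X_power_mult_nth)
  then show ?case
    using insert by (simp add: mult.assoc)
qed

text \<open>A polynomial of degree between 1 and \<open>D\<close> has an irreducible factor of
  degree at most \<open>D\<close>. The sifted series therefore agrees with 1 up to degree
  \<open>D\<close>, which is what makes truncation exact.\<close>

lemma card_sifted_upto:
  assumes "0 < n" "n \<le> D"
  shows "card (sifted (irreducibles_upto D) n :: 'a :: {field, finite} poly set) = 0"
proof -
  have "sifted (irreducibles_upto D) n = ({} :: 'a poly set)"
  proof (rule equals0I)
    fix p :: "'a poly" assume p: "p \<in> sifted (irreducibles_upto D) n"
    then have "degree p = n" by (auto simp: sifted_def monic_polys_def)
    with assms obtain r where "monic_irreducible r" "r dvd p" "degree r \<le> D"
      using exists_monic_irreducible_factor[of p] le_trans by blast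
    with p show False by (auto simp: sifted_def irreducibles_upto_def)
  qed
  then show ?thesis by simp
qed

lemma card_sifted_0:
  assumes "\<forall>r\<in>S. monic_irreducible r"
  shows "card (sifted S 0 :: 'a :: field poly set) = 1"
proof -
  have "sifted S 0 = {1}"
    using assms irreducible_not_unit by (auto simp: sifted_def monic_polys_0 monic_irreducible_def)
  then show ?thesis by simp
qed

lemma card_sifted_le: "card (sifted S n :: 'a :: {field, finite} poly set) \<le> CARD('a) ^ n"
proof -
  have "card (sifted S n) \<le> card (monic_polys n :: 'a poly set)"
    using card_monic_polys[where 'a = 'a] by (intro card_mono) (auto simp: sifted_def)
  then show ?thesis using card_monic_polys[where 'a = 'a] by simp
qed

text \<open>The source of separability, since \<open>X^N - X\<close> has derivative -1 when the
  characteristic divides \<open>N\<close>. Modulo \<open>p\<close> there are finitely many residues,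
  so two iterated Frobenius powers of \<open>X\<close> coincide; their difference is a power of
  \<open>X^(c^(j-i)) - X\<close> by the freshman's dream, and \<open>p\<close> is prime.\<close>

lemma irreducible_dvd_frobenius_minus_id:
  fixes p :: "'a :: finite_field poly"
  assumes "irreducible p"
  shows "\<exists>k>0. p dvd [:0, 1:] ^ (CHAR('a) ^ k) - [:0, 1:]"
proof -
  define Z where "Z = [:0, 1 :: 'a:]"
  let ?c = "CHAR('a)"
  have pr: "prime ?c" by (rule prime_CHAR_semidom) (simp add: finite_imp_CHAR_pos)
  have prp: "prime CHAR('a poly)" using pr by simp
  let ?R = "{r :: 'a poly. degree r < degree p}"
  have fin: "finite ?R"
  proof -
    have "?R \<subseteq> Poly ` {xs. set xs \<subseteq> UNIV \<and> length xs \<le> degree p}"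
    proof
      fix r :: "'a poly" assume r: "r \<in> ?R"
      have "r = Poly (coeffs r)" by simp
      moreover have "length (coeffs r) \<le> degree p"
        using r by (cases "r = 0") (auto simp: length_coeffs)
      ultimately show "r \<in> Poly ` {xs. set xs \<subseteq> UNIV \<and> length xs \<le> degree p}" by blast
    qed
    then show ?thesis by (rule finite_subset) (intro finite_imageI finite_lists_length_le finite)
  qed
  have dp: "degree p > 0" using irreducible_degree_pos[OF assms] .
  let ?f = "\<lambda>i. Z ^ (?c ^ i) mod p"
  have "?f i \<in> ?R" for i
    using dp degree_mod_less[of p "Z ^ (?c ^ i)"] by (cases "p = 0") auto
  then have sub: "range ?f \<subseteq> ?R" by blast
  have "\<not> inj ?f"
  proof
    assume "inj ?f"
    moreover have "finite (range ?f)" using sub fin by (rule finite_subset)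
    ultimately have "finite (UNIV :: nat set)" by (rule finite_imageD[rotated])
    then show False by simp
  qed
  then obtain i j where "i \<noteq> j" "?f i = ?f j" unfolding inj_def by blast
  then obtain i j where ij: "i < j" "?f i = ?f j" by (metis linorder_neqE_nat)
  define m where "m = ?c ^ i"
  define Y where "Y = Z ^ (?c ^ (j - i))"
  have "?c ^ (j - i) * m = ?c ^ j"
    using ij by (simp add: m_def flip: power_add)
  then have "Z ^ (?c ^ j) = Y ^ m"
    unfolding Y_def by (simp flip: power_mult)
  moreover have "(Y - Z + Z) ^ m = (Y - Z) ^ m + Z ^ m"
    by (rule freshmans_dream'[OF prp, of m i]) (simp add: m_def)
  ultimately have "Z ^ (?c ^ j) - Z ^ (?c ^ i) = (Y - Z) ^ m" by (simp add: m_def)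
  moreover have "p dvd Z ^ (?c ^ j) - Z ^ (?c ^ i)"
    using ij by (intro mod_eq_dvd_iff[THEN iffD1]) simp
  ultimately have "p dvd (Y - Z) ^ m" by simp
  then have "p dvd Y - Z"
    by (rule prime_elem_dvd_power[OF field_poly_irreducible_imp_prime[OF assms]])
  then show ?thesis using ij unfolding Y_def Z_def by (intro exI[of _ "j - i"]) simp
qed

section \<open>Operators annihilated by a polynomial\<close>

locale operator_space = vector_space scale
  for scale :: "'a :: field \<Rightarrow> 'b :: ab_group_add \<Rightarrow> 'b"
begin

definition lin_on :: "'b set \<Rightarrow> ('b \<Rightarrow> 'b) \<Rightarrow> bool" where
  "lin_on V T \<longleftrightarrow> (\<forall>u\<in>V. \<forall>v\<in>V. T (u + v) = T u + T v) \<and>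
     (\<forall>c. \<forall>v\<in>V. T (scale c v) = scale c (T v)) \<and> (\<forall>v\<in>V. T v \<in> V)"

definition poly_op :: "('b \<Rightarrow> 'b) \<Rightarrow> 'a poly \<Rightarrow> 'b \<Rightarrow> 'b" where
  "poly_op T p v = (\<Sum>i\<le>degree p. scale (coeff p i) ((T ^^ i) v))"

lemma poly_op_altdef:
  assumes "degree p \<le> N"
  shows "poly_op T p v = (\<Sum>i\<le>N. scale (coeff p i) ((T ^^ i) v))"
  unfolding poly_op_def
  by (rule sum.mono_neutral_left) (use assms in \<open>auto intro: coeff_eq_0\<close>)

lemma poly_op_0 [simp]: "poly_op T 0 v = 0"
  and poly_op_1 [simp]: "poly_op T 1 v = v"
  and poly_op_const [simp]: "poly_op T [:c:] v = scale c v"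
  by (simp_all add: poly_op_def)

lemma poly_op_add: "poly_op T (p + r) v = poly_op T p v + poly_op T r v"
proof -
  let ?N = "max (degree p) (degree r)"
  have "degree (p + r) \<le> ?N" by (rule degree_add_le_max)
  then show ?thesis
    by (simp add: poly_op_altdef[of _ ?N] scale_left_distrib sum.distrib)
qed

lemma poly_op_smult: "poly_op T (smult c p) v = scale c (poly_op T p v)"
  by (simp add: poly_op_altdef[of _ "degree p"] degree_smult_le scale_sum_right)

lemma poly_op_pCons: "poly_op T (pCons a p) v = scale a v + poly_op T p (T v)"
proof -
  have "poly_op T (pCons a p) v = (\<Sum>i\<le>Suc (degree p). scale (coeff (pCons a p) i) ((T ^^ i) v))"
    by (rule poly_op_altdef) (rule degree_pCons_le)
  also have "\<dots> = scale a v + (\<Sum>i\<le>degree p. scale (coeff p i) ((T ^^ i) (T v)))"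
    by (subst sum.atMost_Suc_shift) (simp add: funpow_swap1)
  finally show ?thesis by (simp add: poly_op_def)
qed

lemma lin_onD:
  assumes "lin_on V T"
  shows "u \<in> V \<Longrightarrow> v \<in> V \<Longrightarrow> T (u + v) = T u + T v" "v \<in> V \<Longrightarrow> T (scale c v) = scale c (T v)"
    "v \<in> V \<Longrightarrow> T v \<in> V"
  using assms by (auto simp: lin_on_def)

lemma lin_on_0: "subspace V \<Longrightarrow> lin_on V T \<Longrightarrow> T 0 = 0"
  using lin_onD(2)[of V T 0 0] subspace_0 by simp

lemma lin_on_sum:
  assumes "subspace V" "lin_on V T" "\<And>i. i \<in> I \<Longrightarrow> b i \<in> V"
  shows "T (\<Sum>i\<in>I. scale (c i) (b i)) = (\<Sum>i\<in>I. scale (c i) (T (b i)))"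
  using assms(3)
proof (induction I rule: infinite_finite_induct)
  case (insert x F)
  have "(\<Sum>i\<in>F. scale (c i) (b i)) \<in> V"
    using insert.prems by (intro subspace_sum[OF assms(1)] subspace_scale[OF assms(1)]) auto
  moreover have "scale (c x) (b x) \<in> V"
    using insert.prems by (intro subspace_scale[OF assms(1)]) auto
  ultimately show ?case
    using insert by (simp add: lin_onD[OF assms(2)])
qed (use lin_on_0[OF assms(1,2)] in auto)

lemma funpow_in: "lin_on V T \<Longrightarrow> v \<in> V \<Longrightarrow> (T ^^ i) v \<in> V"
  by (induction i) (auto simp: lin_onD)

lemma lin_on_funpow: "lin_on V T \<Longrightarrow> lin_on V (T ^^ i)"
  by (induction i) (auto simp: lin_on_def)

lemma poly_op_in:
  assumes "subspace V" "lin_on V T" "v \<in> V" shows "poly_op T p v \<in> V"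
  unfolding poly_op_def using assms by (intro subspace_sum subspace_scale funpow_in)

lemma lin_on_poly_op:
  assumes "subspace V" "lin_on V T" shows "lin_on V (poly_op T p)"
proof -
  have "poly_op T p (u + v) = poly_op T p u + poly_op T p v" if "u \<in> V" "v \<in> V" for u v
    using lin_onD(1)[OF lin_on_funpow[OF assms(2)] that]
    by (simp add: poly_op_def scale_right_distrib sum.distrib)
  moreover have "poly_op T p (scale c v) = scale c (poly_op T p v)" if "v \<in> V" for c v
    using lin_onD(2)[OF lin_on_funpow[OF assms(2)] that]
    by (simp add: poly_op_def scale_sum_right mult.commute)
  ultimately show ?thesis
    using poly_op_in[OF assms] by (auto simp: lin_on_def)
qed

lemma poly_op_commute:
  assumes "subspace V" "lin_on V T" "v \<in> V"
  shows "T (poly_op T p v) = poly_op T p (T v)"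
  unfolding poly_op_def
  by (subst lin_on_sum[OF assms(1,2)]) (use assms in \<open>auto intro: funpow_in simp: funpow_swap1\<close>)

lemma poly_op_mult:
  assumes "subspace V" "lin_on V T" "v \<in> V"
  shows "poly_op T (p * r) v = poly_op T p (poly_op T r v)"
  using assms(3)
proof (induction p arbitrary: v)
  case (pCons a p)
  then show ?case
    using lin_onD(3)[OF assms(2)] poly_op_commute[OF assms(1,2)]
    by (simp add: poly_op_add poly_op_smult poly_op_pCons)
qed simp

lemma poly_op_cong:
  assumes "lin_on V T" "\<And>v. v \<in> V \<Longrightarrow> T v = T' v" "v \<in> V"
  shows "poly_op T p v = poly_op T' p v"
proof -
  have "(T ^^ i) v = (T' ^^ i) v" for i
  proof (induction i)
    case (Suc i)
    then show ?case using funpow_in[OF assms(1,3), of i] assms(2) by simp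
  qed simp
  then show ?thesis by (simp add: poly_op_def)
qed

lemma poly_op_dvd:
  assumes "subspace V" "lin_on V T" "v \<in> V" "f dvd g" "poly_op T f v = 0"
  shows "poly_op T g v = 0"
proof -
  obtain h where "g = h * f" using assms(4) by (metis dvdE mult.commute)
  then show ?thesis
    using poly_op_mult[OF assms(1-3)] assms(5) lin_on_0[OF assms(1) lin_on_poly_op[OF assms(1,2)]] by simp
qed

section \<open>Independent families, frames and annihilated operators\<close>

definition indep_fam :: "'i set \<Rightarrow> ('i \<Rightarrow> 'b) \<Rightarrow> bool" where
  "indep_fam I b \<longleftrightarrow> (\<forall>c. (\<Sum>i\<in>I. scale (c i) (b i)) = 0 \<longrightarrow> (\<forall>i\<in>I. c i = 0))"

definition fam_span :: "'i set \<Rightarrow> ('i \<Rightarrow> 'b) \<Rightarrow> 'b set" where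
  "fam_span I b = range (\<lambda>c. \<Sum>i\<in>I. scale (c i) (b i))"

definition frames :: "'i set \<Rightarrow> 'b set \<Rightarrow> ('i \<Rightarrow> 'b) set" where
  "frames I V = {b \<in> I \<rightarrow>\<^sub>E V. indep_fam I b}"

text \<open>Requiring \<open>extensional V\<close> represents each linear endomorphism of the
  subspace \<open>V\<close> by exactly one function, so that cardinalities count operators.\<close>

definition ops :: "'b set \<Rightarrow> 'a poly \<Rightarrow> ('b \<Rightarrow> 'b) set" where
  "ops V f = {T \<in> extensional V. lin_on V T \<and> (\<forall>v\<in>V. poly_op T f v = 0)}"

lemma indep_famD:
  assumes "indep_fam I b" "(\<Sum>i\<in>I. scale (c i) (b i)) = 0" "i \<in> I"
  shows "c i = 0"
  using assms(1)[unfolded indep_fam_def, rule_format, OF assms(2,3)] .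

lemma indep_fam_unique:
  assumes "indep_fam I b" "(\<Sum>i\<in>I. scale (c i) (b i)) = (\<Sum>i\<in>I. scale (c' i) (b i))" "i \<in> I"
  shows "c i = c' i"
proof -
  have "(\<Sum>i\<in>I. scale (c i - c' i) (b i)) = 0"
    using assms(2) by (simp add: scale_left_diff_distrib sum_subtractf)
  then have "c i - c' i = 0"
    using assms(1)[unfolded indep_fam_def, rule_format, of "\<lambda>i. c i - c' i"] assms(3) by blast
  then show ?thesis by simp
qed

lemma fam_spanI: "(\<Sum>i\<in>I. scale (c i) (b i)) \<in> fam_span I b"
  unfolding fam_span_def by (rule rangeI)

lemma fam_span_subspace: "subspace (fam_span I b)"
proof (rule subspaceI)
  show "0 \<in> fam_span I b" using fam_spanI[where c = "\<lambda>_. 0" and I = I and b = b] by simp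
next
  fix x y assume "x \<in> fam_span I b" "y \<in> fam_span I b"
  then obtain c c' where "x = (\<Sum>i\<in>I. scale (c i) (b i))" "y = (\<Sum>i\<in>I. scale (c' i) (b i))"
    by (auto simp: fam_span_def)
  then show "x + y \<in> fam_span I b"
    using fam_spanI[where c = "\<lambda>i. c i + c' i" and I = I and b = b] by (simp add: scale_left_distrib sum.distrib)
next
  fix k x assume "x \<in> fam_span I b"
  then obtain c where "x = (\<Sum>i\<in>I. scale (c i) (b i))" by (auto simp: fam_span_def)
  then show "scale k x \<in> fam_span I b"
    using fam_spanI[where c = "\<lambda>i. k * c i" and I = I and b = b] by (simp add: scale_sum_right)
qed

lemma fam_span_base: "finite I \<Longrightarrow> i \<in> I \<Longrightarrow> b i \<in> fam_span I b"
proof -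
  assume "finite I" "i \<in> I"
  have "(\<Sum>j\<in>I. scale (if j = i then 1 else 0) (b j)) = (\<Sum>j\<in>I. if j = i then b j else 0)"
    by (intro sum.cong) auto
  also have "\<dots> = b i"
    using \<open>finite I\<close> \<open>i \<in> I\<close> by simp
  finally show ?thesis using fam_spanI[where c = "\<lambda>j. if j = i then 1 else 0" and I = I and b = b] by simp
qed

lemma fam_span_subset:
  assumes "subspace V" "\<And>i. i \<in> I \<Longrightarrow> b i \<in> V" shows "fam_span I b \<subseteq> V"
  unfolding fam_span_def using assms by (auto intro!: subspace_sum subspace_scale)

lemma indep_fam_cong: "(\<And>i. i \<in> I \<Longrightarrow> b i = b' i) \<Longrightarrow> indep_fam I b = indep_fam I b'"
  unfolding indep_fam_def by simp

lemma linear_extension: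
  assumes V: "subspace V" and b: "indep_fam I b" "fam_span I b = V" and g: "\<And>i. i \<in> I \<Longrightarrow> g i \<in> V"
    and fin: "finite I"
  shows "\<exists>T\<in>extensional V. lin_on V T \<and> (\<forall>i\<in>I. T (b i) = g i)"
proof -
  define cf where "cf v = (SOME c. v = (\<Sum>i\<in>I. scale (c i) (b i)))" for v
  have cf: "v = (\<Sum>i\<in>I. scale (cf v i) (b i))" if "v \<in> V" for v
  proof -
    have "\<exists>c. v = (\<Sum>i\<in>I. scale (c i) (b i))" using that b(2) unfolding fam_span_def by blast
    then show ?thesis unfolding cf_def by (rule someI_ex)
  qed
  define T where "T = restrict (\<lambda>v. \<Sum>i\<in>I. scale (cf v i) (g i)) V"
  have T: "T v = (\<Sum>i\<in>I. scale (c i) (g i))" if "v = (\<Sum>i\<in>I. scale (c i) (b i))" for v c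
  proof -
    have "v \<in> V" using that b(2) unfolding fam_span_def by blast
    then have "cf v i = c i" if "i \<in> I" for i
      using indep_fam_unique[OF b(1), of "cf v" c i] cf[of v] \<open>v = _\<close> that by simp
    then show ?thesis using \<open>v \<in> V\<close> by (simp add: T_def)
  qed
  have "lin_on V T"
    unfolding lin_on_def
  proof (intro conjI ballI allI)
    fix u v assume uv: "u \<in> V" "v \<in> V"
    have "T (u + v) = (\<Sum>i\<in>I. scale (cf u i + cf v i) (g i))"
    proof (rule T)
      have "u + v = (\<Sum>i\<in>I. scale (cf u i) (b i)) + (\<Sum>i\<in>I. scale (cf v i) (b i))"
        using cf[OF uv(1)] cf[OF uv(2)] by simp
      then show "u + v = (\<Sum>i\<in>I. scale (cf u i + cf v i) (b i))"
        by (simp add: scale_left_distrib sum.distrib)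
    qed
    then show "T (u + v) = T u + T v"
      using uv by (simp add: T_def scale_left_distrib sum.distrib)
  next
    fix c v assume v: "v \<in> V"
    have "T (scale c v) = (\<Sum>i\<in>I. scale (c * cf v i) (g i))"
    proof (rule T)
      have "scale c v = scale c (\<Sum>i\<in>I. scale (cf v i) (b i))" using cf[OF v] by simp
      then show "scale c v = (\<Sum>i\<in>I. scale (c * cf v i) (b i))"
        by (simp add: scale_sum_right)
    qed
    then show "T (scale c v) = scale c (T v)"
      using v by (simp add: T_def scale_sum_right)
  next
    fix v assume v: "v \<in> V"
    then show "T v \<in> V" using g V by (auto simp: T_def intro!: subspace_sum subspace_scale)
  qed
  moreover have "T (b i) = g i" if "i \<in> I" for i
  proof -
    have *: "(\<Sum>j\<in>I. scale (if j = i then 1 else 0) (h j)) = h i" for h :: "_ \<Rightarrow> 'b"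
    proof -
      have "(\<Sum>j\<in>I. scale (if j = i then 1 else 0) (h j)) = (\<Sum>j\<in>I. if j = i then h j else 0)"
        by (intro sum.cong) auto
      then show ?thesis using that fin by simp
    qed
    show ?thesis using T[of "b i" "\<lambda>j. if j = i then 1 else 0"] by (simp only: *)
  qed
  moreover have "T \<in> extensional V" by (simp add: T_def)
  ultimately show ?thesis by blast
qed

lemma lin_on_eqI:
  assumes "subspace V" "lin_on V T" "lin_on V T'" "\<And>i. i \<in> I \<Longrightarrow> b i \<in> V"
    "V \<subseteq> fam_span I b" "\<And>i. i \<in> I \<Longrightarrow> T (b i) = T' (b i)" "v \<in> V"
  shows "T v = T' v"
proof -
  obtain c where c: "v = (\<Sum>i\<in>I. scale (c i) (b i))" using assms(5,7) unfolding fam_span_def by blast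
  show ?thesis unfolding c
    using assms(6) by (simp add: lin_on_sum[OF assms(1,2,4)] lin_on_sum[OF assms(1,3,4)])
qed

text \<open>Suppose a nonzero polynomial \<open>r\<close> of degree below \<open>degree p\<close>
  sends \<open>w\<close> into the invariant subspace \<open>W\<close>. It is coprime to
  \<open>p\<close>, so \<open>u * p + v * r = 1\<close>; applied to \<open>w\<close> this gives
  \<open>w\<close> as the image of an element of \<open>W\<close> under \<open>v\<close>, hence
  \<open>w\<close> in \<open>W\<close>.\<close>

lemma irreducible_op_indep:
  assumes V: "subspace V" and T: "T \<in> ops V p" and p: "irreducible p"
    and W: "subspace W" "W \<subseteq> V" "\<And>v. v \<in> W \<Longrightarrow> T v \<in> W" and w: "w \<in> V" "w \<notin> W"
    and c: "(\<Sum>j<degree p. scale (c j) ((T ^^ j) w)) \<in> W" and j: "j < degree p"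
  shows "c j = 0"
proof -
  have lin: "lin_on V T" "lin_on W T" using T W(2,3) by (auto simp: ops_def lin_on_def subset_iff)
  define r where "r = (\<Sum>j<degree p. monom (c j) j)"
  have co: "coeff r i = (if i < degree p then c i else 0)" for i
    by (simp add: r_def coeff_sum)
  have deg: "degree r \<le> degree p" by (rule degree_le) (simp add: co)
  have "poly_op T r w = (\<Sum>j<degree p. scale (c j) ((T ^^ j) w))"
    unfolding poly_op_altdef[OF deg] by (intro sum.mono_neutral_cong_right) (auto simp: co)
  with c have in_W: "poly_op T r w \<in> W" by simp
  have "r = 0"
  proof (rule ccontr)
    assume "r \<noteq> 0"
    have "degree r < degree p"
      using \<open>r \<noteq> 0\<close> co[of "degree r"] leading_coeff_0_iff[of r] by (auto split: if_splits)
    then have "\<not> p dvd r" using dvd_imp_degree_le[of p r] \<open>r \<noteq> 0\<close> by linarith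
    then obtain u v where uv: "u * p + v * r = 1" using irreducible_bezout[OF p] by blast
    have "poly_op T p w = 0" using T w(1) unfolding ops_def by blast
    then have "poly_op T (u * p) w = 0"
      by (rule poly_op_dvd[OF V lin(1) w(1) dvd_triv_right])
    moreover have "poly_op T (v * r) w \<in> W"
      unfolding poly_op_mult[OF V lin(1) w(1)] using in_W by (rule poly_op_in[OF W(1) lin(2)])
    ultimately have "poly_op T (u * p + v * r) w \<in> W" unfolding poly_op_add by simp
    then show False using w(2) unfolding uv poly_op_1 by simp
  qed
  with co[of j] j show ?thesis by simp
qed

definition cyclic_fam :: "('b \<Rightarrow> 'b) \<Rightarrow> (nat \<Rightarrow> 'b) \<Rightarrow> nat \<times> nat \<Rightarrow> 'b" where
  "cyclic_fam T vs = (\<lambda>(l, j). (T ^^ j) (vs l))"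

text \<open>For an operator annihilated by an irreducible polynomial of degree \<open>d\<close> this is the set of tuples of
  \<open>m\<close> vectors that are independent over the field extension of degree \<open>d\<close> generated by the operator.\<close>

definition cyclic_frames :: "'b set \<Rightarrow> ('b \<Rightarrow> 'b) \<Rightarrow> nat \<Rightarrow> nat \<Rightarrow> (nat \<Rightarrow> 'b) set" where
  "cyclic_frames V T d m = {vs \<in> {..<m} \<rightarrow>\<^sub>E V. indep_fam ({..<m} \<times> {..<d}) (cyclic_fam T vs)}"

lemma top_power_in_span:
  assumes V: "subspace V" and T: "T \<in> ops V p" and p: "monic_irreducible p" and v: "v \<in> V"
  shows "(T ^^ degree p) v = - (\<Sum>i<degree p. scale (coeff p i) ((T ^^ i) v))"
proof -
  have "poly_op T p v = 0" using T v by (simp add: ops_def)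
  then have "(\<Sum>i<degree p. scale (coeff p i) ((T ^^ i) v)) + (T ^^ degree p) v = 0"
    using p by (simp add: poly_op_def monic_irreducible_def flip: lessThan_Suc_atMost)
  then show ?thesis by (simp add: eq_neg_iff_add_eq_0 add.commute)
qed

lemma cyclic_span_invariant:
  assumes V: "subspace V" and T: "T \<in> ops V p" and p: "monic_irreducible p"
    and vs: "vs \<in> {..<m} \<rightarrow> V"
    and v: "v \<in> fam_span ({..<m} \<times> {..<degree p}) (cyclic_fam T vs)"
  shows "T v \<in> fam_span ({..<m} \<times> {..<degree p}) (cyclic_fam T vs)"
proof -
  let ?I = "{..<m} \<times> {..<degree p}"
  let ?W = "fam_span ?I (cyclic_fam T vs)"
  have lin: "lin_on V T" using T by (simp add: ops_def)
  have W: "subspace ?W" by (rule fam_span_subspace)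
  have base: "(T ^^ j) (vs l) \<in> ?W" if "l < m" "j < degree p" for l j
    using fam_span_base[of ?I "(l, j)" "cyclic_fam T vs"] that by (simp add: cyclic_fam_def)
  obtain c where c: "v = (\<Sum>i\<in>?I. scale (c i) (cyclic_fam T vs i))"
    using v unfolding fam_span_def by blast
  have "T v = (\<Sum>i\<in>?I. scale (c i) (T (cyclic_fam T vs i)))"
    unfolding c
  proof (rule lin_on_sum[OF V lin])
    show "cyclic_fam T vs i \<in> V" if "i \<in> ?I" for i
      using that vs funpow_in[OF lin] by (auto simp: cyclic_fam_def)
  qed
  also have "\<dots> \<in> ?W"
  proof (intro subspace_sum[OF W] subspace_scale[OF W])
    fix i assume "i \<in> ?I"
    then obtain l j where i: "i = (l, j)" "l < m" "j < degree p" by auto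
    show "T (cyclic_fam T vs i) \<in> ?W"
    proof (cases "Suc j < degree p")
      case True
      then show ?thesis using base[of l "Suc j"] i by (simp add: cyclic_fam_def)
    next
      case False
      then have "degree p = Suc j" using i by simp
      then have "T (cyclic_fam T vs i) = (T ^^ degree p) (vs l)"
        using i by (simp add: cyclic_fam_def)
      also have "\<dots> \<in> ?W"
        unfolding top_power_in_span[OF V T p funcset_mem[OF vs lessThan_iff[THEN iffD2, OF i(2)]]]
        using i base by (intro subspace_neg[OF W] subspace_sum[OF W] subspace_scale[OF W]) auto
      finally show ?thesis .
    qed
  qed
  finally show ?thesis .
qed

lemma sum_Suc_Times:
  fixes f :: "nat \<times> nat \<Rightarrow> 'b"
  shows "sum f ({..<Suc m} \<times> {..<d}) = sum f ({..<m} \<times> {..<d}) + (\<Sum>j<d. f (m, j))"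
proof -
  have "sum f ({..<Suc m} \<times> {..<d}) = (\<Sum>l<Suc m. \<Sum>j<d. f (l, j))"
    by (simp add: sum.cartesian_product)
  also have "\<dots> = (\<Sum>l<m. \<Sum>j<d. f (l, j)) + (\<Sum>j<d. f (m, j))" by simp
  also have "(\<Sum>l<m. \<Sum>j<d. f (l, j)) = sum f ({..<m} \<times> {..<d})"
    by (simp add: sum.cartesian_product)
  finally show ?thesis .
qed

text \<open>The usual criterion for extending an independent tuple, over the field generated by the
  operator: since \<open>W\<close> is invariant it is a subspace over that field, and a new vector
  is independent of the old ones exactly when it lies outside \<open>W\<close>.\<close>

lemma cyclic_frames_extend:
  assumes V: "subspace V" and T: "T \<in> ops V p" and p: "monic_irreducible p"
    and vs: "vs \<in> {..<m} \<rightarrow> V" and w: "w \<in> V"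
  defines "W \<equiv> fam_span ({..<m} \<times> {..<degree p}) (cyclic_fam T vs)"
  shows "indep_fam ({..<Suc m} \<times> {..<degree p}) (cyclic_fam T (vs(m := w))) \<longleftrightarrow>
    indep_fam ({..<m} \<times> {..<degree p}) (cyclic_fam T vs) \<and> w \<notin> W" (is "?L \<longleftrightarrow> ?R")
proof -
  let ?I = "{..<m} \<times> {..<degree p}"
  have irr: "irreducible p" using p by (simp add: monic_irreducible_def)
  have d: "degree p > 0" by (rule irreducible_degree_pos[OF irr])
  have lin: "lin_on V T" using T by (simp add: ops_def)
  have W: "subspace W" unfolding W_def by (rule fam_span_subspace)
  have WV: "W \<subseteq> V" unfolding W_def
    by (rule fam_span_subset[OF V]) (use vs funpow_in[OF lin] in \<open>auto simp: cyclic_fam_def\<close>)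
  have inv: "T v \<in> W" if "v \<in> W" for v
    using that unfolding W_def by (rule cyclic_span_invariant[OF V T p vs])
  have split: "(\<Sum>i\<in>{..<Suc m} \<times> {..<degree p}. scale (c i) (cyclic_fam T (vs(m := w)) i)) =
      (\<Sum>i\<in>?I. scale (c i) (cyclic_fam T vs i)) + (\<Sum>j<degree p. scale (c (m, j)) ((T ^^ j) w))" for c
  proof -
    have "(\<Sum>i\<in>?I. scale (c i) (cyclic_fam T (vs(m := w)) i)) = (\<Sum>i\<in>?I. scale (c i) (cyclic_fam T vs i))"
      by (intro sum.cong) (auto simp: cyclic_fam_def)
    then show ?thesis by (simp add: sum_Suc_Times) (simp add: cyclic_fam_def)
  qed
  show ?thesis
  proof
    assume L: ?L
    have "indep_fam ?I (cyclic_fam T vs)"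
      unfolding indep_fam_def
    proof (intro allI impI)
      fix c assume c: "(\<Sum>i\<in>?I. scale (c i) (cyclic_fam T vs i)) = 0"
      let ?c = "\<lambda>i. if i \<in> ?I then c i else 0"
      have "(\<Sum>i\<in>?I. scale (?c i) (cyclic_fam T vs i)) = 0" using c by simp
      then have "(\<Sum>i\<in>{..<Suc m} \<times> {..<degree p}. scale (?c i) (cyclic_fam T (vs(m := w)) i)) = 0"
        unfolding split by simp
      note * = indep_famD[OF L this]
      show "\<forall>i\<in>?I. c i = 0"
      proof
        fix i assume i: "i \<in> ?I"
        then have "i \<in> {..<Suc m} \<times> {..<degree p}" by auto
        from *[OF this] show "c i = 0" unfolding if_P[OF i] .
      qed
    qed
    moreover have "w \<notin> W"
    proof
      assume "w \<in> W"
      then obtain c where c: "w = (\<Sum>i\<in>?I. scale (c i) (cyclic_fam T vs i))"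
        unfolding W_def fam_span_def by (elim rangeE)
      let ?c = "\<lambda>i. if i \<in> ?I then c i else if i = (m, 0) then - 1 else 0"
      have "(\<Sum>i\<in>?I. scale (?c i) (cyclic_fam T vs i)) = w"
        unfolding c by (intro sum.cong refl) simp
      moreover have "(\<Sum>j<degree p. scale (?c (m, j)) ((T ^^ j) w)) = (\<Sum>j<degree p. if j = 0 then - w else 0)"
        by (intro sum.cong) auto
      ultimately have "(\<Sum>i\<in>{..<Suc m} \<times> {..<degree p}. scale (?c i) (cyclic_fam T (vs(m := w)) i)) = 0"
        unfolding split using d by (simp only:) simp
      from indep_famD[OF L this, of "(m, 0)"] d have "?c (m, 0) = 0" by simp
      then show False by simp
    qed
    ultimately show ?R ..
  next
    assume R: ?R
    show ?L
      unfolding indep_fam_def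
    proof (intro allI impI)
      fix c assume "(\<Sum>i\<in>{..<Suc m} \<times> {..<degree p}. scale (c i) (cyclic_fam T (vs(m := w)) i)) = 0"
      then have eq: "(\<Sum>i\<in>?I. scale (c i) (cyclic_fam T vs i)) + (\<Sum>j<degree p. scale (c (m, j)) ((T ^^ j) w)) = 0"
        unfolding split .
      have "(\<Sum>j<degree p. scale (c (m, j)) ((T ^^ j) w)) = - (\<Sum>i\<in>?I. scale (c i) (cyclic_fam T vs i))"
        using eq by (simp add: eq_neg_iff_add_eq_0 add.commute)
      also have "\<dots> \<in> W"
        unfolding W_def by (intro subspace_neg[OF fam_span_subspace] fam_spanI)
      finally have cm: "c (m, j) = 0" if "j < degree p" for j
        using irreducible_op_indep[OF V T irr W WV inv w conjunct2[OF R] _ that, of "\<lambda>j. c (m, j)"] by simp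
      then have "(\<Sum>j<degree p. scale (c (m, j)) ((T ^^ j) w)) = 0" by (intro sum.neutral) auto
      then have "(\<Sum>i\<in>?I. scale (c i) (cyclic_fam T vs i)) = 0" using eq by simp
      then have "\<forall>i\<in>?I. c i = 0" using indep_famD[OF conjunct1[OF R]] by blast
      then show "\<forall>i\<in>{..<Suc m} \<times> {..<degree p}. c i = 0"
        using cm by (auto simp: less_Suc_eq)
    qed
  qed
qed

end

text \<open>The order of GL(n,q), counted as ordered bases: vector number \<open>i\<close> has to
  avoid the \<open>q ^ i\<close> vectors spanned by its predecessors.\<close>

definition gl_order :: "nat \<Rightarrow> nat \<Rightarrow> nat" where
  "gl_order q n = (\<Prod>i<n. q ^ n - q ^ i)"

lemma gl_order_pos: "q > 1 \<Longrightarrow> gl_order q n > 0"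
  unfolding gl_order_def by (intro prod_pos) (simp add: power_strict_increasing)

section \<open>Counting frames and operators over a finite field\<close>

locale finite_field_space = operator_space scale
  for scale :: "'a :: {field, finite} \<Rightarrow> 'b :: ab_group_add \<Rightarrow> 'b"
begin

lemma q_gt_1: "CARD('a) > 1"
proof -
  have "card {0, 1 :: 'a} \<le> CARD('a)" by (rule card_mono) auto
  then show ?thesis by simp
qed

lemma card_fam_span:
  assumes "finite I" "indep_fam I b"
  shows "finite (fam_span I b)" "card (fam_span I b) = CARD('a) ^ card I"
proof -
  let ?f = "\<lambda>c. \<Sum>i\<in>I. scale (c i) (b i)"
  have im: "fam_span I b = ?f ` (I \<rightarrow>\<^sub>E UNIV)"
  proof -
    have "?f c \<in> ?f ` (I \<rightarrow>\<^sub>E UNIV)" for c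
    proof (rule image_eqI)
      show "?f c = ?f (restrict c I)" by simp
    qed (auto simp: restrict_def)
    then show ?thesis unfolding fam_span_def by blast
  qed
  have "inj_on ?f (I \<rightarrow>\<^sub>E UNIV)"
  proof (rule inj_onI)
    fix c c' assume *: "c \<in> I \<rightarrow>\<^sub>E UNIV" "c' \<in> I \<rightarrow>\<^sub>E UNIV" "?f c = ?f c'"
    then show "c = c'"
      using indep_fam_unique[OF assms(2) *(3)] by (intro PiE_ext) auto
  qed
  then show "finite (fam_span I b)" "card (fam_span I b) = CARD('a) ^ card I"
    unfolding im using assms(1) by (simp_all add: card_image card_PiE finite_PiE)
qed

lemma finite_PiE_restricted: "finite V \<Longrightarrow> finite I \<Longrightarrow> finite {b \<in> I \<rightarrow>\<^sub>E V. P b}"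
  by (simp add: finite_PiE)

lemma finite_frames: "finite V \<Longrightarrow> finite I \<Longrightarrow> finite (frames I V)"
  unfolding frames_def by (rule finite_PiE_restricted)

lemma finite_ops:
  assumes "finite V" shows "finite (ops V f)"
proof (rule finite_subset)
  show "ops V f \<subseteq> V \<rightarrow>\<^sub>E V" by (auto simp: ops_def lin_on_def PiE_def)
qed (use assms in \<open>simp add: finite_PiE\<close>)

lemma frame_spans:
  assumes "subspace V" "finite V" "card V = CARD('a) ^ card I" "finite I" "b \<in> frames I V"
  shows "fam_span I b = V"
proof (rule card_subset_eq)
  show "fam_span I b \<subseteq> V" using assms by (intro fam_span_subset) (auto simp: frames_def)
  show "card (fam_span I b) = card V" using card_fam_span[of I b] assms by (simp add: frames_def)
qed fact

lemma finite_subspace_card: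
  assumes "subspace V" "finite V"
  shows "\<exists>n. card V = CARD('a) ^ n"
proof -
  obtain B where B: "B \<subseteq> V" "independent B" "V \<subseteq> span B"
    using maximal_independent_subset[of V] by blast
  have fB: "finite B" using B assms finite_subset by blast
  have "span B = V" using B assms span_minimal by blast
  moreover have "fam_span B id = span B"
    unfolding fam_span_def using span_finite[OF fB] by simp
  moreover have "indep_fam B id"
    unfolding indep_fam_def using B(2) fB independent_explicit_module
    by (auto simp: dependent_finite[OF fB])
  ultimately show ?thesis using card_fam_span[OF fB] by metis
qed

text \<open>By \<open>cyclic_frames_extend\<close> vector number \<open>l\<close> is an arbitrary
  element outside the span of its predecessors, and that span has \<open>degree p * l\<close>
  coordinates over the ground field.\<close>

lemma card_cyclic_frames:
  assumes V: "subspace V" "finite V" "card V = CARD('a) ^ n"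
    and T: "T \<in> ops V p" and p: "monic_irreducible p"
  shows "card (cyclic_frames V T (degree p) m) = (\<Prod>l<m. CARD('a) ^ n - CARD('a) ^ (degree p * l))"
proof (induction m)
  case 0
  have "cyclic_frames V T (degree p) 0 = {\<lambda>_. undefined}"
    by (auto simp: cyclic_frames_def indep_fam_def)
  then show ?case by simp
next
  case (Suc m)
  let ?d = "degree p"
  define W where "W vs = fam_span ({..<m} \<times> {..<?d}) (cyclic_fam T vs)" for vs
  have lin: "lin_on V T" using T by (simp add: ops_def)
  let ?S = "SIGMA vs:cyclic_frames V T ?d m. V - W vs"
  let ?f = "\<lambda>(vs, w). vs(m := w)"
  have fin: "finite (cyclic_frames V T ?d m)"
    unfolding cyclic_frames_def by (rule finite_PiE_restricted) (use V in auto)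
  have inj: "inj_on ?f ?S"
  proof (rule inj_onI, clarify)
    fix vs w vs' w'
    assume *: "vs \<in> cyclic_frames V T ?d m" "vs' \<in> cyclic_frames V T ?d m" "vs(m := w) = vs'(m := w')"
    then have "vs m = undefined" "vs' m = undefined"
      by (auto simp: cyclic_frames_def PiE_def extensional_def)
    with *(3) show "vs = vs' \<and> w = w'" by (metis fun_upd_same fun_upd_triv fun_upd_upd)
  qed
  have im: "cyclic_frames V T ?d (Suc m) = ?f ` ?S"
  proof (intro Set.set_eqI iffI)
    fix x assume x: "x \<in> cyclic_frames V T ?d (Suc m)"
    define vs where "vs = x(m := undefined)"
    have xV: "x l \<in> V" if "l < Suc m" for l using x that by (auto simp: cyclic_frames_def)
    have vsV: "vs \<in> {..<m} \<rightarrow> V" using xV by (simp add: vs_def)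
    have xeq: "x = vs(m := x m)" by (simp add: vs_def)
    have "indep_fam ({..<Suc m} \<times> {..<?d}) (cyclic_fam T (vs(m := x m)))"
      using x xeq by (simp add: cyclic_frames_def)
    then have "indep_fam ({..<m} \<times> {..<?d}) (cyclic_fam T vs) \<and> x m \<notin> W vs"
      unfolding W_def using cyclic_frames_extend[OF V(1) T p vsV xV[OF lessI]] by blast
    moreover have "vs \<in> {..<m} \<rightarrow>\<^sub>E V"
      using x vsV by (auto simp: vs_def cyclic_frames_def PiE_def extensional_def less_Suc_eq)
    ultimately have "(vs, x m) \<in> ?S" using xV[of m] by (simp add: cyclic_frames_def)
    then show "x \<in> ?f ` ?S" using xeq by (intro image_eqI[of _ _ "(vs, x m)"]) simp_all
  next
    fix x assume "x \<in> ?f ` ?S"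
    then obtain vs w where x: "x = vs(m := w)" "vs \<in> cyclic_frames V T ?d m" "w \<in> V" "w \<notin> W vs" by auto
    have vsV: "vs \<in> {..<m} \<rightarrow> V" using x(2) by (auto simp: cyclic_frames_def)
    have "indep_fam ({..<Suc m} \<times> {..<?d}) (cyclic_fam T x)"
      unfolding x(1) using cyclic_frames_extend[OF V(1) T p vsV x(3)] x(2,4)
      by (auto simp: W_def cyclic_frames_def)
    moreover have "x \<in> {..<Suc m} \<rightarrow>\<^sub>E V"
      using x by (auto simp: cyclic_frames_def PiE_def extensional_def less_Suc_eq)
    ultimately show "x \<in> cyclic_frames V T ?d (Suc m)" by (simp add: cyclic_frames_def)
  qed
  have "card (V - W vs) = CARD('a) ^ n - CARD('a) ^ (?d * m)" if vs: "vs \<in> cyclic_frames V T ?d m" for vs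
  proof -
    have ind: "indep_fam ({..<m} \<times> {..<?d}) (cyclic_fam T vs)" using vs by (simp add: cyclic_frames_def)
    have "W vs \<subseteq> V" unfolding W_def
      by (rule fam_span_subset[OF V(1)])
         (use vs funpow_in[OF lin] in \<open>auto simp: cyclic_fam_def cyclic_frames_def\<close>)
    moreover have "finite (W vs)" "card (W vs) = CARD('a) ^ (?d * m)"
      unfolding W_def using card_fam_span[OF _ ind] by (simp_all add: mult.commute)
    ultimately show ?thesis using V by (simp add: card_Diff_subset)
  qed
  then have "card ?S = card (cyclic_frames V T ?d m) * (CARD('a) ^ n - CARD('a) ^ (?d * m))"
    using fin V(2) by (subst card_SigmaI) auto
  then show ?case using Suc inj im by (simp add: card_image)
qed

lemma indep_fam_reindex:
  assumes h: "bij_betw h J I"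
  shows "indep_fam I b \<longleftrightarrow> indep_fam J (b \<circ> h)"
proof
  assume I: "indep_fam I b"
  show "indep_fam J (b \<circ> h)"
    unfolding indep_fam_def
  proof (intro allI impI)
    fix c assume c: "(\<Sum>j\<in>J. scale (c j) ((b \<circ> h) j)) = 0"
    have "(\<Sum>i\<in>I. scale (c (inv_into J h i)) (b i)) = (\<Sum>j\<in>J. scale (c (inv_into J h (h j))) (b (h j)))"
      by (rule sum.reindex_bij_betw[OF h, symmetric])
    also have "\<dots> = 0"
      using c h by (simp add: bij_betw_inv_into_left)
    finally have "\<forall>i\<in>I. c (inv_into J h i) = 0"
      using I[unfolded indep_fam_def, rule_format, of "\<lambda>i. c (inv_into J h i)"] by blast
    then show "\<forall>j\<in>J. c j = 0"
      using h by (metis bij_betw_apply bij_betw_inv_into_left)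
  qed
next
  assume J: "indep_fam J (b \<circ> h)"
  show "indep_fam I b"
    unfolding indep_fam_def
  proof (intro allI impI)
    fix c assume c: "(\<Sum>i\<in>I. scale (c i) (b i)) = 0"
    have "(\<Sum>j\<in>J. scale (c (h j)) (b (h j))) = 0"
      using sum.reindex_bij_betw[OF h, of "\<lambda>i. scale (c i) (b i)"] c by simp
    then have "\<forall>j\<in>J. c (h j) = 0"
      using J[unfolded indep_fam_def, rule_format, of "\<lambda>j. c (h j)"] by simp
    then show "\<forall>i\<in>I. c i = 0"
      using h by (auto simp: bij_betw_def)
  qed
qed

lemma card_frames_le:
  assumes "finite I" "finite J" "finite V" "bij_betw h J I"
  shows "card (frames I V) \<le> card (frames J V)"
proof (rule card_inj_on_le)
  let ?f = "\<lambda>b. restrict (b \<circ> h) J"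
  show "inj_on ?f (frames I V)"
  proof (rule inj_onI)
    fix b b' assume *: "b \<in> frames I V" "b' \<in> frames I V" "?f b = ?f b'"
    have "b (h j) = b' (h j)" if "j \<in> J" for j
      using fun_cong[OF *(3), of j] that by simp
    then have "b i = b' i" if "i \<in> I" for i
      using that assms(4) by (auto simp: bij_betw_def)
    moreover have "b \<in> I \<rightarrow>\<^sub>E V" "b' \<in> I \<rightarrow>\<^sub>E V" using * by (auto simp: frames_def)
    ultimately show "b = b'" by (intro PiE_ext)
  qed
  show "?f ` frames I V \<subseteq> frames J V"
  proof (rule image_subsetI)
    fix b assume b: "b \<in> frames I V"
    have "indep_fam J (?f b) = indep_fam J (b \<circ> h)" by (rule indep_fam_cong) simp
    then show "?f b \<in> frames J V"
      using b assms(4) indep_fam_reindex[OF assms(4), of b]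
      by (auto simp: frames_def bij_betw_apply)
  qed
qed (use assms finite_frames in auto)

lemma card_frames_reindex:
  assumes "finite I" "finite J" "finite V" "card I = card J"
  shows "card (frames I V) = card (frames J V)"
proof (rule antisym)
  show "card (frames I V) \<le> card (frames J V)"
    using finite_same_card_bij[OF assms(2,1)] assms card_frames_le by metis
  show "card (frames J V) \<le> card (frames I V)"
    using finite_same_card_bij[OF assms(1,2)] assms card_frames_le by metis
qed

lemma monic_irreducible_X: "monic_irreducible [:0, 1 :: 'a:]"
proof -
  have "irreducible [:0, 1 :: 'a:]"
  proof (rule irreducibleI)
    fix a b assume ab: "[:0, 1 :: 'a:] = a * b"
    then have "a \<noteq> 0" "b \<noteq> 0" by auto
    moreover from this have "degree a + degree b = 1"
      using arg_cong[OF ab, of degree] by (simp add: degree_mult_eq)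
    ultimately show "a dvd 1 \<or> b dvd 1" by (auto simp: is_unit_iff_degree)
  qed (auto simp: is_unit_iff_degree)
  then show ?thesis by (simp add: monic_irreducible_def)
qed

text \<open>The zero operator is annihilated by the irreducible polynomial \<open>X\<close>, whose
  residue field is the ground field itself. So ordinary ordered bases are the degree 1 case of the
  cyclic count.\<close>

lemma card_frames:
  assumes V: "subspace V" "finite V" "card V = CARD('a) ^ card I" and "finite I"
  shows "card (frames I V) = gl_order CARD('a) (card I)"
proof -
  let ?n = "card I" and ?T = "restrict (\<lambda>_. 0) V"
  have "0 \<in> V" using V(1) by (rule subspace_0)
  then have "?T \<in> ops V [:0, 1:]"
    using V(1) by (auto simp: ops_def lin_on_def poly_op_pCons subspace_def)
  from card_cyclic_frames[OF V this monic_irreducible_X, of ?n]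
  have "card (cyclic_frames V ?T 1 ?n) = gl_order CARD('a) ?n" by (simp add: gl_order_def)
  moreover have "cyclic_frames V ?T 1 ?n = frames {..<?n} V"
  proof -
    have "bij_betw (\<lambda>l. (l, 0)) {..<?n} ({..<?n} \<times> {..<1::nat})"
      by (rule bij_betwI[of _ _ _ fst]) auto
    from indep_fam_reindex[OF this, of "cyclic_fam ?T vs" for vs]
    have "indep_fam ({..<?n} \<times> {..<1}) (cyclic_fam ?T vs) = indep_fam {..<?n} vs" for vs
      by (simp add: cyclic_fam_def o_def)
    then show ?thesis by (simp add: cyclic_frames_def frames_def)
  qed
  moreover have "card (frames I V) = card (frames {..<?n} V)"
    using assms by (intro card_frames_reindex) auto
  ultimately show ?thesis by simp
qed

end

context finite_field_space
begin

lemma lin_on_restrict: "subspace V \<Longrightarrow> lin_on V T \<Longrightarrow> lin_on V (restrict T V)"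
  by (auto simp: lin_on_def subspace_add subspace_scale)

text \<open>Double counting of ordered bases of \<open>V\<close> indexed by pairs
  \<open>(l, j)\<close>. Such a basis determines one operator, which moves \<open>(l, j)\<close> to
  \<open>(l, Suc j)\<close> and closes each row by the relation \<open>p\<close>, and one cyclic
  frame of it, the column \<open>j = 0\<close>. Conversely every operator has
  \<open>gl_order (CARD('a) ^ degree p) m\<close> cyclic frames.\<close>

lemma card_ops_irreducible:
  assumes V: "subspace V" "finite V" "card V = CARD('a) ^ n"
    and p: "monic_irreducible p" and n: "n = degree p * m"
  shows "card (ops V p) * gl_order (CARD('a) ^ degree p) m = gl_order CARD('a) n"
proof -
  let ?d = "degree p" and ?q = "CARD('a)"
  let ?I = "{..<m} \<times> {..<?d}"
  let ?S = "SIGMA T:ops V p. cyclic_frames V T ?d m"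
  let ?f = "\<lambda>(T, vs). restrict (cyclic_fam T vs) ?I"
  have d: "?d > 0" using p irreducible_degree_pos by (auto simp: monic_irreducible_def)
  have cI: "card ?I = n" by (simp add: n mult.commute)
  have inj: "inj_on ?f ?S"
  proof (rule inj_onI)
    fix x x' assume x: "x \<in> ?S" "x' \<in> ?S" "?f x = ?f x'"
    obtain T vs T' vs' where xx: "x = (T, vs)" "x' = (T', vs')" by (cases x, cases x')
    have T: "T \<in> ops V p" "T' \<in> ops V p" and vs: "vs \<in> cyclic_frames V T ?d m" "vs' \<in> cyclic_frames V T' ?d m"
      using x xx by auto
    have lin: "lin_on V T" "lin_on V T'" using T by (auto simp: ops_def)
    have eq: "(T ^^ j) (vs l) = (T' ^^ j) (vs' l)" if "l < m" "j < ?d" for l j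
      using fun_cong[OF x(3), of "(l, j)"] that by (simp add: xx cyclic_fam_def)
    have vl: "vs l = vs' l" if "l < m" for l using eq[OF that d] by simp
    have vsPi: "vs \<in> {..<m} \<rightarrow>\<^sub>E V" "vs' \<in> {..<m} \<rightarrow>\<^sub>E V" using vs by (auto simp: cyclic_frames_def)
    have "vs = vs'" using vsPi vl by (intro PiE_ext) auto
    let ?b = "restrict (cyclic_fam T vs) ?I"
    have inV: "cyclic_fam T vs i \<in> V" if "i \<in> ?I" for i
      using that vsPi funpow_in[OF lin(1)] by (auto simp: cyclic_fam_def)
    have "indep_fam ?I ?b"
      using vs(1) indep_fam_cong[of ?I ?b "cyclic_fam T vs"] by (simp add: cyclic_frames_def)
    then have fr: "?b \<in> frames ?I V" using inV by (simp add: frames_def)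
    have span: "fam_span ?I ?b = V" using V cI by (intro frame_spans fr) simp_all
    have TT: "T (?b i) = T' (?b i)" if iI: "i \<in> ?I" for i
    proof -
      obtain l j where i: "i = (l, j)" "l < m" "j < ?d" using iI by auto
      have vlV: "vs l \<in> V" using vsPi i by auto
      show ?thesis
      proof (cases "Suc j < ?d")
        case True
        then show ?thesis
          using eq[of l "Suc j"] eq[of l j] i vl[of l] by (simp add: cyclic_fam_def)
      next
        case False
        then have dj: "?d = Suc j" using i by simp
        have "T (?b i) = (T ^^ ?d) (vs l)" using i unfolding dj by (simp add: cyclic_fam_def)
        also have "\<dots> = - (\<Sum>i<?d. scale (coeff p i) ((T ^^ i) (vs l)))"
          by (rule top_power_in_span[OF V(1) T(1) p vlV])
        also have "\<dots> = - (\<Sum>i<?d. scale (coeff p i) ((T' ^^ i) (vs l)))"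
          using eq[OF i(2)] vl[OF i(2)] by simp
        also have "\<dots> = (T' ^^ ?d) (vs l)"
          by (rule top_power_in_span[OF V(1) T(2) p vlV, symmetric])
        also have "\<dots> = T' ((T' ^^ j) (vs' l))" using vl[OF i(2)] unfolding dj by simp
        also have "\<dots> = T' (?b i)"
          using eq[OF i(2,3)] i by (simp add: cyclic_fam_def)
        finally show ?thesis .
      qed
    qed
    have "T v = T' v" if "v \<in> V" for v
    proof (rule lin_on_eqI[where I = ?I and b = ?b, OF V(1) lin _ _ TT that])
      show "?b i \<in> V" if "i \<in> ?I" for i using inV[OF that] that by (simp only: restrict_apply if_True)
      show "V \<subseteq> fam_span ?I ?b" unfolding span ..
    qed
    moreover have "T \<in> extensional V" "T' \<in> extensional V" using T by (auto simp: ops_def)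
    ultimately have "T = T'" by (auto intro: extensionalityI)
    with \<open>vs = vs'\<close> show "x = x'" by (simp add: xx)
  qed
  have im: "?f ` ?S = frames ?I V"
  proof (intro equalityI subsetI)
    fix b assume "b \<in> ?f ` ?S"
    then obtain T vs where b: "b = restrict (cyclic_fam T vs) ?I" "T \<in> ops V p" "vs \<in> cyclic_frames V T ?d m"
      by auto
    have lin: "lin_on V T" using b by (simp add: ops_def)
    have "cyclic_fam T vs i \<in> V" if "i \<in> ?I" for i
      using that b(3) funpow_in[OF lin] by (auto simp: cyclic_fam_def cyclic_frames_def)
    moreover have "indep_fam ?I b"
      using b indep_fam_cong[of ?I b "cyclic_fam T vs"] by (simp add: cyclic_frames_def)
    ultimately show "b \<in> frames ?I V" by (simp add: frames_def b(1))
  next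
    fix b assume b: "b \<in> frames ?I V"
    then have ind: "indep_fam ?I b" and bV: "\<And>l j. l < m \<Longrightarrow> j < ?d \<Longrightarrow> b (l, j) \<in> V"
      by (auto simp: frames_def)
    have span: "fam_span ?I b = V" using V cI by (intro frame_spans b) simp_all
    \<comment> \<open>The images of the basis vectors under a block companion operator of
      \<open>p\<close>.\<close>
    define g where "g = (\<lambda>(l, j). if Suc j < ?d then b (l, Suc j) else - (\<Sum>i<?d. scale (coeff p i) (b (l, i))))"
    have gV: "g i \<in> V" if "i \<in> ?I" for i
      using that bV V(1) by (auto simp: g_def intro!: subspace_neg subspace_sum subspace_scale)
    have "\<exists>T\<in>extensional V. lin_on V T \<and> (\<forall>i\<in>?I. T (b i) = g i)"
      by (rule linear_extension[OF V(1) ind span]) (use gV in simp_all)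
    then obtain T where T: "T \<in> extensional V" "lin_on V T" "\<forall>i\<in>?I. T (b i) = g i" by blast
    define vs where "vs = restrict (\<lambda>l. b (l, 0)) {..<m}"
    have pow: "(T ^^ j) (b (l, 0)) = b (l, j)" if "l < m" "j < ?d" for l j
      using that(2)
    proof (induction j)
      case (Suc j)
      then have "T (b (l, j)) = g (l, j)" using T(3) that(1) by simp
      then show ?case using Suc by (simp add: g_def)
    qed simp
    have top: "(T ^^ ?d) (b (l, 0)) = - (\<Sum>i<?d. scale (coeff p i) (b (l, i)))" if l: "l < m" for l
    proof -
      obtain e where e: "?d = Suc e" using d by (cases ?d) auto
      then have "(T ^^ ?d) (b (l, 0)) = T (b (l, e))" using pow[OF l, of e] by simp
      also have "\<dots> = g (l, e)" using T(3) l e by simp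
      also have "\<dots> = - (\<Sum>i<?d. scale (coeff p i) (b (l, i)))" by (simp add: g_def e)
      finally show ?thesis .
    qed
    have z0: "poly_op T p (b (l, 0)) = 0" if l: "l < m" for l
    proof -
      have "poly_op T p (b (l, 0)) = (\<Sum>i<?d. scale (coeff p i) ((T ^^ i) (b (l, 0)))) + (T ^^ ?d) (b (l, 0))"
        using p by (simp add: poly_op_def monic_irreducible_def flip: lessThan_Suc_atMost)
      also have "(\<Sum>i<?d. scale (coeff p i) ((T ^^ i) (b (l, 0)))) = (\<Sum>i<?d. scale (coeff p i) (b (l, i)))"
        using pow[OF l] by simp
      finally show ?thesis unfolding top[OF l] by simp
    qed
    have zj: "poly_op T p ((T ^^ j) (b (l, 0))) = 0" if l: "l < m" for l j
    proof (induction j)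
      case (Suc j)
      have "(T ^^ j) (b (l, 0)) \<in> V" by (rule funpow_in[OF T(2) bV[OF l d]])
      from poly_op_commute[OF V(1) T(2) this, of p] Suc lin_on_0[OF V(1) T(2)]
      show ?case by simp
    qed (use z0[OF l] in simp)
    have z: "poly_op T p v = 0" if "v \<in> V" for v
    proof -
      have lz: "lin_on V (\<lambda>_. 0)" using subspace_0[OF V(1)] by (simp add: lin_on_def)
      have zz: "poly_op T p (b i) = 0" if "i \<in> ?I" for i
        using that zj pow by (metis mem_Sigma_iff lessThan_iff surj_pair)
      show ?thesis
      proof (rule lin_on_eqI[where I = ?I and b = b, OF V(1) lin_on_poly_op[OF V(1) T(2)] lz _ _ zz that])
        show "b i \<in> V" if "i \<in> ?I" for i using that bV by auto
        show "V \<subseteq> fam_span ?I b" unfolding span ..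
      qed
    qed
    have ops: "T \<in> ops V p" using T(1,2) z by (simp add: ops_def)
    have eq: "cyclic_fam T vs i = b i" if "i \<in> ?I" for i
      using that pow by (auto simp: cyclic_fam_def vs_def)
    have "vs \<in> cyclic_frames V T ?d m"
      using ind indep_fam_cong[of ?I "cyclic_fam T vs" b, OF eq] bV d
      by (auto simp: cyclic_frames_def vs_def)
    moreover have "b = restrict (cyclic_fam T vs) ?I"
    proof (rule extensionalityI[where A = ?I])
      show "b \<in> extensional ?I" using b by (auto simp: frames_def PiE_def)
    qed (use eq in auto)
    ultimately show "b \<in> ?f ` ?S" using ops by force
  qed
  have "card ?S = card (ops V p) * gl_order (?q ^ ?d) m"
  proof -
    have "card (cyclic_frames V T ?d m) = gl_order (?q ^ ?d) m" if "T \<in> ops V p" for T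
      using card_cyclic_frames[OF V that p, of m] by (simp add: gl_order_def n flip: power_mult)
    moreover have "finite (cyclic_frames V T ?d m)" for T
      unfolding cyclic_frames_def by (rule finite_PiE_restricted) (use V in auto)
    ultimately show ?thesis using finite_ops[OF V(2)] by (subst card_SigmaI) auto
  qed
  moreover have "card ?S = card (frames ?I V)" using card_image[OF inj, unfolded im] by (rule sym)
  moreover have "card (frames ?I V) = gl_order ?q n"
    using card_frames[OF V(1,2), of ?I] V(3) cI by simp
  ultimately show ?thesis by simp
qed

text \<open>Let \<open>m\<close> be the quotient of \<open>n\<close> by the degree. If the degree
  does not divide \<open>n\<close>, then \<open>degree p * m < n\<close>, so the counting formula
  still produces \<open>Suc m\<close> cyclically independent vectors; but their span would have more
  than \<open>CARD('a) ^ n\<close> elements.\<close>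

lemma ops_irreducible_empty:
  assumes V: "subspace V" "finite V" "card V = CARD('a) ^ n"
    and p: "monic_irreducible p" and n: "\<not> degree p dvd n"
  shows "ops V p = {}"
proof (rule equals0I)
  fix T assume T: "T \<in> ops V p"
  let ?d = "degree p" and ?q = "CARD('a)"
  define m where "m = n div ?d"
  have lin: "lin_on V T" using T by (simp add: ops_def)
  have d: "?d > 0" using p irreducible_degree_pos by (auto simp: monic_irreducible_def)
  have lt: "?d * m < n"
    using n by (metis m_def dvd_triv_left le_neq_implies_less times_div_less_eq_dividend)
  have "?q ^ n - ?q ^ (?d * l) > 0" if "l < Suc m" for l
  proof -
    have "?d * l \<le> ?d * m" using that by simp
    then have "?d * l < n" using lt by linarith
    then show ?thesis using q_gt_1 by (simp add: power_strict_increasing)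
  qed
  then have "card (cyclic_frames V T ?d (Suc m)) > 0"
    unfolding card_cyclic_frames[OF V T p] by (intro prod_pos) auto
  then obtain vs where vs: "vs \<in> cyclic_frames V T ?d (Suc m)"
    by (metis card_gt_0_iff ex_in_conv)
  let ?I = "{..<Suc m} \<times> {..<?d}"
  have "fam_span ?I (cyclic_fam T vs) \<subseteq> V"
    by (rule fam_span_subset[OF V(1)])
       (use vs funpow_in[OF lin] in \<open>auto simp: cyclic_fam_def cyclic_frames_def\<close>)
  then have "card (fam_span ?I (cyclic_fam T vs)) \<le> ?q ^ n"
    using card_mono[OF V(2)] V(3) by metis
  moreover have "card (fam_span ?I (cyclic_fam T vs)) = ?q ^ (Suc m * ?d)"
    using vs by (subst card_fam_span) (auto simp: cyclic_frames_def)
  ultimately have "Suc m * ?d \<le> n" using q_gt_1 power_le_imp_le_exp by metis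
  moreover have "n < Suc m * ?d"
    using d by (metis m_def mult.commute dividend_less_times_div mult_Suc_right)
  ultimately show False by simp
qed

section \<open>Direct sum decompositions and coprime annihilators\<close>

definition splittings :: "'b set \<Rightarrow> ('b set \<times> 'b set) set" where
  "splittings V = {(A, B). subspace A \<and> subspace B \<and> A \<subseteq> V \<and> B \<subseteq> V \<and> A \<inter> B = {0} \<and>
     (\<forall>v\<in>V. \<exists>a\<in>A. \<exists>b\<in>B. v = a + b)}"

lemma splittingD:
  assumes "(A, B) \<in> splittings V"
  shows "subspace A" "subspace B" "A \<subseteq> V" "B \<subseteq> V" "A \<inter> B = {0}" "\<And>v. v \<in> V \<Longrightarrow> \<exists>a\<in>A. \<exists>b\<in>B. v = a + b"
  using assms by (auto simp: splittings_def)

lemma splitting_unique: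
  assumes "(A, B) \<in> splittings V" "a \<in> A" "a' \<in> A" "b \<in> B" "b' \<in> B" "a + b = a' + b'"
  shows "a = a'" "b = b'"
proof -
  note s = splittingD[OF assms(1)]
  have "a - a' = b' - b" using assms(6) by (simp add: algebra_simps)
  moreover have "a - a' \<in> A" "b' - b \<in> B" using assms s by (auto intro: subspace_diff)
  ultimately have "a - a' \<in> A \<inter> B" by simp
  then show "a = a'" using s(5) by simp
  then show "b = b'" using assms(6) by simp
qed

lemma card_splitting:
  assumes V: "subspace V" "finite V" and s: "(A, B) \<in> splittings V"
  shows "card V = card A * card B"
proof -
  note sp = splittingD[OF s]
  have "inj_on (\<lambda>(a, b). a + b) (A \<times> B)"
    using splitting_unique[OF s] by (auto simp: inj_on_def)
  moreover have "(\<lambda>(a, b). a + b) ` (A \<times> B) = V"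
    using sp V(1) by (force intro: subspace_add)
  ultimately show ?thesis by (metis card_image card_cartesian_product)
qed

lemma finite_splittings: "finite V \<Longrightarrow> finite (splittings V)"
  by (rule finite_subset[of _ "Pow V \<times> Pow V"]) (auto simp: splittings_def)

text \<open>Primary decomposition as a bijection: an operator annihilated by \<open>f * g\<close> is
  the same as the pair of kernels of \<open>f\<close> and \<open>g\<close>, which split
  \<open>V\<close> by the Bezout relation, together with the restrictions to them. Conversely two
  operators on complementary subspaces are glued along the decomposition.\<close>

lemma ops_mult_bij:
  assumes V: "subspace V" "finite V" and uv: "u * f + v * g = 1"
  shows "card (ops V (f * g)) = (\<Sum>(A, B)\<in>splittings V. card (ops A f) * card (ops B g))"
proof -
  let ?ker = "\<lambda>T h. {x \<in> V. poly_op T h x = 0}"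
  let ?S = "SIGMA (A, B):splittings V. ops A f \<times> ops B g"
  let ?F = "\<lambda>T. ((?ker T f, ?ker T g), (restrict T (?ker T f), restrict T (?ker T g)))"
  have ker_sub: "subspace (?ker T h)" "lin_on (?ker T h) T" if "lin_on V T" for T h
  proof -
    note l = lin_on_poly_op[OF V(1) that, of h]
    show "subspace (?ker T h)"
      using lin_onD[OF l] lin_on_0[OF V(1) l] V(1)
      by (auto intro!: subspaceI intro: subspace_0 subspace_add subspace_scale)
    have "poly_op T h (T x) = 0" if "x \<in> V" "poly_op T h x = 0" for x
      using poly_op_commute[OF V(1) \<open>lin_on V T\<close> that(1), of h] lin_on_0[OF V(1) \<open>lin_on V T\<close>] that by simp
    then show "lin_on (?ker T h) T" using that by (auto simp: lin_on_def)
  qed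
  have ker_split: "(?ker T f, ?ker T g) \<in> splittings V" if T: "T \<in> ops V (f * g)" for T
  proof -
    have lin: "lin_on V T" and z: "\<And>x. x \<in> V \<Longrightarrow> poly_op T (f * g) x = 0" using T by (auto simp: ops_def)
    note mult = poly_op_mult[OF V(1) lin]
    \<comment> \<open>The Bezout relation applied to \<open>x\<close>: the summand with
      \<open>v * g\<close> is killed by \<open>f\<close>, the one with \<open>u * f\<close> by
      \<open>g\<close>.\<close>
    have one: "x = poly_op T (v * g) x + poly_op T (u * f) x" for x
      using poly_op_add[of T "u * f" "v * g" x] uv by (simp add: add.commute)
    have "\<exists>a\<in>?ker T f. \<exists>b\<in>?ker T g. x = a + b" if x: "x \<in> V" for x
    proof (intro bexI)
      show "x = poly_op T (v * g) x + poly_op T (u * f) x" by (rule one)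
      have "poly_op T f (poly_op T (v * g) x) = poly_op T v (poly_op T (f * g) x)"
        unfolding mult[OF x, symmetric] by (simp add: mult_ac)
      then show "poly_op T (v * g) x \<in> ?ker T f"
        using z[OF x] poly_op_in[OF V(1) lin x] lin_on_0[OF V(1) lin_on_poly_op[OF V(1) lin]] by simp
      have "poly_op T g (poly_op T (u * f) x) = poly_op T u (poly_op T (f * g) x)"
        unfolding mult[OF x, symmetric] by (simp add: mult_ac)
      then show "poly_op T (u * f) x \<in> ?ker T g"
        using z[OF x] poly_op_in[OF V(1) lin x] lin_on_0[OF V(1) lin_on_poly_op[OF V(1) lin]] by simp
    qed
    moreover have "x = 0" if "x \<in> V" "poly_op T f x = 0" "poly_op T g x = 0" for x
      using one[of x] that lin_on_0[OF V(1) lin_on_poly_op[OF V(1) lin]] by (simp add: mult)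
    moreover have "0 \<in> ?ker T f" "0 \<in> ?ker T g"
      using ker_sub(1)[OF lin] subspace_0 by blast+
    ultimately show ?thesis
      using ker_sub(1)[OF lin] unfolding splittings_def by blast
  qed
  have inj: "inj_on ?F (ops V (f * g))"
  proof (rule inj_onI)
    fix T T' assume T: "T \<in> ops V (f * g)" "T' \<in> ops V (f * g)" and eq: "?F T = ?F T'"
    have lin: "lin_on V T" "lin_on V T'" using T by (auto simp: ops_def)
    note eqs = eq[unfolded prod.inject]
    note kf = conjunct1[OF conjunct1[OF eqs]] conjunct2[OF conjunct1[OF eqs]]
      and rf = conjunct1[OF conjunct2[OF eqs]] and rg = conjunct2[OF conjunct2[OF eqs]]
    have on_f: "T x = T' x" if "x \<in> ?ker T f" for x
      using fun_cong[OF rf, of x] that unfolding kf[symmetric] by (simp only: restrict_apply if_True)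
    have on_g: "T x = T' x" if "x \<in> ?ker T g" for x
      using fun_cong[OF rg, of x] that unfolding kf[symmetric] by (simp only: restrict_apply if_True)
    have "T x = T' x" if "x \<in> V" for x
    proof -
      obtain a b where ab: "a \<in> ?ker T f" "b \<in> ?ker T g" "x = a + b"
        using splittingD(6)[OF ker_split[OF T(1)] \<open>x \<in> V\<close>] by blast
      then have "a \<in> V" "b \<in> V" by auto
      then show ?thesis
        unfolding ab(3) using lin_onD(1)[OF lin(1)] lin_onD(1)[OF lin(2)] on_f[OF ab(1)] on_g[OF ab(2)] by simp
    qed
    then show "T = T'" using T by (auto simp: ops_def intro: extensionalityI)
  qed
  have im: "?F ` ops V (f * g) = ?S"
  proof (intro equalityI subsetI)
    fix y assume "y \<in> ?F ` ops V (f * g)"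
    then obtain T where T: "T \<in> ops V (f * g)" and y: "y = ?F T" by blast
    have lin: "lin_on V T" using T by (simp add: ops_def)
    have "restrict T (?ker T h) \<in> ops (?ker T h) h" for h
    proof -
      have "poly_op (restrict T (?ker T h)) h x = 0" if "x \<in> ?ker T h" for x
        using poly_op_cong[OF ker_sub(2)[OF lin, of h], of "restrict T (?ker T h)" x h] that by simp
      then show ?thesis
        using lin_on_restrict[OF ker_sub[OF lin]] by (simp add: ops_def)
    qed
    then show "y \<in> ?S" unfolding y using ker_split[OF T] by simp
  next
    fix y assume "y \<in> ?S"
    then obtain A B T1 T2 where y: "y = ((A, B), (T1, T2))" and s: "(A, B) \<in> splittings V"
      and T1: "T1 \<in> ops A f" and T2: "T2 \<in> ops B g" by auto
    note sp = splittingD[OF s]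
    have l1: "lin_on A T1" and l2: "lin_on B T2" using T1 T2 by (auto simp: ops_def)
    define \<pi> where "\<pi> x = (SOME ab. fst ab \<in> A \<and> snd ab \<in> B \<and> x = fst ab + snd ab)" for x
    have \<pi>: "fst (\<pi> x) \<in> A" "snd (\<pi> x) \<in> B" "x = fst (\<pi> x) + snd (\<pi> x)" if "x \<in> V" for x
    proof -
      have "\<exists>ab. fst ab \<in> A \<and> snd ab \<in> B \<and> x = fst ab + snd ab" using sp(6)[OF that] by force
      then have "fst (\<pi> x) \<in> A \<and> snd (\<pi> x) \<in> B \<and> x = fst (\<pi> x) + snd (\<pi> x)"
        unfolding \<pi>_def by (rule someI_ex)
      then show "fst (\<pi> x) \<in> A" "snd (\<pi> x) \<in> B" "x = fst (\<pi> x) + snd (\<pi> x)" by auto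
    qed
    define T where "T = restrict (\<lambda>x. T1 (fst (\<pi> x)) + T2 (snd (\<pi> x))) V"
    have T: "T (a + b) = T1 a + T2 b" if ab: "a \<in> A" "b \<in> B" for a b
    proof -
      have V': "a + b \<in> V" using ab sp V(1) by (auto intro: subspace_add)
      have "a = fst (\<pi> (a + b))" "b = snd (\<pi> (a + b))"
        using splitting_unique[OF s ab(1) \<pi>(1)[OF V'] ab(2) \<pi>(2)[OF V'] \<pi>(3)[OF V']] .
      then show ?thesis using V' by (simp add: T_def)
    qed
    have TA: "T a = T1 a" if "a \<in> A" for a
      using T[OF that subspace_0[OF sp(2)]] lin_on_0[OF sp(2) l2] by simp
    have TB: "T b = T2 b" if "b \<in> B" for b
      using T[OF subspace_0[OF sp(1)] that] lin_on_0[OF sp(1) l1] by simp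
    have lin: "lin_on V T"
      unfolding lin_on_def
    proof (intro conjI ballI allI)
      fix x x' assume x: "x \<in> V" "x' \<in> V"
      obtain a b a' b' where ab: "a \<in> A" "b \<in> B" "x = a + b" "a' \<in> A" "b' \<in> B" "x' = a' + b'"
        using sp(6)[OF x(1)] sp(6)[OF x(2)] by blast
      have "x + x' = (a + a') + (b + b')" using ab by (simp add: algebra_simps)
      moreover have "a + a' \<in> A" "b + b' \<in> B" using ab sp by (auto intro: subspace_add)
      ultimately have "T (x + x') = T1 (a + a') + T2 (b + b')" using T by simp
      then show "T (x + x') = T x + T x'"
        using ab T lin_onD(1)[OF l1] lin_onD(1)[OF l2] by (simp add: algebra_simps)
    next
      fix c x assume x: "x \<in> V"
      obtain a b where ab: "a \<in> A" "b \<in> B" "x = a + b" using sp(6)[OF x] by blast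
      have "scale c a \<in> A" "scale c b \<in> B" using ab sp by (auto intro: subspace_scale)
      then have "T (scale c x) = T1 (scale c a) + T2 (scale c b)"
        using T ab by (simp add: scale_right_distrib)
      then show "T (scale c x) = scale c (T x)"
        using ab T lin_onD(2)[OF l1] lin_onD(2)[OF l2] by (simp add: scale_right_distrib)
    next
      fix x assume x: "x \<in> V"
      obtain a b where ab: "a \<in> A" "b \<in> B" "x = a + b" using sp(6)[OF x] by blast
      then have "T1 a \<in> V" "T2 b \<in> V" using lin_onD(3)[OF l1] lin_onD(3)[OF l2] sp by blast+
      then show "T x \<in> V" using ab T V(1) by (simp add: subspace_add)
    qed
    have linA: "lin_on A T" and linB: "lin_on B T"
      using l1 l2 TA TB sp(1,2) by (auto simp: lin_on_def subspace_add subspace_scale)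
    have fA: "poly_op T f a = 0" if "a \<in> A" for a
      using poly_op_cong[OF linA, of T1 a f] TA that T1 by (simp add: ops_def)
    have gB: "poly_op T g b = 0" if "b \<in> B" for b
      using poly_op_cong[OF linB, of T2 b g] TB that T2 by (simp add: ops_def)
    have fg: "poly_op T (f * g) x = 0" if x: "x \<in> V" for x
    proof -
      obtain a b where ab: "a \<in> A" "b \<in> B" "x = a + b" using sp(6)[OF x] by blast
      then have "a \<in> V" "b \<in> V" using sp by auto
      moreover have "poly_op T (f * g) a = 0"
        using poly_op_dvd[OF V(1) lin \<open>a \<in> V\<close> dvd_triv_left fA[OF ab(1)]] .
      moreover have "poly_op T (f * g) b = 0"
        using poly_op_dvd[OF V(1) lin \<open>b \<in> V\<close> dvd_triv_right gB[OF ab(2)]] .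
      ultimately show ?thesis
        unfolding ab(3) using lin_onD(1)[OF lin_on_poly_op[OF V(1) lin]] by simp
    qed
    have Tops: "T \<in> ops V (f * g)" using lin fg by (simp add: ops_def T_def)
    have coprime0: "x = 0" if "x \<in> ?ker T f" "x \<in> ?ker T g" for x
      using splittingD(5)[OF ker_split[OF Tops]] that by blast
    \<comment> \<open>The glued operator has to give back the given subspaces. If
      \<open>a + b\<close> is killed by \<open>f\<close>, then so is \<open>b\<close>, which is also
      killed by \<open>g\<close>; coprimality leaves \<open>b = 0\<close>.\<close>
    have kA: "?ker T f = A"
    proof (intro equalityI subsetI)
      fix x assume x: "x \<in> ?ker T f"
      then obtain a b where ab: "a \<in> A" "b \<in> B" "x = a + b" using sp(6) by blast
      have aV: "a \<in> V" "b \<in> V" using ab sp by auto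
      have "poly_op T f x = poly_op T f a + poly_op T f b"
        unfolding ab(3) by (rule lin_onD(1)[OF lin_on_poly_op[OF V(1) lin] aV])
      then have "poly_op T f b = 0" using x fA[OF ab(1)] by simp
      then have "b = 0" using coprime0[of b] gB[OF ab(2)] aV by simp
      then show "x \<in> A" using ab by simp
    qed (use fA sp in auto)
    have kB: "?ker T g = B"
    proof (intro equalityI subsetI)
      fix x assume x: "x \<in> ?ker T g"
      then obtain a b where ab: "a \<in> A" "b \<in> B" "x = a + b" using sp(6) by blast
      have aV: "a \<in> V" "b \<in> V" using ab sp by auto
      have "poly_op T g x = poly_op T g a + poly_op T g b"
        unfolding ab(3) by (rule lin_onD(1)[OF lin_on_poly_op[OF V(1) lin] aV])
      then have "poly_op T g a = 0" using x gB[OF ab(2)] by simp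
      then have "a = 0" using coprime0[of a] fA[OF ab(1)] aV by simp
      then show "x \<in> B" using ab by simp
    qed (use gB sp in auto)
    have "restrict T A = T1" "restrict T B = T2"
      using TA TB T1 T2 by (auto simp: ops_def restrict_def extensional_def fun_eq_iff)
    then have "?F T = y" unfolding kA kB y by simp
    then show "y \<in> ?F ` ops V (f * g)" using Tops by blast
  qed
  have "card (ops V (f * g)) = card ?S" using card_image[OF inj, unfolded im] by (rule sym)
  also have "\<dots> = (\<Sum>(A, B)\<in>splittings V. card (ops A f) * card (ops B g))"
  proof -
    have fin: "finite A" "finite B" if "(A, B) \<in> splittings V" for A B
      using splittingD(3,4)[OF that] V(2) by (auto intro: finite_subset)
    have "card ?S = (\<Sum>s\<in>splittings V. card (case s of (A, B) \<Rightarrow> ops A f \<times> ops B g))"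
      by (rule card_SigmaI[OF finite_splittings[OF V(2)]])
         (use fin in \<open>auto intro!: finite_cartesian_product finite_ops\<close>)
    also have "\<dots> = (\<Sum>(A, B)\<in>splittings V. card (ops A f) * card (ops B g))"
      by (intro sum.cong refl) (simp add: card_cartesian_product split: prod.split)
    finally show ?thesis .
  qed
  finally show ?thesis .
qed

text \<open>An ordered basis of \<open>V\<close> indexed by a disjoint sum is the same as a
  splitting with these dimensions and an ordered basis of either part; counting the bases in both
  ways gives the identity.\<close>

lemma card_splittings:
  assumes V: "subspace V" "finite V" "card V = CARD('a) ^ (a + b)"
  shows "card {(A, B) \<in> splittings V. card A = CARD('a) ^ a \<and> card B = CARD('a) ^ b} *
    (gl_order CARD('a) a * gl_order CARD('a) b) = gl_order CARD('a) (a + b)"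
proof -
  let ?q = "CARD('a)"
  let ?C = "{(A, B) \<in> splittings V. card A = ?q ^ a \<and> card B = ?q ^ b}"
  let ?I = "{..<a} <+> {..<b}"
  let ?S = "SIGMA (A, B):?C. frames {..<a} A \<times> frames {..<b} B"
  let ?F = "\<lambda>(_, (x, y)). case_sum x y"
  have cI: "card ?I = a + b" by (simp add: card_Plus)
  have fin: "finite A" "finite B" if "(A, B) \<in> splittings V" for A B
    using splittingD(3,4)[OF that] V(2) finite_subset by blast+
  have span: "fam_span {..<a} x = A" "fam_span {..<b} y = B"
    if "(A, B) \<in> ?C" "x \<in> frames {..<a} A" "y \<in> frames {..<b} B" for A B x y
  proof -
    have s: "(A, B) \<in> splittings V" "card A = ?q ^ a" "card B = ?q ^ b" using that(1) by auto
    show "fam_span {..<a} x = A"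
      using splittingD(1)[OF s(1)] fin[OF s(1)] s that(2) by (intro frame_spans) auto
    show "fam_span {..<b} y = B"
      using splittingD(2)[OF s(1)] fin[OF s(1)] s that(3) by (intro frame_spans) auto
  qed
  have split: "(\<Sum>i\<in>?I. scale (c i) (z i)) =
    (\<Sum>i<a. scale (c (Inl i)) (z (Inl i))) + (\<Sum>i<b. scale (c (Inr i)) (z (Inr i)))" for c z
    by (simp add: sum.Plus o_def)
  have inj: "inj_on ?F ?S"
  proof (rule inj_onI)
    fix s s' assume s: "s \<in> ?S" "s' \<in> ?S" "?F s = ?F s'"
    obtain A B x y A' B' x' y' where ss: "s = ((A, B), (x, y))" "s' = ((A', B'), (x', y'))"
      by (metis surj_pair)
    have "x = x'" "y = y'" using s(3) by (auto simp: ss fun_eq_iff split: sum.splits dest: spec[of _ "Inl _"] spec[of _ "Inr _"])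
    then show "s = s'" using span[of A B x y] span[of A' B' x' y'] s(1,2) by (simp add: ss)
  qed
  have im: "?F ` ?S = frames ?I V"
  proof (intro equalityI subsetI)
    fix z assume "z \<in> ?F ` ?S"
    then obtain A B x y where z: "z = case_sum x y" and AB: "(A, B) \<in> ?C"
      and x: "x \<in> frames {..<a} A" and y: "y \<in> frames {..<b} B" by auto
    have s: "(A, B) \<in> splittings V" using AB by simp
    note sp = splittingD[OF s]
    have "z \<in> ?I \<rightarrow>\<^sub>E V"
      using x y sp(3,4) by (auto simp: z frames_def PiE_def extensional_def split: sum.splits)
    moreover have "indep_fam ?I z"
      unfolding indep_fam_def
    proof (intro allI impI)
      fix c assume "(\<Sum>i\<in>?I. scale (c i) (z i)) = 0"
      then have eq: "(\<Sum>i<a. scale (c (Inl i)) (x i)) + (\<Sum>i<b. scale (c (Inr i)) (y i)) = 0 + 0"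
        unfolding split by (simp add: z)
      have "(\<Sum>i<a. scale (c (Inl i)) (x i)) \<in> A"
        using fam_spanI[of "\<lambda>i. c (Inl i)" x "{..<a}"] span(1)[OF AB x y] by simp
      moreover have "(\<Sum>i<b. scale (c (Inr i)) (y i)) \<in> B"
        using fam_spanI[of "\<lambda>i. c (Inr i)" y "{..<b}"] span(2)[OF AB x y] by simp
      ultimately have "(\<Sum>i<a. scale (c (Inl i)) (x i)) = 0" "(\<Sum>i<b. scale (c (Inr i)) (y i)) = 0"
        using splitting_unique[OF s _ subspace_0[OF sp(1)] _ subspace_0[OF sp(2)] eq] by simp_all
      then have "c (Inl i) = 0" if "i < a" for i
        using indep_famD[of "{..<a}" x "\<lambda>i. c (Inl i)" i] x that by (simp add: frames_def)
      moreover have "c (Inr i) = 0" if "i < b" for i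
        using indep_famD[of "{..<b}" y "\<lambda>i. c (Inr i)" i] y that \<open>(\<Sum>i<b. scale (c (Inr i)) (y i)) = 0\<close>
        by (simp add: frames_def)
      ultimately show "\<forall>i\<in>?I. c i = 0" by auto
    qed
    ultimately show "z \<in> frames ?I V" by (simp add: frames_def)
  next
    fix z assume z: "z \<in> frames ?I V"
    define x y where "x = (\<lambda>i. z (Inl i))" and "y = (\<lambda>i. z (Inr i))"
    define A B where "A = fam_span {..<a} x" and "B = fam_span {..<b} y"
    have zeq: "z = case_sum x y" by (auto simp: x_def y_def fun_eq_iff split: sum.splits)
    have ind: "indep_fam ?I z" and zV: "z \<in> ?I \<rightarrow>\<^sub>E V" using z by (auto simp: frames_def)
    have span_z: "fam_span ?I z = V" using V cI by (intro frame_spans z) simp_all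
    have ix: "indep_fam {..<a} x"
      unfolding indep_fam_def
    proof (intro allI impI ballI)
      fix c i assume c: "(\<Sum>i<a. scale (c i) (x i)) = 0" and i: "i \<in> {..<a}"
      have "(\<Sum>i\<in>?I. scale (case_sum c (\<lambda>_. 0) i) (z i)) = 0" unfolding split using c by (simp add: x_def)
      from indep_famD[OF ind this InlI[OF i]] show "c i = 0" by simp
    qed
    have iy: "indep_fam {..<b} y"
      unfolding indep_fam_def
    proof (intro allI impI ballI)
      fix c i assume c: "(\<Sum>i<b. scale (c i) (y i)) = 0" and i: "i \<in> {..<b}"
      have "(\<Sum>i\<in>?I. scale (case_sum (\<lambda>_. 0) c i) (z i)) = 0" unfolding split using c by (simp add: y_def)
      from indep_famD[OF ind this InrI[OF i]] show "c i = 0" by simp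
    qed
    have AV: "A \<subseteq> V" unfolding A_def
      by (rule fam_span_subset[OF V(1)]) (use zV in \<open>auto simp: x_def\<close>)
    have BV: "B \<subseteq> V" unfolding B_def
      by (rule fam_span_subset[OF V(1)]) (use zV in \<open>auto simp: y_def\<close>)
    have "A \<inter> B = {0}"
    proof (intro equalityI subsetI)
      fix w assume w: "w \<in> A \<inter> B"
      obtain c where c1: "w = (\<Sum>i<a. scale (c i) (x i))"
        using IntD1[OF w] unfolding A_def fam_span_def by (elim rangeE)
      obtain c' where c2: "w = (\<Sum>i<b. scale (c' i) (y i))"
        using IntD2[OF w] unfolding B_def fam_span_def by (elim rangeE)
      have "(\<Sum>i\<in>?I. scale (case_sum c (\<lambda>i. - c' i) i) (z i)) = w - w"
        unfolding split using c1 c2 by (simp add: x_def y_def scale_minus_left sum_negf)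
      then have *: "(\<Sum>i\<in>?I. scale (case_sum c (\<lambda>i. - c' i) i) (z i)) = 0" by simp
      have "c i = 0" if "i < a" for i
        using indep_famD[OF ind * InlI, of i] that by simp
      then show "w \<in> {0}" using c1 by simp
    qed (auto simp: A_def B_def intro: subspace_0[OF fam_span_subspace])
    moreover have "\<forall>v\<in>V. \<exists>a'\<in>A. \<exists>b'\<in>B. v = a' + b'"
    proof
      fix v assume "v \<in> V"
      then have "v \<in> fam_span ?I z" using span_z by simp
      then obtain c where "v = (\<Sum>i\<in>?I. scale (c i) (z i))" unfolding fam_span_def by (elim rangeE)
      then have "v = (\<Sum>i<a. scale (c (Inl i)) (x i)) + (\<Sum>i<b. scale (c (Inr i)) (y i))"
        unfolding split by (simp add: x_def y_def)
      then show "\<exists>a'\<in>A. \<exists>b'\<in>B. v = a' + b'"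
        unfolding A_def B_def by (rule bexI[OF bexI[OF _ fam_spanI] fam_spanI])
    qed
    ultimately have "(A, B) \<in> splittings V"
      using AV BV by (simp add: splittings_def A_def B_def fam_span_subspace)
    moreover have "card A = ?q ^ a" "card B = ?q ^ b"
      unfolding A_def B_def using card_fam_span(2)[OF _ ix] card_fam_span(2)[OF _ iy] by simp_all
    ultimately have AB: "(A, B) \<in> ?C" by simp
    have "x i = undefined" if "i \<notin> {..<a}" for i
      using PiE_arb[OF zV, of "Inl i"] that by (auto simp: x_def)
    moreover have "x i \<in> A" if "i \<in> {..<a}" for i
      unfolding A_def by (rule fam_span_base) (use that in auto)
    ultimately have "x \<in> {..<a} \<rightarrow>\<^sub>E A" by (intro PiE_I)
    moreover have "y i = undefined" if "i \<notin> {..<b}" for i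
      using PiE_arb[OF zV, of "Inr i"] that by (auto simp: y_def)
    moreover have "y i \<in> B" if "i \<in> {..<b}" for i
      unfolding B_def by (rule fam_span_base) (use that in auto)
    ultimately have xy: "x \<in> frames {..<a} A" "y \<in> frames {..<b} B"
      using ix iy by (auto simp: frames_def intro!: PiE_I)
    have "((A, B), (x, y)) \<in> ?S" using AB xy by simp
    then show "z \<in> ?F ` ?S" by (rule rev_image_eqI) (simp add: zeq)
  qed
  have "card ?S = card ?C * (gl_order ?q a * gl_order ?q b)"
  proof -
    have finC: "finite ?C" by (rule finite_subset[OF _ finite_splittings[OF V(2)]]) auto
    have "card (frames {..<a} A \<times> frames {..<b} B) = gl_order ?q a * gl_order ?q b" if "(A, B) \<in> ?C" for A B
      using that splittingD[of A B V] fin[of A B] card_frames[of A "{..<a}"] card_frames[of B "{..<b}"]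
      by (auto simp: card_cartesian_product)
    then have "(\<Sum>s\<in>?C. card (case s of (A, B) \<Rightarrow> frames {..<a} A \<times> frames {..<b} B))
        = (\<Sum>s\<in>?C. gl_order ?q a * gl_order ?q b)"
      by (intro sum.cong refl) auto
    moreover have "finite (case s of (A, B) \<Rightarrow> frames {..<a} A \<times> frames {..<b} B)" if "s \<in> ?C" for s
      using that fin by (auto intro!: finite_frames)
    ultimately show ?thesis using finC by (subst card_SigmaI) auto
  qed
  moreover have "card ?S = card (frames ?I V)" using card_image[OF inj, unfolded im] by (rule sym)
  moreover have "card (frames ?I V) = gl_order ?q (a + b)"
    using card_frames[OF V(1,2), of ?I] V(3) cI by simp
  ultimately show ?thesis by simp
qed

end

definition gl_fps :: "nat \<Rightarrow> nat \<Rightarrow> real fps" where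
  "gl_fps q d = Abs_fps (\<lambda>n. if d dvd n then 1 / real (gl_order (q ^ d) (n div d)) else 0)"

context operator_space
begin

text \<open>Induction on the set of roots. Write the remaining product \<open>g\<close> as
  \<open>poly g x + h * (X - x)\<close>, where \<open>poly g x\<close> is nonzero because the roots
  are distinct. Then \<open>v\<close> is a combination of the image of \<open>v\<close> under
  \<open>g\<close>, an eigenvector for \<open>x\<close>, and the image under \<open>h\<close> of a
  vector annihilated by \<open>g\<close>, to which the induction hypothesis applies.\<close>

lemma eigenvectors_span:
  assumes V: "subspace V" and T: "lin_on V T" and "finite L"
    and "v \<in> V" "poly_op T (\<Prod>x\<in>L. [:- x, 1:]) v = 0"
  shows "v \<in> span {w \<in> V. \<exists>x. T w = scale x w}"
  using assms(3-5)
proof (induction L arbitrary: v rule: finite_induct)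
  case empty
  then show ?case by (simp add: span_zero)
next
  case (insert x L)
  let ?E = "{w \<in> V. \<exists>x. T w = scale x w}"
  define g where "g = (\<Prod>x\<in>L. [:- x, 1:])"
  have EV: "span ?E \<subseteq> V" using V by (intro span_minimal) auto
  have TE: "w \<in> span ?E \<and> T w \<in> span ?E" if "w \<in> span ?E" for w
    using that
  proof (induction rule: span_induct_alt)
    case base
    then show ?case using lin_on_0[OF V T] by (simp add: span_zero)
  next
    case (step c e w)
    then have e: "e \<in> V" "w \<in> V" using EV by auto
    have "T (scale c e + w) = T (scale c e) + T w"
      using V e by (intro lin_onD(1)[OF T] subspace_scale)
    also have "T (scale c e) = scale c (T e)" using e(1) by (rule lin_onD(2)[OF T])
    finally have eq: "T (scale c e + w) = scale c (T e) + T w" .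
    obtain y where "T e = scale y e" using step(1) by blast
    then have "T e \<in> span ?E" using span_base[OF step(1)] by (simp add: span_scale)
    then show ?case unfolding eq using step span_base[OF step(1)] by (simp add: span_add span_scale)
  qed
  have lin: "lin_on (span ?E) T" using T EV TE by (simp add: lin_on_def subset_iff)
  note vV = insert.prems(1)
  have z: "poly_op T ([:- x, 1:] * g) v = 0" using insert by (simp add: g_def)
  let ?w1 = "poly_op T g v" and ?w2 = "poly_op T [:- x, 1:] v"
  have lin_factor: "poly_op T [:- x, 1:] w = T w - scale x w" for w
    by (simp add: poly_op_pCons)
  have w1V: "?w1 \<in> V" and w2V: "?w2 \<in> V" using poly_op_in[OF V T vV] by auto
  have "T ?w1 - scale x ?w1 = 0"
    using z poly_op_mult[OF V T vV, of "[:- x, 1:]" g] unfolding lin_factor by simp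
  then have "?w1 \<in> ?E" using w1V by auto
  then have w1: "?w1 \<in> span ?E" by (rule span_base)
  have "poly_op T g ?w2 = 0"
    using z poly_op_mult[OF V T vV, of g "[:- x, 1:]"] by (simp add: mult.commute)
  then have w2: "?w2 \<in> span ?E" using insert.IH[OF w2V] by (simp add: g_def)
  have gx: "poly g x \<noteq> 0"
    using insert.hyps by (auto simp: g_def poly_prod prod_zero_iff)
  have "[:- x, 1:] dvd g - [:poly g x:]" by (simp add: poly_eq_0_iff_dvd [symmetric])
  then obtain h where "g - [:poly g x:] = [:- x, 1:] * h" by (rule dvdE)
  then have "g = [:poly g x:] + h * [:- x, 1:]" by (simp add: algebra_simps)
  then have "?w1 = scale (poly g x) v + poly_op T h ?w2"
    using poly_op_add[of T "[:poly g x:]" "h * [:- x, 1:]" v] poly_op_mult[OF V T vV, of h "[:- x, 1:]"]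
    by simp
  then have "scale (poly g x) v = ?w1 - poly_op T h ?w2" by simp
  moreover have "poly_op T h ?w2 \<in> span ?E" by (rule poly_op_in[OF subspace_span lin w2])
  ultimately have "scale (poly g x) v \<in> span ?E" using w1 by (simp add: span_diff)
  then have "scale (inverse (poly g x)) (scale (poly g x) v) \<in> span ?E" by (rule span_scale)
  then show ?case using gx by simp
qed

end

section \<open>Operator counts as coefficients of power series\<close>

context finite_field_space
begin

lemma card_ops_1:
  assumes V: "subspace V" "finite V" "card V = CARD('a) ^ n"
  shows "card (ops V 1) = (if n = 0 then 1 else 0)"
proof (cases "n = 0")
  case True
  then obtain x where "V = {x}" using V(3) card_1_singletonE by auto
  then have V0: "V = {0}" using subspace_0[OF V(1)] by auto
  have "ops V 1 = {restrict (\<lambda>_. 0) V}"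
    by (auto simp: ops_def V0 lin_on_def fun_eq_iff extensional_def)
  then show ?thesis using True by simp
next
  case False
  have "ops V 1 = {}"
  proof (rule equals0I)
    fix T assume "T \<in> ops V 1"
    then have "V \<subseteq> {0}" by (auto simp: ops_def)
    then have "card V \<le> card {0 :: 'b}" by (intro card_mono) auto
    then have "CARD('a) ^ n \<le> 1" using V(3) by simp
    moreover have "CARD('a) ^ n > 1" using False q_gt_1 by (intro one_less_power) auto
    ultimately show False by simp
  qed
  then show ?thesis using False by simp
qed

lemma card_ops_gl_fps:
  assumes V: "subspace V" "finite V" "card V = CARD('a) ^ n" and p: "monic_irreducible p"
  shows "real (card (ops V p)) = real (gl_order CARD('a) n) * gl_fps CARD('a) (degree p) $ n"
proof (cases "degree p dvd n")
  case True
  then obtain m where n: "n = degree p * m" by (rule dvdE)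
  have d: "degree p > 0" using p irreducible_degree_pos by (auto simp: monic_irreducible_def)
  have "CARD('a) ^ degree p > 1" using d q_gt_1 by (intro one_less_power) auto
  then have "gl_order (CARD('a) ^ degree p) m > 0" by (rule gl_order_pos)
  moreover have "real (card (ops V p)) * real (gl_order (CARD('a) ^ degree p) m) = real (gl_order CARD('a) n)"
    using card_ops_irreducible[OF V p n] by (metis of_nat_mult)
  ultimately show ?thesis using d by (simp add: gl_fps_def n field_simps)
next
  case False
  then show ?thesis using ops_irreducible_empty[OF V p] by (simp add: gl_fps_def)
qed

text \<open>Grouped by the dimension \<open>a\<close> of the first part, the number of splittings
  cancels the two group orders and leaves \<open>gl_order CARD('a) n\<close>. After division by
  group orders, sums over splittings thus become Cauchy products.\<close>

lemma sum_splittings: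
  fixes F :: "'b set \<times> 'b set \<Rightarrow> real"
  assumes V: "subspace V" "finite V" "card V = CARD('a) ^ n"
    and F: "\<And>A B a. a \<le> n \<Longrightarrow> (A, B) \<in> splittings V \<Longrightarrow> card A = CARD('a) ^ a \<Longrightarrow>
      card B = CARD('a) ^ (n - a) \<Longrightarrow>
      F (A, B) = real (gl_order CARD('a) a) * real (gl_order CARD('a) (n - a)) * G a"
  shows "(\<Sum>s\<in>splittings V. F s) = real (gl_order CARD('a) n) * (\<Sum>a\<le>n. G a)"
proof -
  let ?q = "CARD('a)"
  define C where "C a = {(A, B) \<in> splittings V. card A = ?q ^ a \<and> card B = ?q ^ (n - a)}" for a
  have inj: "a = b" if "?q ^ a = ?q ^ b" for a b
    using that q_gt_1 power_inject_exp by blast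
  have fin: "finite (splittings V)" by (rule finite_splittings[OF V(2)])
  have finC: "finite (C a)" for a
    by (rule finite_subset[OF _ fin]) (auto simp: C_def)
  have split: "splittings V = (\<Union>a\<le>n. C a)"
  proof (intro equalityI subsetI)
    fix s assume "s \<in> splittings V"
    then obtain A B where s: "s = (A, B)" "(A, B) \<in> splittings V" by (cases s) auto
    note sp = splittingD[OF s(2)]
    have "finite A" "finite B" using sp(3,4) V(2) by (auto intro: finite_subset)
    then obtain a b where ab: "card A = ?q ^ a" "card B = ?q ^ b"
      using finite_subspace_card sp(1,2) by meson
    have "?q ^ n = ?q ^ (a + b)"
      using card_splitting[OF V(1,2) s(2)] V(3) ab by (simp add: power_add)
    then have "n = a + b" by (rule inj)
    then show "s \<in> (\<Union>a\<le>n. C a)" using s ab by (auto simp: C_def intro!: bexI[of _ a])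
  qed (auto simp: C_def)
  have "(\<Sum>s\<in>splittings V. F s) = (\<Sum>a\<le>n. \<Sum>s\<in>C a. F s)"
    unfolding split
  proof (rule sum.UNION_disjoint)
    show "\<forall>a\<in>{..n}. \<forall>b\<in>{..n}. a \<noteq> b \<longrightarrow> C a \<inter> C b = {}"
    proof (intro ballI impI equals0I)
      fix a b s assume "a \<noteq> b" "s \<in> C a \<inter> C b"
      then have "?q ^ a = ?q ^ b" by (auto simp: C_def)
      with \<open>a \<noteq> b\<close> show False using inj by blast
    qed
  qed (use finC in simp_all)
  also have "\<dots> = (\<Sum>a\<le>n. real (gl_order ?q n) * G a)"
  proof (intro sum.cong refl)
    fix a assume "a \<in> {..n}"
    then have a: "a \<le> n" by simp
    have "(\<Sum>s\<in>C a. F s) = (\<Sum>s\<in>C a. real (gl_order ?q a) * real (gl_order ?q (n - a)) * G a)"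
    proof (intro sum.cong refl)
      fix s assume "s \<in> C a"
      then obtain A B where "s = (A, B)" "(A, B) \<in> splittings V" "card A = ?q ^ a" "card B = ?q ^ (n - a)"
        by (auto simp: C_def)
      then show "F s = real (gl_order ?q a) * real (gl_order ?q (n - a)) * G a" using F[OF a] by simp
    qed
    also have "\<dots> = real (card (C a) * (gl_order ?q a * gl_order ?q (n - a))) * G a" by simp
    also have "card (C a) * (gl_order ?q a * gl_order ?q (n - a)) = gl_order ?q n"
      using card_splittings[of V a "n - a"] V a by (simp add: C_def)
    finally show "(\<Sum>s\<in>C a. F s) = real (gl_order ?q n) * G a" .
  qed
  finally show ?thesis by (simp add: sum_distrib_left)
qed

text \<open>Distinct monic irreducibles are coprime, so \<open>ops_mult_bij\<close> splits off one
  polynomial at a time, and each time the normalised count is convolved with the series of that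
  polynomial.\<close>

theorem card_ops_prod:
  assumes "finite S" "\<forall>p\<in>S. monic_irreducible p"
    and "subspace V" "finite V" "card V = CARD('a) ^ n"
  shows "real (card (ops V (\<Prod>S))) = real (gl_order CARD('a) n) * (\<Prod>p\<in>S. gl_fps CARD('a) (degree p)) $ n"
  using assms
proof (induction S arbitrary: V n rule: finite_induct)
  case empty
  then show ?case using card_ops_1[of V n] by (simp add: gl_order_def)
next
  case (insert p S)
  let ?q = "CARD('a)"
  note V = insert.prems(2-4)
  have p: "monic_irreducible p" and S: "\<forall>p\<in>S. monic_irreducible p" using insert.prems by auto
  have "\<not> p dvd \<Prod>S" using monic_irreducible_dvd_prod[OF insert.hyps(1) S p] insert.hyps(2) by blast
  then obtain u v where uv: "u * p + v * \<Prod>S = 1"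
    using irreducible_bezout[of p "\<Prod>S"] p unfolding monic_irreducible_def by blast
  let ?f = "gl_fps ?q (degree p)" and ?g = "\<Prod>p\<in>S. gl_fps ?q (degree p)"
  have "real (card (ops V (\<Prod>(insert p S)))) = real (card (ops V (p * \<Prod>S)))"
    using insert.hyps by simp
  also have "\<dots> = (\<Sum>s\<in>splittings V. (\<lambda>(A, B). real (card (ops A p)) * real (card (ops B (\<Prod>S)))) s)"
    unfolding ops_mult_bij[OF V(1,2) uv] by (simp add: case_prod_unfold)
  also have "\<dots> = real (gl_order ?q n) * (\<Sum>a\<le>n. ?f $ a * ?g $ (n - a))"
  proof (rule sum_splittings[OF V])
    fix A B a assume a: "a \<le> n" and s: "(A, B) \<in> splittings V"
      and c: "card A = ?q ^ a" "card B = ?q ^ (n - a)"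
    note sp = splittingD[OF s]
    have "finite A" "finite B" using sp(3,4) V(2) by (auto intro: finite_subset)
    then have "real (card (ops A p)) = real (gl_order ?q a) * ?f $ a"
      "real (card (ops B (\<Prod>S))) = real (gl_order ?q (n - a)) * ?g $ (n - a)"
      using card_ops_gl_fps[OF sp(1) _ c(1) p] insert.IH[OF S sp(2) _ c(2)] by simp_all
    then show "(case (A, B) of (A, B) \<Rightarrow> real (card (ops A p)) * real (card (ops B (\<Prod>S)))) =
      real (gl_order ?q a) * real (gl_order ?q (n - a)) * (?f $ a * ?g $ (n - a))"
      by simp
  qed
  also have "(\<Sum>a\<le>n. ?f $ a * ?g $ (n - a)) = (?f * ?g) $ n"
    by (simp add: fps_mult_nth atLeast0AtMost)
  also have "?f * ?g = (\<Prod>p\<in>insert p S. gl_fps ?q (degree p))"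
    using insert.hyps by simp
  finally show ?case .
qed

end

section \<open>Semisimple matrices\<close>

definition fun_scale :: "'a :: field \<Rightarrow> (nat \<Rightarrow> 'a) \<Rightarrow> nat \<Rightarrow> 'a" where
  "fun_scale c v = (\<lambda>i. c * v i)"

interpretation fun_space: operator_space "fun_scale :: 'a :: field \<Rightarrow> _"
  by unfold_locales (auto simp: fun_scale_def fun_eq_iff algebra_simps)

interpretation fin_fun_space: finite_field_space "fun_scale :: 'a :: {field, finite} \<Rightarrow> _"
  by unfold_locales

text \<open>Vectors are functions that vanish from \<open>n\<close> on. A single type then contains
  the coordinate spaces of all dimensions, and they are subspaces of one ambient space as the
  counting lemmas expect.\<close>

definition coord_space :: "nat \<Rightarrow> (nat \<Rightarrow> 'a :: field) set" where
  "coord_space n = {v. \<forall>i\<ge>n. v i = 0}"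

definition mat_op :: "nat \<Rightarrow> 'a :: field mat \<Rightarrow> (nat \<Rightarrow> 'a) \<Rightarrow> nat \<Rightarrow> 'a" where
  "mat_op n A v = (\<lambda>i. if i < n then \<Sum>j<n. A $$ (i, j) * v j else 0)"

definition unit_fun :: "nat \<Rightarrow> nat \<Rightarrow> 'a :: field" where
  "unit_fun j = (\<lambda>i. if i = j then 1 else 0)"

definition col_fun :: "nat \<Rightarrow> 'a :: field mat \<Rightarrow> nat \<Rightarrow> nat \<Rightarrow> 'a" where
  "col_fun n A j = (\<lambda>i. if i < n then A $$ (i, j) else 0)"

lemma sum_fun_apply: "(\<Sum>j\<in>J. f j) i = (\<Sum>j\<in>J. f j i)" for f :: "_ \<Rightarrow> _ \<Rightarrow> 'a :: comm_monoid_add"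
  by (induction J rule: infinite_finite_induct) auto

lemma coord_space_subspace: "fun_space.subspace (coord_space n)"
  by (rule fun_space.subspaceI) (auto simp: coord_space_def fun_scale_def)

lemma mat_op_in: "mat_op n A v \<in> coord_space n"
  by (simp add: mat_op_def coord_space_def)

lemma lin_on_mat_op: "fun_space.lin_on (coord_space n) (mat_op n A)"
  unfolding fun_space.lin_on_def
  by (auto simp: mat_op_in)
     (auto simp: mat_op_def fun_scale_def fun_eq_iff sum.distrib sum_distrib_left algebra_simps)

lemma unit_fun_sum: "(\<Sum>j<n. fun_scale (c j) (unit_fun j)) = (\<lambda>i. if i < n then c i else 0)"
proof
  fix i
  have "(\<Sum>j<n. fun_scale (c j) (unit_fun j)) i = (\<Sum>j<n. if j = i then c j else 0)"
    unfolding sum_fun_apply by (intro sum.cong) (auto simp: fun_scale_def unit_fun_def)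
  then show "(\<Sum>j<n. fun_scale (c j) (unit_fun j)) i = (if i < n then c i else 0)" by simp
qed

lemma unit_fun_in: "j < n \<Longrightarrow> unit_fun j \<in> coord_space n"
  by (auto simp: unit_fun_def coord_space_def)

lemma indep_unit_fun: "fun_space.indep_fam {..<n} unit_fun"
  unfolding fun_space.indep_fam_def unit_fun_sum
  by (auto simp: fun_eq_iff zero_fun_def split: if_splits)

lemma span_unit_fun: "fun_space.fam_span {..<n} unit_fun = coord_space n"
proof (intro equalityI subsetI)
  fix v assume "v \<in> fun_space.fam_span {..<n} unit_fun"
  then show "v \<in> coord_space n"
    by (auto simp: fun_space.fam_span_def unit_fun_sum coord_space_def)
next
  fix v :: "nat \<Rightarrow> 'a" assume "v \<in> coord_space n"
  then have "v = (\<Sum>j<n. fun_scale (v j) (unit_fun j))"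
    unfolding unit_fun_sum by (auto simp: coord_space_def)
  then show "v \<in> fun_space.fam_span {..<n} unit_fun"
    using fun_space.fam_spanI[of v unit_fun "{..<n}"] by simp
qed

lemma card_coord_space:
  "finite (coord_space n :: (nat \<Rightarrow> 'a :: {field, finite}) set)"
  "card (coord_space n :: (nat \<Rightarrow> 'a) set) = CARD('a) ^ n"
  using fin_fun_space.card_fam_span[OF finite_lessThan indep_unit_fun[of n]]
  by (simp_all add: span_unit_fun)

lemma mat_op_unit_fun: "j < n \<Longrightarrow> mat_op n A (unit_fun j) = col_fun n A j"
  by (auto simp: mat_op_def col_fun_def unit_fun_def fun_eq_iff if_distrib cong: if_cong)

lemma col_fun_in: "col_fun n A j \<in> coord_space n"
  by (simp add: col_fun_def coord_space_def)

lemma col_fun_sum: "(\<Sum>j<n. fun_scale (c j) (col_fun n A j)) = mat_op n A c"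
  by (rule ext) (auto simp: sum_fun_apply fun_scale_def col_fun_def mat_op_def mult.commute intro!: sum.neutral)

lemma indep_col_fun_iff:
  fixes A :: "'a :: field mat"
  assumes A: "A \<in> carrier_mat n n"
  shows "fun_space.indep_fam {..<n} (col_fun n A) \<longleftrightarrow> det A \<noteq> 0"
proof -
  have mv: "A *\<^sub>v v = 0\<^sub>v n \<longleftrightarrow> mat_op n A (\<lambda>i. vec_index v i) = 0" if "v \<in> carrier_vec n" for v
  proof -
    have "vec_index (A *\<^sub>v v) i = mat_op n A (\<lambda>i. vec_index v i) i" if "i < n" for i
      using A that \<open>v \<in> carrier_vec n\<close> by (simp add: mat_op_def scalar_prod_def lessThan_atLeast0)
    moreover have "mat_op n A (\<lambda>i. vec_index v i) i = 0" if "\<not> i < n" for i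
      using that by (simp add: mat_op_def)
    ultimately show ?thesis
      using A that by (auto simp: fun_eq_iff vec_eq_iff)
  qed
  have cong: "mat_op n A c = mat_op n A c'" if "\<And>i. i < n \<Longrightarrow> c i = c' i" for c c'
    unfolding mat_op_def using that by (intro ext if_cong refl sum.cong) simp
  show ?thesis
  proof
    assume ind: "fun_space.indep_fam {..<n} (col_fun n A)"
    show "det A \<noteq> 0"
    proof
      assume "det A = 0"
      then obtain v where v: "v \<in> carrier_vec n" "v \<noteq> 0\<^sub>v n" "A *\<^sub>v v = 0\<^sub>v n"
        using det_0_iff_vec_prod_zero_field[OF A] by blast
      then have "(\<Sum>j<n. fun_scale (vec_index v j) (col_fun n A j)) = 0"
        using mv by (simp add: col_fun_sum)
      then have "vec_index v j = 0" if "j < n" for j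
        using fun_space.indep_famD[OF ind, of "\<lambda>j. vec_index v j" j] that by simp
      then show False using v(1,2) by (auto simp: vec_eq_iff)
    qed
  next
    assume det: "det A \<noteq> 0"
    show "fun_space.indep_fam {..<n} (col_fun n A)"
      unfolding fun_space.indep_fam_def
    proof (intro allI impI ballI)
      fix c i assume c: "(\<Sum>j<n. fun_scale (c j) (col_fun n A j)) = 0" and i: "i \<in> {..<n}"
      have "mat_op n A (\<lambda>i. vec_index (vec n c) i) = mat_op n A c" by (rule cong) simp
      then have "A *\<^sub>v vec n c = 0\<^sub>v n" using c mv[of "vec n c"] by (simp add: col_fun_sum)
      moreover have "vec n c \<in> carrier_vec n" by simp
      ultimately have "vec n c = 0\<^sub>v n" using det det_0_iff_vec_prod_zero_field[OF A] by blast
      then have "vec_index (vec n c) i = 0" using i by simp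
      then show "c i = 0" using i by simp
    qed
  qed
qed

lemma invertible_mat_iff_det:
  fixes A :: "'a :: field mat"
  assumes A: "A \<in> carrier_mat n n"
  shows "invertible_mat A \<longleftrightarrow> det A \<noteq> 0"
proof
  assume "invertible_mat A"
  then obtain B where "A * B = 1\<^sub>m n" "B * A = 1\<^sub>m (dim_row B)"
    using A by (auto simp: invertible_mat_def inverts_mat_def)
  moreover from this have "B \<in> carrier_mat n n"
    using A by (metis carrier_matD(1,2) carrier_matI index_mult_mat(2,3) index_one_mat(2,3))
  ultimately have "det A * det B = 1"
    using det_mult[OF A, of B] by (metis det_one)
  then show "det A \<noteq> 0" by auto
next
  assume "det A \<noteq> 0"
  from det_non_zero_imp_unit[OF A this, of "()"]
  obtain B where "B \<in> carrier_mat n n" "A * B = 1\<^sub>m n" "B * A = 1\<^sub>m n"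
    by (auto simp: Units_def ring_mat_def)
  then show "invertible_mat A" using A
    by (auto simp: invertible_mat_def inverts_mat_def)
qed

text \<open>An invertible matrix is an ordered basis of the coordinate space, namely its
  columns.\<close>

lemma card_GL: "card (GL n :: 'a :: {field, finite} mat set) = gl_order CARD('a) n"
proof -
  let ?V = "coord_space n :: (nat \<Rightarrow> 'a) set"
  let ?f = "\<lambda>A :: 'a mat. restrict (col_fun n A) {..<n}"
  have ind: "fun_space.indep_fam {..<n} (?f A) \<longleftrightarrow> A \<in> GL n" if "A \<in> carrier_mat n n" for A
  proof -
    have "fun_space.indep_fam {..<n} (?f A) \<longleftrightarrow> fun_space.indep_fam {..<n} (col_fun n A)"
      by (rule fun_space.indep_fam_cong) simp
    then show ?thesis using that
      by (simp add: indep_col_fun_iff invertible_mat_iff_det GL_def)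
  qed
  have carr: "A \<in> carrier_mat n n" if "A \<in> GL n" for A :: "'a mat" using that by (simp add: GL_def)
  have "bij_betw ?f (GL n) (fun_space.frames {..<n} ?V)"
    unfolding bij_betw_def
  proof (intro conjI inj_onI equalityI subsetI)
    fix A B :: "'a mat" assume AB: "A \<in> GL n" "B \<in> GL n" "?f A = ?f B"
    have "A $$ (i, j) = B $$ (i, j)" if "i < n" "j < n" for i j
      using fun_cong[OF fun_cong[OF AB(3), of j], of i] that by (simp add: col_fun_def)
    then show "A = B" using AB(1,2)[THEN carr] by (intro eq_matI) auto
  next
    fix b assume "b \<in> ?f ` GL n"
    then obtain A where A: "A \<in> GL n" "b = ?f A" by blast
    then have "fun_space.indep_fam {..<n} b" using ind[OF carr[OF A(1)]] by simp
    moreover have "b \<in> {..<n} \<rightarrow>\<^sub>E ?V" using A(2) col_fun_in by auto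
    ultimately show "b \<in> fun_space.frames {..<n} ?V" by (simp add: fun_space.frames_def)
  next
    fix b assume b: "b \<in> fun_space.frames {..<n} ?V"
    define A where "A = mat n n (\<lambda>(i, j). b j i)"
    have A: "A \<in> carrier_mat n n" by (simp add: A_def)
    have bV: "b \<in> {..<n} \<rightarrow>\<^sub>E ?V" using b by (simp add: fun_space.frames_def)
    have eq: "?f A = b"
    proof (rule extensionalityI[where A = "{..<n}"])
      show "b \<in> extensional {..<n}" using bV by (simp add: PiE_def)
      fix j assume j: "j \<in> {..<n}"
      then have "b j \<in> ?V" using bV by auto
      then show "?f A j = b j" using j by (auto simp: col_fun_def A_def coord_space_def fun_eq_iff)
    qed simp
    have "fun_space.indep_fam {..<n} (?f A)" unfolding eq using b by (simp add: fun_space.frames_def)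
    then have "A \<in> GL n" using ind[OF A] by simp
    then show "b \<in> ?f ` GL n" using eq by blast
  qed
  then have "card (GL n :: 'a mat set) = card (fun_space.frames {..<n} ?V)" by (rule bij_betw_same_card)
  also have "\<dots> = gl_order CARD('a) (card {..<n})"
    by (rule fin_fun_space.card_frames[OF coord_space_subspace card_coord_space(1)])
       (simp_all add: card_coord_space(2))
  also have "card {..<n} = n" by simp
  finally show ?thesis .
qed

definition annihilated :: "nat \<Rightarrow> 'a :: field poly \<Rightarrow> 'a mat set" where
  "annihilated n f = {A \<in> carrier_mat n n. \<forall>v\<in>coord_space n. fun_space.poly_op (mat_op n A) f v = 0}"

lemma card_annihilated: "card (annihilated n f) = card (fun_space.ops (coord_space n) f)"
  for f :: "'a :: field poly"
proof (rule bij_betw_same_card)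
  let ?V = "coord_space n :: (nat \<Rightarrow> 'a) set"
  let ?f = "\<lambda>A :: 'a mat. restrict (mat_op n A) ?V"
  note V = coord_space_subspace[of n, where 'a = 'a]
  have cong: "fun_space.poly_op (mat_op n A) f v = fun_space.poly_op (?f A) f v" if "v \<in> ?V" for A v
    by (rule fun_space.poly_op_cong[OF lin_on_mat_op _ that]) simp
  have lin_f: "fun_space.lin_on ?V (?f A)" for A
    using lin_on_mat_op[of n A] fun_space.subspace_add[OF V] fun_space.subspace_scale[OF V]
    by (auto simp: fun_space.lin_on_def)
  show "bij_betw ?f (annihilated n f) (fun_space.ops ?V f)"
    unfolding bij_betw_def
  proof (intro conjI inj_onI equalityI subsetI)
    fix A B :: "'a mat" assume AB: "A \<in> annihilated n f" "B \<in> annihilated n f" "?f A = ?f B"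
    have "A $$ (i, j) = B $$ (i, j)" if "i < n" "j < n" for i j
      using fun_cong[OF fun_cong[OF AB(3), of "unit_fun j"], of i] that unit_fun_in[of j n, where 'a = 'a]
      by (simp add: mat_op_unit_fun col_fun_def)
    then show "A = B" using AB(1,2) by (intro eq_matI) (auto simp: annihilated_def)
  next
    fix T assume "T \<in> ?f ` annihilated n f"
    then obtain A where A: "A \<in> annihilated n f" "T = ?f A" by blast
    then show "T \<in> fun_space.ops ?V f"
      using lin_f cong by (simp add: fun_space.ops_def annihilated_def)
  next
    fix T assume T: "T \<in> fun_space.ops ?V f"
    define A where "A = mat n n (\<lambda>(i, j). T (unit_fun j) i)"
    have lin: "fun_space.lin_on ?V T" and ext: "T \<in> extensional ?V" using T by (auto simp: fun_space.ops_def)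
    have "T v = mat_op n A v" if v: "v \<in> ?V" for v
    proof (rule fun_space.lin_on_eqI[where I = "{..<n}" and b = unit_fun, OF V lin lin_on_mat_op _ _ _ v])
      fix j assume j: "j \<in> {..<n}"
      show "unit_fun j \<in> ?V" using j by (simp add: unit_fun_in)
      then have "T (unit_fun j) \<in> ?V" by (rule fun_space.lin_onD(3)[OF lin])
      then show "T (unit_fun j) = mat_op n A (unit_fun j)"
        using j by (auto simp: mat_op_unit_fun col_fun_def A_def coord_space_def fun_eq_iff)
    qed (simp add: span_unit_fun)
    then have eq: "?f A = T" using ext by (auto intro: extensionalityI)
    have "fun_space.poly_op (mat_op n A) f v = 0" if "v \<in> ?V" for v
      using cong[OF that, of A] T that unfolding eq by (simp add: fun_space.ops_def)
    then have "A \<in> annihilated n f" by (simp add: annihilated_def A_def)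
    then show "T \<in> ?f ` annihilated n f" using eq by blast
  qed
qed

section \<open>Passage to the algebraic closure\<close>

interpretation to_ac: inj_comm_ring_hom "to_ac :: 'a :: field \<Rightarrow> 'a alg_closure"
  by unfold_locales auto

interpretation to_ac_poly: map_poly_inj_comm_ring_hom "to_ac :: 'a :: field \<Rightarrow> 'a alg_closure" ..

abbreviation ac_poly :: "'a :: field poly \<Rightarrow> 'a alg_closure poly" where
  "ac_poly \<equiv> map_poly to_ac"

lemma ac_poly_monic: "lead_coeff p = 1 \<Longrightarrow> lead_coeff (ac_poly p) = 1"
  by simp

lemma mat_op_to_ac:
  assumes "A \<in> carrier_mat n n"
  shows "mat_op n (map_mat to_ac A) (\<lambda>i. to_ac (v i)) = (\<lambda>i. to_ac (mat_op n A v i))"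
  using assms by (auto simp: mat_op_def to_ac_sum fun_eq_iff intro!: sum.cong)

lemma poly_op_to_ac:
  fixes A :: "'a :: field mat"
  assumes A: "A \<in> carrier_mat n n"
  shows "fun_space.poly_op (mat_op n (map_mat to_ac A)) (ac_poly f) (\<lambda>i. to_ac (v i)) =
    (\<lambda>i. to_ac (fun_space.poly_op (mat_op n A) f v i))"
proof -
  have pow: "(mat_op n (map_mat to_ac A) ^^ k) (\<lambda>i. to_ac (v i)) = (\<lambda>i. to_ac ((mat_op n A ^^ k) v i))" for k
    by (induction k) (simp_all add: mat_op_to_ac[OF A])
  show ?thesis
    unfolding fun_space.poly_op_def pow
    by (rule ext) (simp add: sum_fun_apply fun_scale_def to_ac_sum coeff_map_poly)
qed

lemma to_ac_unit_fun: "(\<lambda>i. to_ac (unit_fun j i)) = unit_fun j"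
  by (auto simp: unit_fun_def fun_eq_iff)

text \<open>Annihilation can be tested on the unit vectors, which are already defined over the
  ground field; in the other direction vectors over the ground field embed into those over the
  closure.\<close>

lemma annihilated_ac_iff:
  fixes A :: "'a :: field mat"
  assumes A: "A \<in> carrier_mat n n"
  shows "A \<in> annihilated n f \<longleftrightarrow> map_mat to_ac A \<in> annihilated n (ac_poly f)"
proof
  let ?A = "map_mat to_ac A"
  assume L: "A \<in> annihilated n f"
  have "fun_space.poly_op (mat_op n ?A) (ac_poly f) v = 0" if v: "v \<in> coord_space n" for v
  proof (rule fun_space.lin_on_eqI[where I = "{..<n}" and b = unit_fun and V = "coord_space n"
      and T = "fun_space.poly_op (mat_op n ?A) (ac_poly f)" and T' = "\<lambda>_. 0" and v = v])
    show "fun_space.lin_on (coord_space n) (fun_space.poly_op (mat_op n ?A) (ac_poly f))"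
      by (rule fun_space.lin_on_poly_op[OF coord_space_subspace lin_on_mat_op])
    show "fun_space.lin_on (coord_space n) (\<lambda>_. 0 :: nat \<Rightarrow> 'a alg_closure)"
      using fun_space.subspace_0[OF coord_space_subspace] by (auto simp: fun_space.lin_on_def)
    fix j assume "j \<in> {..<n}"
    then have "fun_space.poly_op (mat_op n A) f (unit_fun j) = 0"
      using L unit_fun_in[of j n] by (auto simp: annihilated_def)
    then show "fun_space.poly_op (mat_op n ?A) (ac_poly f) (unit_fun j) = 0"
      using poly_op_to_ac[OF A, of f "unit_fun j"] by (simp add: to_ac_unit_fun zero_fun_def)
  qed (use v coord_space_subspace in \<open>auto simp: span_unit_fun unit_fun_in\<close>)
  then show "?A \<in> annihilated n (ac_poly f)" using A by (simp add: annihilated_def)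
next
  let ?A = "map_mat to_ac A"
  assume R: "?A \<in> annihilated n (ac_poly f)"
  have "fun_space.poly_op (mat_op n A) f v = 0" if v: "v \<in> coord_space n" for v
  proof -
    have "(\<lambda>i. to_ac (v i)) \<in> coord_space n" using v by (simp add: coord_space_def)
    then have "fun_space.poly_op (mat_op n ?A) (ac_poly f) (\<lambda>i. to_ac (v i)) = 0"
      using R by (simp add: annihilated_def)
    then show ?thesis unfolding poly_op_to_ac[OF A] by (simp add: fun_eq_iff)
  qed
  then show "A \<in> annihilated n f" using A by (simp add: annihilated_def)
qed

lemma poly_op_eigenvector:
  assumes "\<And>i. (T ^^ i) v = fun_scale (x ^ i) v"
  shows "fun_space.poly_op T f v = fun_scale (poly f x) v"
  unfolding fun_space.poly_op_def assms
  by (simp add: poly_altdef fun_space.scale_sum_left)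

lemma eigenvector_funpow:
  assumes "fun_space.lin_on V T" "v \<in> V" "T v = fun_scale x v"
  shows "(T ^^ i) v = fun_scale (x ^ i) v"
proof (induction i)
  case (Suc i)
  then show ?case using fun_space.lin_onD(2)[OF assms(1,2)] assms(3) by (simp add: mult.commute)
qed simp

lemma mat_op_mult:
  assumes "A \<in> carrier_mat n n" "B \<in> carrier_mat n n" "j < n"
  shows "mat_op n A (col_fun n B j) = col_fun n (A * B) j"
  using assms by (auto simp: mat_op_def col_fun_def fun_eq_iff scalar_prod_def lessThan_atLeast0 intro!: sum.cong)

lemma col_fun_mult_diagonal:
  assumes "P \<in> carrier_mat n n" "D \<in> carrier_mat n n" "diagonal_mat D" "j < n"
  shows "col_fun n (P * D) j = fun_scale (D $$ (j, j)) (col_fun n P j)"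
proof
  fix i
  show "col_fun n (P * D) j i = fun_scale (D $$ (j, j)) (col_fun n P j) i"
  proof (cases "i < n")
    case True
    have "(P * D) $$ (i, j) = (\<Sum>k\<in>{0..<n}. P $$ (i, k) * D $$ (k, j))"
      using assms True by (auto simp: scalar_prod_def intro!: sum.cong)
    also have "\<dots> = (\<Sum>k\<in>{0..<n}. if k = j then P $$ (i, j) * D $$ (j, j) else 0)"
      using assms by (intro sum.cong) (auto simp: diagonal_mat_def)
    also have "\<dots> = P $$ (i, j) * D $$ (j, j)" using assms by simp
    finally show ?thesis using True by (simp add: col_fun_def fun_scale_def)
  qed (simp add: col_fun_def fun_scale_def)
qed

lemma fam_span_col_fun:
  fixes P :: "'a :: field mat"
  assumes P: "P \<in> carrier_mat n n" "Q \<in> carrier_mat n n" "P * Q = 1\<^sub>m n"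
  shows "coord_space n \<subseteq> fun_space.fam_span {..<n} (col_fun n P)"
proof
  fix v :: "nat \<Rightarrow> 'a" assume v: "v \<in> coord_space n"
  have sub: "fun_space.subspace (fun_space.fam_span {..<n} (col_fun n P))" by (rule fun_space.fam_span_subspace)
  have "unit_fun j \<in> fun_space.fam_span {..<n} (col_fun n P)" if j: "j < n" for j
  proof -
    have "mat_op n P (col_fun n Q j) = col_fun n (1\<^sub>m n) j" using mat_op_mult[OF P(1,2) j] P(3) by simp
    also have "\<dots> = unit_fun j" using j by (auto simp: col_fun_def unit_fun_def fun_eq_iff)
    finally show ?thesis
      using fun_space.fam_spanI[of "col_fun n Q j" "col_fun n P" "{..<n}"] by (simp add: col_fun_sum)
  qed
  then have "fun_space.fam_span {..<n} unit_fun \<subseteq> fun_space.fam_span {..<n} (col_fun n P)"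
    using sub by (intro fun_space.fam_span_subset) auto
  then show "v \<in> fun_space.fam_span {..<n} (col_fun n P)" using v by (auto simp: span_unit_fun)
qed

lemma annihilated_diagonalizable:
  fixes A :: "'a :: field mat"
  assumes A: "A \<in> carrier_mat n n" and PDQ: "P \<in> carrier_mat n n" "D \<in> carrier_mat n n" "Q \<in> carrier_mat n n"
      "P * Q = 1\<^sub>m n" "Q * P = 1\<^sub>m n" "A = P * D * Q" and D: "diagonal_mat D"
    and f: "\<And>j. j < n \<Longrightarrow> poly f (D $$ (j, j)) = 0"
  shows "A \<in> annihilated n f"
proof -
  let ?V = "coord_space n :: (nat \<Rightarrow> 'a) set"
  have AP: "A * P = P * D"
  proof -
    have "A * P = P * D * (Q * P)" unfolding PDQ(6) using PDQ(1-3) by (simp add: assoc_mult_mat[of _ n n _ n _ n])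
    then show ?thesis using PDQ(1-3,5) by simp
  qed
  have eig: "mat_op n A (col_fun n P j) = fun_scale (D $$ (j, j)) (col_fun n P j)" if "j < n" for j
    using mat_op_mult[OF A PDQ(1) that] col_fun_mult_diagonal[OF PDQ(1,2) D that] AP by simp
  have z: "fun_space.poly_op (mat_op n A) f (col_fun n P j) = 0" if "j < n" for j
    using poly_op_eigenvector[OF eigenvector_funpow[OF lin_on_mat_op col_fun_in eig[OF that]]] f[OF that]
    by (simp add: fun_scale_def zero_fun_def)
  have "fun_space.poly_op (mat_op n A) f v = 0" if v: "v \<in> ?V" for v
  proof (rule fun_space.lin_on_eqI[where I = "{..<n}" and b = "col_fun n P" and V = ?V
      and T = "fun_space.poly_op (mat_op n A) f" and T' = "\<lambda>_. 0" and v = v])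
    show "fun_space.lin_on ?V (fun_space.poly_op (mat_op n A) f)"
      by (rule fun_space.lin_on_poly_op[OF coord_space_subspace lin_on_mat_op])
    show "fun_space.lin_on ?V (\<lambda>_. 0)"
      using fun_space.subspace_0[OF coord_space_subspace] by (auto simp: fun_space.lin_on_def)
    show "?V \<subseteq> fun_space.fam_span {..<n} (col_fun n P)" by (rule fam_span_col_fun[OF PDQ(1,3,4)])
  qed (use v z coord_space_subspace col_fun_in in auto)
  then show ?thesis using A by (simp add: annihilated_def)
qed

lemma indep_fam_independent:
  assumes "finite I" "fun_space.indep_fam I b"
  shows "inj_on b I" "\<not> fun_space.dependent (b ` I)"
proof -
  show inj: "inj_on b I"
  proof (rule inj_onI, rule ccontr)
    fix i j assume ij: "i \<in> I" "j \<in> I" "b i = b j" "i \<noteq> j"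
    let ?c = "\<lambda>k. if k = i then 1 else if k = j then -1 else 0"
    have "(\<Sum>k\<in>I. fun_scale (?c k) (b k)) = (\<Sum>k\<in>{i, j}. fun_scale (?c k) (b k))"
      using assms(1) ij by (intro sum.mono_neutral_right) auto
    also have "\<dots> = 0" using ij by simp
    finally have "(\<Sum>k\<in>I. fun_scale (?c k) (b k)) = 0" .
    from fun_space.indep_famD[OF assms(2) this ij(1)] show False by simp
  qed
  show "\<not> fun_space.dependent (b ` I)"
  proof
    assume "fun_space.dependent (b ` I)"
    then obtain u where u: "\<exists>v\<in>b ` I. u v \<noteq> 0" "(\<Sum>v\<in>b ` I. fun_scale (u v) v) = 0"
      using fun_space.dependent_finite[of "b ` I"] assms(1) by auto
    have "(\<Sum>i\<in>I. fun_scale (u (b i)) (b i)) = 0" using u(2) inj by (simp add: sum.reindex)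
    then have "u (b i) = 0" if "i \<in> I" for i
      using fun_space.indep_famD[OF assms(2), of "\<lambda>i. u (b i)"] that by blast
    then show False using u(1) by blast
  qed
qed

text \<open>The eigenvectors span the space, so a maximal independent set of them is a basis;
  comparison with the unit vectors shows that it has \<open>n\<close> elements. Used as columns they
  form the conjugating matrix \<open>P\<close>.\<close>

lemma diagonalizable_annihilated:
  fixes A :: "'a :: field mat"
  assumes A: "A \<in> annihilated n (\<Prod>x\<in>L. [:- x, 1:])" and L: "finite L"
  shows "\<exists>D. diagonal_mat D \<and> similar_mat A D"
proof -
  let ?V = "coord_space n :: (nat \<Rightarrow> 'a) set"
  let ?E = "{w \<in> ?V. \<exists>x. mat_op n A w = fun_scale x w}"
  have carr: "A \<in> carrier_mat n n" using A by (simp add: annihilated_def)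
  have span: "?V \<subseteq> fun_space.span ?E"
    using fun_space.eigenvectors_span[OF coord_space_subspace lin_on_mat_op L] A
    by (auto simp: annihilated_def)
  obtain B where B: "B \<subseteq> ?E" "\<not> fun_space.dependent B" "?E \<subseteq> fun_space.span B"
    using fun_space.maximal_independent_subset[of ?E] by blast
  have "fun_space.span ?E \<subseteq> fun_space.span B"
    using B(3) by (rule fun_space.span_minimal) (rule fun_space.subspace_span)
  then have VB: "?V \<subseteq> fun_space.span B" using span by blast
  have BV: "B \<subseteq> ?V" using B(1) by auto
  let ?U = "unit_fun ` {..<n} :: (nat \<Rightarrow> 'a) set"
  have U: "inj_on (unit_fun :: nat \<Rightarrow> nat \<Rightarrow> 'a) {..<n}" "\<not> fun_space.dependent ?U"
    using indep_fam_independent[OF finite_lessThan indep_unit_fun] by auto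
  have VU: "?V \<subseteq> fun_space.span ?U"
  proof
    fix v :: "nat \<Rightarrow> 'a" assume "v \<in> ?V"
    then have "v \<in> fun_space.fam_span {..<n} unit_fun" by (simp add: span_unit_fun)
    then obtain c where "v = (\<Sum>j<n. fun_scale (c j) (unit_fun j))"
      unfolding fun_space.fam_span_def by (elim rangeE)
    then show "v \<in> fun_space.span ?U"
      by (simp only:) (intro fun_space.span_sum fun_space.span_scale fun_space.span_base imageI)
  qed
  have UV: "?U \<subseteq> ?V" using unit_fun_in by auto
  have "finite B" "card B \<le> card ?U"
    using fun_space.independent_span_bound[of ?U B] B(2) BV VU by auto
  moreover have "card ?U \<le> card B"
    using fun_space.independent_span_bound[of B ?U] U(2) UV VB \<open>finite B\<close> by auto
  moreover have "card ?U = n" using U(1) by (simp add: card_image)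
  ultimately have "finite B" "card B = n" by auto
  then obtain b where b: "bij_betw b {..<n} B"
    using ex_bij_betw_nat_finite[of B] by (auto simp: lessThan_atLeast0)
  have bE: "b j \<in> ?E" if "j < n" for j using b B(1) that by (auto simp: bij_betw_def)
  define x where "x j = (SOME y. mat_op n A (b j) = fun_scale y (b j))" for j
  have x: "mat_op n A (b j) = fun_scale (x j) (b j)" if "j < n" for j
  proof -
    have "\<exists>y. mat_op n A (b j) = fun_scale y (b j)" using bE[OF that] by blast
    then show ?thesis unfolding x_def by (rule someI_ex)
  qed
  define P where "P = mat n n (\<lambda>(i, j). b j i)"
  define D where "D = mat n n (\<lambda>(i, j). if i = j then x j else 0)"
  have P: "P \<in> carrier_mat n n" and D: "D \<in> carrier_mat n n" by (simp_all add: P_def D_def)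
  have diag: "diagonal_mat D" by (simp add: diagonal_mat_def D_def)
  have col: "col_fun n P j = b j" if "j < n" for j
    using bE[OF that] that by (auto simp: col_fun_def P_def coord_space_def fun_eq_iff)
  have "fun_space.indep_fam {..<n} (col_fun n P)"
    unfolding fun_space.indep_fam_def
  proof (intro allI impI)
    fix c assume c: "(\<Sum>j<n. fun_scale (c j) (col_fun n P j)) = 0"
    let ?u = "\<lambda>v. c (inv_into {..<n} b v)"
    have "(\<Sum>v\<in>B. fun_scale (?u v) v) = (\<Sum>j<n. fun_scale (?u (b j)) (b j))"
      by (rule sum.reindex_bij_betw[OF b, symmetric])
    also have "\<dots> = (\<Sum>j<n. fun_scale (c j) (col_fun n P j))"
      using b col by (intro sum.cong) (auto simp: bij_betw_inv_into_left)
    finally have sum0: "(\<Sum>v\<in>B. fun_scale (?u v) v) = 0" using c by simp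
    have dep: "fun_space.dependent B" if "(\<Sum>v\<in>B. fun_scale (u v) v) = 0" "\<not> (\<forall>v\<in>B. u v = 0)" for u
      unfolding fun_space.dependent_finite[OF \<open>finite B\<close>] using that by (intro exI[of _ u]) simp
    have u0: "\<forall>v\<in>B. ?u v = 0"
    proof (rule ccontr)
      assume "\<not> (\<forall>v\<in>B. ?u v = 0)"
      with sum0 have "fun_space.dependent B" by (rule dep)
      with B(2) show False by contradiction
    qed
    show "\<forall>i\<in>{..<n}. c i = 0"
    proof
      fix i assume i: "i \<in> {..<n}"
      then have "b i \<in> B" using b by (auto simp: bij_betw_def)
      then have "?u (b i) = 0" using u0 by blast
      then show "c i = 0" using b i by (simp add: bij_betw_inv_into_left)
    qed
  qed
  then have "det P \<noteq> 0" using indep_col_fun_iff[OF P] by simp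
  from det_non_zero_imp_unit[OF P this, of "()"]
  obtain Q where Q: "Q \<in> carrier_mat n n" "P * Q = 1\<^sub>m n" "Q * P = 1\<^sub>m n"
    by (auto simp: Units_def ring_mat_def)
  have "A * P = P * D"
  proof (rule eq_matI)
    fix i j assume ij: "i < dim_row (P * D)" "j < dim_col (P * D)"
    then have j: "i < n" "j < n" using P D by auto
    have "col_fun n (A * P) j = col_fun n (P * D) j"
      using mat_op_mult[OF carr P j(2)] col_fun_mult_diagonal[OF P D diag j(2)] x[OF j(2)] col[OF j(2)] j
      by (simp add: D_def)
    from fun_cong[OF this, of i] show "(A * P) $$ (i, j) = (P * D) $$ (i, j)"
      using j by (simp add: col_fun_def)
  qed (use carr P D in auto)
  then have "P * D * Q = A * (P * Q)"
    using carr P Q by (metis assoc_mult_mat)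
  then have "A = P * D * Q" using Q(2) carr by simp
  then have "similar_mat A D" using carr P D Q by (intro similar_matI[of A D P Q n]) auto
  then show ?thesis using diag by blast
qed

text \<open>Exactly one factor \<open>p\<close> vanishes at \<open>x\<close>, the others being
  coprime to it, so a double root of the product would be one of \<open>p\<close>. But
  \<open>p\<close> divides a polynomial \<open>X^N - X\<close>, whose derivative is the constant
  -1.\<close>

lemma poly_ac_no_double_root:
  fixes S :: "'a :: finite_field poly set"
  assumes S: "finite S" "\<forall>p\<in>S. monic_irreducible p" and x: "poly (ac_poly (\<Prod>S)) x = 0"
  shows "poly (pderiv (ac_poly (\<Prod>S))) x \<noteq> 0"
proof
  assume dx: "poly (pderiv (ac_poly (\<Prod>S))) x = 0"
  have "ac_poly (\<Prod>S) = (\<Prod>p\<in>S. ac_poly p)" by (rule to_ac_poly.hom_prod)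
  then have "(\<Prod>p\<in>S. poly (ac_poly p) x) = 0" using x by (simp add: poly_prod)
  then obtain p where p: "p \<in> S" "poly (ac_poly p) x = 0" using S(1) by (auto simp: prod_zero_iff)
  define g where "g = \<Prod>(S - {p})"
  have f: "\<Prod>S = p * g" using S(1) p(1) by (simp add: g_def prod.remove)
  have mp: "monic_irreducible p" using S(2) p(1) by blast
  have irr: "irreducible p" using mp by (simp add: monic_irreducible_def)
  have "\<not> p dvd g"
    unfolding g_def using monic_irreducible_dvd_prod[of "S - {p}" p] S mp by auto
  then obtain u v where "u * p + v * g = 1" using irreducible_bezout[OF irr] by blast
  then have "ac_poly (u * p + v * g) = 1" by simp
  then have "ac_poly u * ac_poly p + ac_poly v * ac_poly g = 1"
    by (simp add: to_ac_poly.hom_add to_ac_poly.hom_mult)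
  then have "poly (ac_poly u * ac_poly p + ac_poly v * ac_poly g) x = 1" by simp
  then have gx: "poly (ac_poly g) x \<noteq> 0" using p(2) by auto
  have "ac_poly (\<Prod>S) = ac_poly p * ac_poly g" unfolding f by (rule to_ac_poly.hom_mult)
  then have px: "poly (pderiv (ac_poly p)) x = 0"
    using dx p(2) gx by (simp add: pderiv_mult)
  obtain k where k: "k > 0" "p dvd [:0, 1:] ^ (CHAR('a) ^ k) - [:0, 1:]"
    using irreducible_dvd_frobenius_minus_id[OF irr] by blast
  define N where "N = CHAR('a) ^ k"
  have "CHAR('a) dvd N" using k(1) by (simp add: N_def)
  then have "of_nat N = (0 :: 'a)" by (simp add: of_nat_eq_0_iff_char_dvd)
  then have N0: "of_nat N = (0 :: 'a alg_closure)" using to_ac_of_nat[of N, where 'a = 'a] by simp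
  obtain h where "[:0, 1:] ^ N - [:0, 1:] = p * h" using k(2) unfolding N_def by (rule dvdE)
  then have "ac_poly ([:0, 1:] ^ N - [:0, 1:]) = ac_poly p * ac_poly h"
    by (simp only: to_ac_poly.hom_mult)
  then have eq: "[:0, 1:] ^ N - [:0, 1:] = ac_poly p * ac_poly h"
    by (simp add: to_ac_poly.hom_minus to_ac_poly.hom_power)
  have "poly (pderiv ([:0, 1:] ^ N - [:0, 1:] :: 'a alg_closure poly)) x = - 1"
    by (simp add: pderiv_diff pderiv_power N0 pderiv_pCons)
  moreover have "poly (pderiv (ac_poly p * ac_poly h)) x = 0"
    using p(2) px by (simp add: pderiv_mult)
  ultimately show False unfolding eq by simp
qed

text \<open>Over the closure the polynomial is a product over a multiset of roots. Without double
  roots all multiplicities are 1, so the multiset is a set, as \<open>eigenvectors_span\<close>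
  requires.\<close>

lemma ac_poly_split:
  fixes S :: "'a :: finite_field poly set"
  assumes S: "finite S" "\<forall>p\<in>S. monic_irreducible p"
  shows "\<exists>L. finite L \<and> ac_poly (\<Prod>S) = (\<Prod>x\<in>L. [:- x, 1:])"
proof -
  let ?f = "ac_poly (\<Prod>S)"
  have "lead_coeff (\<Prod>S) = 1"
    using S(2) by (simp add: lead_coeff_prod monic_irreducible_def)
  then have lf: "lead_coeff ?f = 1" by (rule ac_poly_monic)
  then have "?f \<noteq> 0" by auto
  then obtain M where "?f = smult (lead_coeff ?f) (\<Prod>x\<in>#M. [:- x, 1:])"
    using alg_closed_imp_factorization by blast
  then have M: "?f = (\<Prod>x\<in>#M. [:- x, 1:])" by (simp only: lf smult_1_left)
  have le1: "count M x \<le> 1" for x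
  proof (rule ccontr)
    assume "\<not> count M x \<le> 1"
    then have "count M x \<ge> 2" by simp
    then have "replicate_mset 2 x \<subseteq># M" by (simp add: count_le_replicate_mset_subset_eq)
    then obtain M' where M': "M = replicate_mset 2 x + M'" using subset_mset.le_iff_add by blast
    have e: "?f = [:- x, 1:] * ([:- x, 1:] * (\<Prod>x\<in>#M'. [:- x, 1:]))"
      unfolding M M' by (simp add: numeral_2_eq_2)
    have "poly ?f x = 0" unfolding e poly_mult by simp
    moreover have "poly (pderiv ?f) x = 0" unfolding e pderiv_mult poly_add poly_mult by simp
    ultimately show False using poly_ac_no_double_root[OF S] by blast
  qed
  have "M = mset_set (set_mset M)"
  proof (rule multiset_eqI)
    fix x
    show "count M x = count (mset_set (set_mset M)) x"
    proof (cases "x \<in># M")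
      case True
      then have "count M x \<ge> 1" by simp
      with le1[of x] have "count M x = 1" by linarith
      then show ?thesis using True by (simp add: count_mset_set)
    next
      case False
      then show ?thesis by (simp add: not_in_iff count_mset_set)
    qed
  qed
  then have "?f = (\<Prod>x\<in>set_mset M. [:- x, 1:])"
    unfolding M by (subst prod_unfold_prod_mset) simp
  then show ?thesis using finite_set_mset by blast
qed

text \<open>Applied to a characteristic polynomial of degree \<open>n\<close>, it confines the
  minimal polynomials of the eigenvalues to degree at most \<open>n\<close>, so finitely many
  irreducibles suffice for all matrices of that size.\<close>

lemma algebraic_root_irreducible:
  fixes f :: "'a :: field poly"
  assumes "f \<noteq> 0" "poly (ac_poly f) x = 0"
  shows "\<exists>p. monic_irreducible p \<and> degree p \<le> degree f \<and> poly (ac_poly p) x = 0"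
  using assms
proof (induction "degree f" arbitrary: f rule: less_induct)
  case less
  have "degree f > 0"
  proof (rule ccontr)
    assume "\<not> degree f > 0"
    then obtain c where "f = [:c:]" by (metis degree_eq_zeroE gr0I)
    then show False using less.prems by simp
  qed
  then obtain r where r: "monic_irreducible r" "r dvd f" "degree r \<le> degree f"
    using exists_monic_irreducible_factor by blast
  then obtain h where h: "f = r * h" by (elim dvdE)
  have nz: "r \<noteq> 0" "h \<noteq> 0" using h less.prems(1) by auto
  have dr: "degree r > 0" using r(1) irreducible_degree_pos by (auto simp: monic_irreducible_def)
  have df: "degree f = degree r + degree h" unfolding h using nz by (rule degree_mult_eq)
  have "poly (ac_poly r) x * poly (ac_poly h) x = 0"
    using less.prems(2) unfolding h by (simp add: to_ac_poly.hom_mult)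
  then consider "poly (ac_poly r) x = 0" | "poly (ac_poly h) x = 0" by auto
  then show ?case
  proof cases
    case 2
    then obtain p where "monic_irreducible p" "degree p \<le> degree h" "poly (ac_poly p) x = 0"
      using less.hyps[of h] df dr nz by auto
    then show ?thesis using df by (intro exI[of _ p]) simp
  qed (use r in blast)
qed

text \<open>A single annihilator for all invertible semisimple matrices of size at most
  \<open>d\<close>: omitting \<open>X\<close> encodes invertibility, and taking each irreducible
  once encodes semisimplicity.\<close>

definition semisimple_poly :: "nat \<Rightarrow> 'a :: finite_field poly" where
  "semisimple_poly d = \<Prod>(irreducibles_upto d - {[:0, 1:]})"

lemma semisimple_poly_factors:
  "finite (irreducibles_upto d - {[:0, 1:]} :: 'a :: finite_field poly set)"
  "\<forall>p\<in>irreducibles_upto d - {[:0, 1 :: 'a:]}. monic_irreducible p"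
  using finite_irreducibles_upto by (auto simp: irreducibles_upto_def)

text \<open>Each diagonal entry is a root of the characteristic polynomial, hence of a monic
  irreducible polynomial of degree at most \<open>n\<close>; the product of the entries is the
  determinant, so none is zero and that polynomial is not \<open>X\<close>.\<close>

lemma semisimple_imp_annihilated:
  fixes A :: "'a :: finite_field mat"
  assumes A: "A \<in> GL n" "semisimple_mat A" and d: "n \<le> d"
  shows "A \<in> annihilated n (semisimple_poly d)"
proof -
  let ?A = "map_mat to_ac A"
  have carr: "A \<in> carrier_mat n n" and inv: "invertible_mat A" using A(1) by (auto simp: GL_def)
  obtain D where D: "diagonal_mat D" "similar_mat ?A D"
    using A(2) by (auto simp: semisimple_mat_def diagonalizable_mat_def)
  obtain m P Q where *: "{?A, D, P, Q} \<subseteq> carrier_mat m m" "P * Q = 1\<^sub>m m" "Q * P = 1\<^sub>m m" "?A = P * D * Q"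
    using similar_matD[OF D(2)] by blast
  then have "dim_row ?A = m" by auto
  then have "m = n" using carr by auto
  note PDQ = *[unfolded \<open>m = n\<close>]
  have Dc: "D \<in> carrier_mat n n" using PDQ(1) by simp
  have ut: "upper_triangular D" using D(1) Dc by (auto simp: diagonal_mat_def upper_triangular_def)
  have "char_poly ?A = (\<Prod>a\<leftarrow>diag_mat D. [:- a, 1:])"
    using char_poly_similar[OF D(2)] char_poly_upper_triangular[OF Dc ut] by simp
  then have cp: "ac_poly (char_poly A) = (\<Prod>a\<leftarrow>diag_mat D. [:- a, 1:])"
    using to_ac.char_poly_hom[OF carr] by simp
  have "det A \<noteq> 0" using inv invertible_mat_iff_det[OF carr] by simp
  moreover have "prod_list (diag_mat D) = to_ac (det A)"
    using det_similar[OF D(2)] det_upper_triangular[OF ut Dc] by simp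
  ultimately have "prod_list (diag_mat D) \<noteq> 0" by simp
  then have nz: "0 \<notin> set (diag_mat D)" using prod_list_zero_iff by blast
  have "poly (ac_poly (semisimple_poly d)) (D $$ (j, j)) = 0" if j: "j < n" for j
  proof -
    let ?x = "D $$ (j, j)"
    have mem: "?x \<in> set (diag_mat D)" using j Dc by (auto simp: diag_mat_def)
    have "poly (ac_poly (char_poly A)) ?x = 0"
      unfolding cp poly_prod_list prod_list_zero_iff using mem by (auto simp: image_iff intro!: bexI[of _ ?x])
    moreover have "char_poly A \<noteq> 0" "degree (char_poly A) = n" using degree_monic_char_poly[OF carr] by auto
    ultimately obtain p where p: "monic_irreducible p" "degree p \<le> n" "poly (ac_poly p) ?x = 0"
      using algebraic_root_irreducible by metis
    have "p \<noteq> [:0, 1:]" using p(3) mem nz by auto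
    then have "p \<in> irreducibles_upto d - {[:0, 1:]}" using p d by (auto simp: irreducibles_upto_def)
    then have "p dvd semisimple_poly d"
      unfolding semisimple_poly_def using semisimple_poly_factors(1) by (intro dvd_prodI) auto
    then obtain h where "semisimple_poly d = p * h" by (rule dvdE)
    then show ?thesis using p(3) by (simp add: to_ac_poly.hom_mult)
  qed
  then have "?A \<in> annihilated n (ac_poly (semisimple_poly d))"
    using PDQ D(1) by (intro annihilated_diagonalizable[of ?A n P D Q]) auto
  then show ?thesis using annihilated_ac_iff[OF carr] by blast
qed

text \<open>The annihilator is coprime to \<open>X\<close>, so a vector in the kernel of
  \<open>A\<close> is zero by the Bezout relation. It has distinct roots over the closure, so the
  eigenvectors span there.\<close>

lemma annihilated_imp_semisimple:
  fixes A :: "'a :: finite_field mat"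
  assumes A: "A \<in> annihilated n (semisimple_poly d)"
  shows "A \<in> GL n" "semisimple_mat A"
proof -
  let ?f = "semisimple_poly d :: 'a poly" and ?X = "[:0, 1 :: 'a:]"
  have carr: "A \<in> carrier_mat n n" using A by (simp add: annihilated_def)
  have mX: "monic_irreducible ?X" by (rule fin_fun_space.monic_irreducible_X)
  have "\<not> ?X dvd ?f"
    unfolding semisimple_poly_def using monic_irreducible_dvd_prod[OF semisimple_poly_factors mX] by blast
  then obtain u w where uw: "u * ?X + w * ?f = 1"
    using irreducible_bezout[of ?X] mX unfolding monic_irreducible_def by blast
  have "fun_space.indep_fam {..<n} (col_fun n A)"
    unfolding fun_space.indep_fam_def
  proof (intro allI impI ballI)
    fix c i assume c: "(\<Sum>j<n. fun_scale (c j) (col_fun n A j)) = 0" and i: "i \<in> {..<n}"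
    define v where "v = (\<lambda>i. if i < n then c i else 0)"
    have v: "v \<in> coord_space n" by (simp add: v_def coord_space_def)
    have "mat_op n A v = mat_op n A c"
      unfolding mat_op_def v_def by (intro ext if_cong refl sum.cong) simp
    then have Tv: "mat_op n A v = 0" using c by (simp add: col_fun_sum)
    have "fun_space.poly_op (mat_op n A) ?X v = 0"
      by (simp add: fun_space.poly_op_pCons Tv)
    then have "fun_space.poly_op (mat_op n A) (u * ?X) v = 0"
      by (rule fun_space.poly_op_dvd[OF coord_space_subspace lin_on_mat_op v dvd_triv_right])
    moreover have "fun_space.poly_op (mat_op n A) ?f v = 0" using A v by (simp add: annihilated_def)
    then have "fun_space.poly_op (mat_op n A) (w * ?f) v = 0"
      by (rule fun_space.poly_op_dvd[OF coord_space_subspace lin_on_mat_op v dvd_triv_right])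
    ultimately have "fun_space.poly_op (mat_op n A) (u * ?X + w * ?f) v = 0"
      unfolding fun_space.poly_op_add by simp
    then have "v = 0" unfolding uw by simp
    then have "v i = 0" by simp
    then show "c i = 0" using i by (simp add: v_def)
  qed
  then show "A \<in> GL n"
    using indep_col_fun_iff[OF carr] invertible_mat_iff_det[OF carr] carr by (simp add: GL_def)
  obtain L where L: "finite L" "ac_poly ?f = (\<Prod>x\<in>L. [:- x, 1:])"
    using ac_poly_split[OF semisimple_poly_factors] unfolding semisimple_poly_def by blast
  have "map_mat to_ac A \<in> annihilated n (ac_poly ?f)" using A annihilated_ac_iff[OF carr] by blast
  then show "semisimple_mat A"
    unfolding L(2) semisimple_mat_def diagonalizable_mat_def by (rule diagonalizable_annihilated[OF _ L(1)])
qed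

theorem prob_semisimple_eq_coeff:
  assumes "n \<le> d"
  shows "prob_semisimple TYPE('a :: finite_field) n =
    (\<Prod>p\<in>irreducibles_upto d - {[:0, 1 :: 'a:]}. gl_fps CARD('a) (degree p)) $ n"
proof -
  let ?V = "coord_space n :: (nat \<Rightarrow> 'a) set" and ?f = "semisimple_poly d :: 'a poly"
  have set_eq: "GL n \<inter> {A. semisimple_mat A} = annihilated n ?f"
    using semisimple_imp_annihilated[OF _ _ assms] annihilated_imp_semisimple by blast
  have "prob_semisimple TYPE('a) n = card (GL n \<inter> {A :: 'a mat. semisimple_mat A}) / card (GL n :: 'a mat set)"
    unfolding prob_semisimple_def by (rule measure_pmf_of_set[OF GL_nonempty finite_GL])
  also have "\<dots> = real (card (fun_space.ops ?V ?f)) / real (gl_order CARD('a) n)"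
    unfolding set_eq card_annihilated card_GL ..
  also have "real (card (fun_space.ops ?V ?f)) = real (gl_order CARD('a) n) *
      (\<Prod>p\<in>irreducibles_upto d - {[:0, 1 :: 'a:]}. gl_fps CARD('a) (degree p)) $ n"
    unfolding semisimple_poly_def
    by (rule fin_fun_space.card_ops_prod[OF semisimple_poly_factors coord_space_subspace card_coord_space])
  also have "real (gl_order CARD('a) n) > 0"
    using gl_order_pos[OF fin_fun_space.q_gt_1[where 'a = 'a], of n] by simp
  then have "real (gl_order CARD('a) n) *
      (\<Prod>p\<in>irreducibles_upto d - {[:0, 1 :: 'a:]}. gl_fps CARD('a) (degree p)) $ n / real (gl_order CARD('a) n)
      = (\<Prod>p\<in>irreducibles_upto d - {[:0, 1 :: 'a:]}. gl_fps CARD('a) (degree p)) $ n" by simp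
  finally show ?thesis .
qed

section \<open>The limit\<close>

text \<open>Evaluation at \<open>u = 1\<close>. Absolute convergence is included so that the notion
  is stable under products of power series.\<close>

definition abs_sums :: "real fps \<Rightarrow> real \<Rightarrow> bool" where
  "abs_sums f v \<longleftrightarrow> summable (\<lambda>n. \<bar>f $ n\<bar>) \<and> (\<lambda>n. f $ n) sums v"

lemma abs_sums_mult:
  assumes "abs_sums f v" "abs_sums g w"
  shows "abs_sums (f * g) (v * w)"
proof -
  have f: "summable (\<lambda>n. norm (f $ n))" "(\<lambda>n. f $ n) sums v"
    and g: "summable (\<lambda>n. norm (g $ n))" "(\<lambda>n. g $ n) sums w" using assms by (simp_all add: abs_sums_def)
  have "(\<lambda>n. \<Sum>i\<le>n. f $ i * g $ (n - i)) sums (suminf (\<lambda>n. f $ n) * suminf (\<lambda>n. g $ n))"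
    by (rule Cauchy_product_sums[OF f(1) g(1)])
  then have "(\<lambda>n. (f * g) $ n) sums (v * w)"
    using f(2) g(2) by (simp add: sums_iff fps_mult_nth atLeast0AtMost)
  moreover have "summable (\<lambda>n. \<bar>(f * g) $ n\<bar>)"
  proof (rule summable_comparison_test')
    show "summable (\<lambda>n. \<Sum>i\<le>n. \<bar>f $ i\<bar> * \<bar>g $ (n - i)\<bar>)"
      using Cauchy_product_sums[of "\<lambda>n. \<bar>f $ n\<bar>" "\<lambda>n. \<bar>g $ n\<bar>"] f(1) g(1) by (simp add: sums_iff)
    show "norm \<bar>(f * g) $ n\<bar> \<le> (\<Sum>i\<le>n. \<bar>f $ i\<bar> * \<bar>g $ (n - i)\<bar>)" for n
      unfolding fps_mult_nth atLeast0AtMost real_norm_def abs_idempotent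
      by (rule order_trans[OF sum_abs]) (simp add: abs_mult)
  qed
  ultimately show ?thesis by (simp add: abs_sums_def)
qed

lemma abs_sums_finite:
  assumes "finite A" "\<And>n. n \<notin> A \<Longrightarrow> f $ n = 0"
  shows "abs_sums f (\<Sum>n\<in>A. f $ n)"
  unfolding abs_sums_def using assms by (auto intro: summable_finite sums_finite)

lemma abs_sums_1: "abs_sums 1 1"
  using abs_sums_finite[of "{0}" 1] by simp

lemma abs_sums_linear:
  assumes "d > 0" shows "abs_sums (1 - fps_const c * fps_X ^ d) (1 - c)"
proof -
  have nth: "(1 - fps_const c * fps_X ^ d) $ n = (if n = 0 then 1 else if n = d then - c else 0)" for n
    using assms by (simp add: fps_X_power_nth)
  show ?thesis
    using abs_sums_finite[of "{0, d}" "1 - fps_const c * fps_X ^ d"] assms by (simp add: nth)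
qed

lemma abs_sums_prod:
  assumes "\<And>p. p \<in> S \<Longrightarrow> abs_sums (f p) (v p)"
  shows "abs_sums (\<Prod>p\<in>S. f p) (\<Prod>p\<in>S. v p)"
  using assms by (induction S rule: infinite_finite_induct) (auto simp: abs_sums_1 abs_sums_mult)

lemma abs_sums_unique: "abs_sums f v \<Longrightarrow> abs_sums f w \<Longrightarrow> v = w"
  by (auto simp: abs_sums_def dest: sums_unique2)

lemma abs_sums_multiples:
  fixes e :: "nat \<Rightarrow> real"
  assumes d: "d > 0" and e: "summable (\<lambda>m. \<bar>e m\<bar>)" "e sums v"
  shows "abs_sums (Abs_fps (\<lambda>n. if d dvd n then e (n div d) else 0)) v"
proof -
  let ?f = "\<lambda>n. if d dvd n then e (n div d) else 0"
  have mono: "strict_mono (\<lambda>m. d * m)" using d by (simp add: strict_mono_def)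
  have 1: "?f n = 0" "\<bar>?f n\<bar> = 0" if "n \<notin> range (\<lambda>m. d * m)" for n
    using that by (auto simp: dvd_def)
  have "(\<lambda>m. ?f (d * m)) sums v" using e(2) d by simp
  then have "?f sums v" by (subst (asm) sums_mono_reindex[OF mono]) (use 1 in auto)
  moreover have "summable (\<lambda>m. \<bar>?f (d * m)\<bar>)" using e(1) d by simp
  then have "summable (\<lambda>n. \<bar>?f n\<bar>)" by (subst (asm) summable_mono_reindex[OF mono]) (use 1 in auto)
  ultimately show ?thesis by (simp add: abs_sums_def)
qed

text \<open>Taking \<open>Q ^ m\<close> out of each of the \<open>m\<close> factors of
  \<open>gl_order\<close> leaves the q-Pochhammer product in \<open>1 / Q\<close>; this is where the
  terms of the Rogers-Ramanujan sum come from.\<close>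

lemma inverse_gl_order:
  assumes "Q > 1"
  shows "1 / real (gl_order Q m) = (1 / real Q) ^ m\<^sup>2 / qfac (1 / real Q) m"
proof -
  let ?x = "1 / real Q"
  have "real (gl_order Q m) = (\<Prod>i<m. real Q ^ m - real Q ^ i)"
    unfolding gl_order_def of_nat_prod using assms by (intro prod.cong) (auto simp: of_nat_diff)
  also have "\<dots> = (\<Prod>i<m. real Q ^ m * (1 - ?x ^ (m - i)))"
  proof (intro prod.cong refl)
    fix i assume "i \<in> {..<m}"
    then have "real Q ^ m = real Q ^ i * real Q ^ (m - i)" by (simp flip: power_add)
    then have "real Q ^ m * ?x ^ (m - i) = real Q ^ i" using assms by (simp add: power_one_over)
    then show "real Q ^ m - real Q ^ i = real Q ^ m * (1 - ?x ^ (m - i))" by (simp add: right_diff_distrib)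
  qed
  also have "\<dots> = real Q ^ m\<^sup>2 * (\<Prod>i<m. 1 - ?x ^ (m - i))"
    by (simp add: prod.distrib power2_eq_square power_mult)
  also have "(\<Prod>i<m. 1 - ?x ^ (m - i)) = (\<Prod>i<m. 1 - ?x ^ Suc i)"
    by (rule prod.reindex_bij_witness[of _ "\<lambda>i. m - Suc i" "\<lambda>i. m - Suc i"]) (auto simp: Suc_diff_Suc)
  also have "\<dots> = qfac ?x m" by (simp add: qfac_def)
  finally show ?thesis using assms by (simp add: power_one_over field_simps)
qed

definition local_factor :: "nat \<Rightarrow> nat \<Rightarrow> real fps" where
  "local_factor q d = (1 - fps_const (1 / real q ^ d) * fps_X ^ d) * gl_fps q d"

text \<open>With \<open>x = 1 / q ^ d\<close>, the coefficient of \<open>u ^ (d * m)\<close> in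
  \<open>local_factor q d\<close>: the subtracted term comes from the weight
  \<open>1 - x * u ^ d\<close>, and the constant coefficient has no predecessor.\<close>

definition rr_coeff :: "real \<Rightarrow> nat \<Rightarrow> real" where
  "rr_coeff x m = x ^ m\<^sup>2 / qfac x m - (if m = 0 then 0 else x * (x ^ (m - 1)\<^sup>2 / qfac x (m - 1)))"

lemma gl_fps_eq:
  assumes "q > 1" "d > 0"
  shows "gl_fps q d = Abs_fps (\<lambda>n. if d dvd n then (1 / real q ^ d) ^ (n div d)\<^sup>2 / qfac (1 / real q ^ d) (n div d) else 0)"
proof -
  have "q ^ d > 1" using assms by (intro one_less_power) auto
  then show ?thesis using inverse_gl_order[of "q ^ d"] unfolding gl_fps_def by (intro fps_ext) simp
qed

lemma local_factor_eq:
  assumes "q > 1" "d > 0"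
  shows "local_factor q d = Abs_fps (\<lambda>n. if d dvd n then rr_coeff (1 / real q ^ d) (n div d) else 0)"
proof (rule fps_ext)
  fix n
  let ?x = "1 / real q ^ d"
  have "local_factor q d $ n = gl_fps q d $ n - ?x * (fps_X ^ d * gl_fps q d) $ n"
    by (simp add: local_factor_def left_diff_distrib mult.assoc)
  also have "(fps_X ^ d * gl_fps q d) $ n = (if n < d then 0 else gl_fps q d $ (n - d))"
    by (rule fps_X_power_mult_nth)
  also have "gl_fps q d $ n - ?x * (if n < d then 0 else gl_fps q d $ (n - d)) =
      (if d dvd n then rr_coeff ?x (n div d) else 0)"
  proof (cases "d dvd n")
    case True
    then obtain m where n: "n = d * m" by (rule dvdE)
    show ?thesis
    proof (cases m)
      case 0
      then show ?thesis using assms n by (simp add: gl_fps_eq rr_coeff_def)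
    next
      case (Suc k)
      have "n - d = d * k" "\<not> n < d" using n Suc by auto
      then show ?thesis using assms n Suc by (simp add: gl_fps_eq rr_coeff_def)
    qed
  next
    case False
    then have "\<not> d dvd (n - d)" if "\<not> n < d" using that by (simp add: dvd_minus_self)
    then show ?thesis using False assms by (simp add: gl_fps_eq)
  qed
  finally show "local_factor q d $ n = Abs_fps (\<lambda>n. if d dvd n then rr_coeff ?x (n div d) else 0) $ n"
    by simp
qed

text \<open>A positive lower bound for all products \<open>qfac x n\<close> with \<open>x\<close> at
  most 1/2. As \<open>q\<close> is at least 2, this covers every \<open>x = 1 / q ^ d\<close> with
  positive \<open>d\<close>, so the estimates become uniform in \<open>d\<close>.\<close>

definition half_qfac_inf :: real where
  "half_qfac_inf = (SOME L. L > 0 \<and> (\<forall>n. L \<le> qfac (1 / 2) n))"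

lemma half_qfac_inf: "half_qfac_inf > 0" "half_qfac_inf \<le> qfac (1 / 2) n"
proof -
  have "\<exists>L. L > 0 \<and> (\<forall>n. L \<le> qfac (1 / 2) n)" using qfac_LIMSEQ[of "1 / 2"] by auto
  then have "half_qfac_inf > 0 \<and> (\<forall>n. half_qfac_inf \<le> qfac (1 / 2) n)"
    unfolding half_qfac_inf_def by (rule someI_ex)
  then show "half_qfac_inf > 0" "half_qfac_inf \<le> qfac (1 / 2) n" by auto
qed

lemma half_qfac_inf_le:
  assumes "0 < x" "x \<le> 1 / 2"
  shows "half_qfac_inf \<le> qfac x n"
proof -
  have "qfac (1 / 2) n \<le> qfac x n"
    unfolding qfac_def
  proof (rule prod_mono)
    fix i assume "i \<in> {..<n}"
    have "x ^ Suc i \<le> (1 / 2) ^ Suc i" using assms by (intro power_mono) auto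
    moreover have "(1 / 2 :: real) ^ Suc i \<le> 1" by (intro power_le_one) auto
    ultimately show "0 \<le> 1 - (1 / 2 :: real) ^ Suc i \<and> 1 - (1 / 2) ^ Suc i \<le> 1 - x ^ Suc i" by linarith
  qed
  then show ?thesis using half_qfac_inf(2)[of n] by linarith
qed

text \<open>The summand 2 bounds \<open>1 / (1 - x)\<close> in the coefficient with
  \<open>m = 1\<close>; the other summand bounds the two terms of each coefficient with
  \<open>m\<close> at least 2.\<close>

definition tail_const :: real where "tail_const = 2 + 2 / half_qfac_inf"

text \<open>Cancelling the pole at 1 leaves a first coefficient of order \<open>x\<^sup>2\<close>; as there are at most \<open>q\<^sup>d\<close>
  irreducible polynomials of degree \<open>d\<close>, this makes the product over all of them converge.\<close>

lemma rr_coeff_bound: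
  assumes x: "0 < x" "x \<le> 1 / 2"
  shows "\<bar>rr_coeff x m\<bar> \<le> (if m = 0 then 1 else if m = 1 then tail_const * x\<^sup>2 else tail_const * x ^ m)"
proof -
  define L where "L = half_qfac_inf"
  have L: "L > 0" "\<And>n. L \<le> qfac x n" using half_qfac_inf(1) half_qfac_inf_le[OF x] by (simp_all add: L_def)
  have quot: "0 \<le> x ^ k / qfac x n" "x ^ k / qfac x n \<le> x ^ k / L" for k n
    using x L(1) L(2)[of n] by (auto intro!: divide_left_mono divide_nonneg_pos mult_pos_pos)
  consider "m = 0" | "m = 1" | "m \<ge> 2" by linarith
  then show ?thesis
  proof cases
    case 1
    then show ?thesis by (simp add: rr_coeff_def)
  next
    case 2
    \<comment> \<open>The cancellation: \<open>x / (1 - x) - x\<close> is of second order.\<close>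
    have "rr_coeff x m = x\<^sup>2 / (1 - x)"
      using x 2 by (simp add: rr_coeff_def qfac_Suc field_simps power2_eq_square)
    also have "\<dots> \<le> 2 * x\<^sup>2"
    proof -
      have "x\<^sup>2 * 1 \<le> x\<^sup>2 * (2 * (1 - x))" using x by (intro mult_left_mono) auto
      then show ?thesis using x by (simp add: divide_le_eq algebra_simps)
    qed
    also have "\<dots> \<le> tail_const * x\<^sup>2"
      using half_qfac_inf(1) by (intro mult_right_mono) (auto simp: tail_const_def)
    finally have "rr_coeff x m \<le> tail_const * x\<^sup>2" .
    moreover have "rr_coeff x m \<ge> 0" using \<open>rr_coeff x m = _\<close> x by simp
    ultimately show ?thesis using 2 by simp
  next
    case 3
    have "\<bar>rr_coeff x m\<bar> \<le> x ^ m\<^sup>2 / qfac x m + x * (x ^ (m - 1)\<^sup>2 / qfac x (m - 1))"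
    proof -
      have tri: "\<bar>a - b\<bar> \<le> a + b" if "0 \<le> a" "0 \<le> b" for a b :: real using that by linarith
      have "rr_coeff x m = x ^ m\<^sup>2 / qfac x m - x * (x ^ (m - 1)\<^sup>2 / qfac x (m - 1))"
        using 3 by (simp add: rr_coeff_def)
      then show ?thesis
        using tri[OF quot(1) mult_nonneg_nonneg[OF less_imp_le[OF x(1)] quot(1)]] by (simp only:)
    qed
    also have "\<dots> \<le> x ^ m\<^sup>2 / L + x * (x ^ (m - 1)\<^sup>2 / L)"
      using quot(2) x by (intro add_mono mult_left_mono) auto
    also have "\<dots> = (x ^ m\<^sup>2 + x ^ Suc ((m - 1)\<^sup>2)) / L" by (simp add: add_divide_distrib)
    also have "\<dots> \<le> (x ^ m + x ^ m) / L"
    proof -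
      obtain k where k: "m = Suc k" using 3 by (cases m) auto
      \<comment> \<open>With \<open>m = Suc k\<close> the exponent \<open>k\<^sup>2 + 1\<close> is
        at least \<open>Suc k\<close>, so the extra factor \<open>x\<close> from the weight is just
        enough.\<close>
      have "x ^ m\<^sup>2 \<le> x ^ m" "x ^ Suc ((m - 1)\<^sup>2) \<le> x ^ m"
        using x by (auto intro!: power_decreasing simp: k power2_eq_square simp del: power_Suc)
      then show ?thesis using L(1) by (intro divide_right_mono add_mono) auto
    qed
    also have "\<dots> = (2 / L) * x ^ m" by simp
    also have "\<dots> \<le> tail_const * x ^ m"
      using x by (intro mult_right_mono) (auto simp: tail_const_def L_def)
    finally show ?thesis using 3 by simp
  qed
qed

lemma tail_const_pos: "tail_const > 0"
  using half_qfac_inf(1) by (simp add: tail_const_def add_pos_pos)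

text \<open>The index 1 contributes one multiple of \<open>tail_const * x\<^sup>2\<close>; from
  index 2 on the bounds are geometric with sum at most two further multiples, because
  \<open>1 / (1 - x)\<close> is at most 2.\<close>

lemma rr_coeff_abs_summable:
  assumes x: "0 < x" "x \<le> 1 / 2"
  shows "summable (\<lambda>m. \<bar>rr_coeff x m\<bar>)" "(\<Sum>m. \<bar>rr_coeff x m\<bar>) \<le> 1 + 3 * tail_const * x\<^sup>2"
proof -
  let ?u = "\<lambda>m. if m = 0 then 1 else if m = 1 then tail_const * x\<^sup>2 else tail_const * x ^ m"
  have "(\<lambda>m. tail_const * x\<^sup>2 * x ^ m) sums (tail_const * x\<^sup>2 * (1 / (1 - x)))"
    using x by (intro sums_mult geometric_sums) auto
  then have "(\<lambda>m. ?u (m + 2)) sums (tail_const * x\<^sup>2 * (1 / (1 - x)))"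
    by (simp add: power2_eq_square mult_ac)
  then have "?u sums (tail_const * x\<^sup>2 * (1 / (1 - x)) + (\<Sum>i<2. ?u i))"
    by (subst (asm) sums_iff_shift) 
  then have su: "?u sums (tail_const * x\<^sup>2 * (1 / (1 - x)) + (1 + tail_const * x\<^sup>2))"
    by (simp add: numeral_2_eq_2)
  show sm: "summable (\<lambda>m. \<bar>rr_coeff x m\<bar>)"
    by (rule summable_comparison_test'[of ?u 0]) (use su rr_coeff_bound[OF x] in \<open>auto simp: sums_iff\<close>)
  have "(\<Sum>m. \<bar>rr_coeff x m\<bar>) \<le> suminf ?u"
    by (rule suminf_le[OF rr_coeff_bound[OF x] sm]) (use su in \<open>simp add: sums_iff\<close>)
  also have "suminf ?u = tail_const * x\<^sup>2 * (1 / (1 - x)) + (1 + tail_const * x\<^sup>2)"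
    using su by (simp add: sums_iff)
  also have "\<dots> \<le> tail_const * x\<^sup>2 * 2 + (1 + tail_const * x\<^sup>2)"
    using x tail_const_pos by (intro add_right_mono mult_left_mono) (auto simp: divide_le_eq)
  finally show "(\<Sum>m. \<bar>rr_coeff x m\<bar>) \<le> 1 + 3 * tail_const * x\<^sup>2" by (simp add: algebra_simps)
qed

text \<open>The value of \<open>local_factor q d\<close> at \<open>u = 1\<close> for
  \<open>x = 1 / q ^ d\<close>: the weight times the Rogers-Ramanujan sum.\<close>

definition rr_value :: "real \<Rightarrow> real" where
  "rr_value x = (1 - x) * (\<Sum>m. x ^ m\<^sup>2 / qfac x m)"

lemma inverse_power_le_half:
  assumes "q > (1 :: nat)" "d > 0"
  shows "0 < 1 / real q ^ d" "1 / real q ^ d \<le> 1 / 2"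
proof -
  have "q ^ 1 \<le> q ^ d" using assms by (intro power_increasing) auto
  then have "2 \<le> q ^ d" using assms(1) by simp
  then have "real 2 \<le> real (q ^ d)" by (rule of_nat_mono)
  then show "0 < 1 / real q ^ d" "1 / real q ^ d \<le> 1 / 2" using assms by (auto simp: field_simps)
qed

lemma abs_sums_local_factor:
  assumes "q > 1" "d > 0"
  shows "abs_sums (local_factor q d) (rr_value (1 / real q ^ d))"
  unfolding local_factor_def rr_value_def
proof (rule abs_sums_mult)
  let ?x = "1 / real q ^ d"
  note x = inverse_power_le_half[OF assms]
  have sm: "summable (\<lambda>m. ?x ^ m\<^sup>2 / qfac ?x m)" using x by (intro summable_rr_series) auto
  have nn: "\<bar>?x ^ m\<^sup>2 / qfac ?x m\<bar> = ?x ^ m\<^sup>2 / qfac ?x m" for m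
    using x qfac_pos[of ?x m] by (intro abs_of_nonneg divide_nonneg_pos) auto
  show "abs_sums (1 - fps_const ?x * fps_X ^ d) (1 - ?x)" by (rule abs_sums_linear) fact
  show "abs_sums (gl_fps q d) (\<Sum>m. ?x ^ m\<^sup>2 / qfac ?x m)"
    unfolding gl_fps_eq[OF assms]
    by (rule abs_sums_multiples) (use assms sm nn summable_sums[OF sm] in simp_all)
qed

section \<open>Coefficientwise majorants\<close>

definition abs_fps :: "real fps \<Rightarrow> real fps" where
  "abs_fps f = Abs_fps (\<lambda>n. \<bar>f $ n\<bar>)"

lemma abs_sums_abs_local_factor:
  assumes "q > 1" "d > 0"
  shows "\<exists>v. abs_sums (abs_fps (local_factor q d)) v \<and> 0 \<le> v \<and> v \<le> 1 + 3 * tail_const * (1 / real q ^ d)\<^sup>2"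
proof (intro exI conjI)
  let ?x = "1 / real q ^ d"
  note x = inverse_power_le_half[OF assms]
  have "abs_fps (local_factor q d) = Abs_fps (\<lambda>n. if d dvd n then \<bar>rr_coeff ?x (n div d)\<bar> else 0)"
    unfolding local_factor_eq[OF assms] abs_fps_def by (intro fps_ext) simp
  then show "abs_sums (abs_fps (local_factor q d)) (\<Sum>m. \<bar>rr_coeff ?x m\<bar>)"
    using rr_coeff_abs_summable(1)[OF x] assms(2) by (auto intro!: abs_sums_multiples summable_sums)
  show "0 \<le> (\<Sum>m. \<bar>rr_coeff ?x m\<bar>)" by (intro suminf_nonneg rr_coeff_abs_summable(1)[OF x]) auto
qed (rule rr_coeff_abs_summable(2)[OF inverse_power_le_half[OF assms]])

lemma abs_fps_mult_le:
  fixes f g F G :: "real fps"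
  assumes "\<And>n. \<bar>f $ n\<bar> \<le> F $ n" "\<And>n. \<bar>g $ n\<bar> \<le> G $ n"
  shows "\<bar>(f * g) $ n\<bar> \<le> (F * G) $ n"
proof -
  have "\<bar>(f * g) $ n\<bar> \<le> (\<Sum>i=0..n. \<bar>f $ i\<bar> * \<bar>g $ (n - i)\<bar>)"
    unfolding fps_mult_nth by (rule order_trans[OF sum_abs]) (simp add: abs_mult)
  also have "\<dots> \<le> (\<Sum>i=0..n. F $ i * G $ (n - i))"
    by (intro sum_mono mult_mono assms) (use assms order_trans[OF abs_ge_zero] in auto)
  finally show ?thesis by (simp add: fps_mult_nth)
qed

lemma abs_fps_prod_le: "\<bar>(\<Prod>p\<in>S. f p) $ n\<bar> \<le> (\<Prod>p\<in>S. abs_fps (f p)) $ n"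
  for f :: "_ \<Rightarrow> real fps"
proof (induction S arbitrary: n rule: infinite_finite_induct)
  case (insert p S)
  then show ?case by (auto simp: abs_fps_def intro!: abs_fps_mult_le)
qed auto

lemma nonneg_fps_mult_mono:
  fixes F R :: "real fps"
  assumes "\<And>n. F $ n \<ge> 0" "\<And>n. R $ n \<ge> 0" "R $ 0 = 1"
  shows "F $ n \<le> (F * R) $ n"
proof -
  have "F $ n = (\<Sum>i\<in>{n}. F $ i * R $ (n - i))" using assms by simp
  also have "\<dots> \<le> (\<Sum>i=0..n. F $ i * R $ (n - i))"
    by (rule sum_mono2) (use assms in auto)
  finally show ?thesis by (simp add: fps_mult_nth)
qed

definition nonneg_fps :: "real fps \<Rightarrow> bool" where
  "nonneg_fps f \<longleftrightarrow> (\<forall>n. f $ n \<ge> 0)"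

lemma nonneg_abs_fps: "nonneg_fps (abs_fps f)"
  by (simp add: nonneg_fps_def abs_fps_def)

lemma nonneg_fps_mult: "nonneg_fps f \<Longrightarrow> nonneg_fps g \<Longrightarrow> nonneg_fps (f * g)"
  by (auto simp: nonneg_fps_def fps_mult_nth intro!: sum_nonneg)

lemma nonneg_fps_prod: "(\<And>p. p \<in> S \<Longrightarrow> nonneg_fps (f p)) \<Longrightarrow> nonneg_fps (\<Prod>p\<in>S. f p)"
  by (induction S rule: infinite_finite_induct) (simp_all add: nonneg_fps_mult, simp_all add: nonneg_fps_def)

lemma fps_prod_nth_0': "(\<Prod>p\<in>S. f p) $ 0 = (\<Prod>p\<in>S. f p $ 0)" for f :: "_ \<Rightarrow> real fps"
  by (induction S rule: infinite_finite_induct) auto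

definition fps_rescale :: "real \<Rightarrow> real fps \<Rightarrow> real fps" where
  "fps_rescale c f = Abs_fps (\<lambda>n. c ^ n * f $ n)"

lemma fps_rescale_mult: "fps_rescale c (f * g) = fps_rescale c f * fps_rescale c g"
proof (rule fps_ext)
  fix n
  have "c ^ n * (f $ i * g $ (n - i)) = (c ^ i * f $ i) * (c ^ (n - i) * g $ (n - i))" if "i \<in> {0..n}" for i
    using that by (simp add: mult_ac flip: power_add)
  then have "(\<Sum>i=0..n. c ^ n * (f $ i * g $ (n - i))) =
      (\<Sum>i=0..n. (c ^ i * f $ i) * (c ^ (n - i) * g $ (n - i)))"
    by (rule sum.cong[OF refl])
  then show "fps_rescale c (f * g) $ n = (fps_rescale c f * fps_rescale c g) $ n"
    by (simp add: fps_rescale_def fps_mult_nth sum_distrib_left)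
qed

lemma fps_rescale_prod: "fps_rescale c (\<Prod>p\<in>S. f p) = (\<Prod>p\<in>S. fps_rescale c (f p))"
proof -
  have "fps_rescale c 1 = 1" by (rule fps_ext) (simp add: fps_rescale_def)
  then show ?thesis by (induction S rule: infinite_finite_induct) (simp_all add: fps_rescale_mult)
qed

lemma fps_rescale_linear:
  "fps_rescale c (1 - fps_const a * fps_X ^ d) = 1 - fps_const (a * c ^ d) * fps_X ^ d"
  by (rule fps_ext) (auto simp: fps_rescale_def fps_X_power_nth)

definition nonzero_irreducibles :: "nat \<Rightarrow> 'a :: field poly set" where
  "nonzero_irreducibles d = irreducibles_upto d - {[:0, 1:]}"

section \<open>Truncated Euler products over a fixed finite field\<close>

context
  fixes q :: nat
  assumes q_card: "q = CARD('a :: finite_field)"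
begin

lemma q_gt: "q > 1" using fin_fun_space.q_gt_1[where 'a = 'a] by (simp add: q_card)

abbreviation irrs :: "nat \<Rightarrow> 'a poly set" where "irrs \<equiv> nonzero_irreducibles"

lemma finite_irrs: "finite (irrs d)"
  using finite_irreducibles_upto by (simp add: nonzero_irreducibles_def)

lemma irrs_degree_pos: "p \<in> irrs d \<Longrightarrow> degree p > 0"
  using irreducible_degree_pos by (auto simp: nonzero_irreducibles_def irreducibles_upto_def monic_irreducible_def)

lemma irreducibles_upto_insert:
  "d \<ge> 1 \<Longrightarrow> irreducibles_upto d = insert [:0, 1:] (irrs d)" "[:0, 1:] \<notin> irrs d"
  using fin_fun_space.monic_irreducible_X[where 'a = 'a]
  by (auto simp: nonzero_irreducibles_def irreducibles_upto_def)

lemma irrs_mono: "d \<le> e \<Longrightarrow> irrs d \<subseteq> irrs e"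
  by (auto simp: nonzero_irreducibles_def irreducibles_upto_def)

text \<open>Bounding irreducibles by all monic polynomials is enough: there are \<open>q ^ k\<close>
  of degree \<open>k\<close>, each of weight \<open>q ^ (-2k)\<close>, and the resulting geometric
  series has ratio at most 1/2.\<close>

lemma sum_irrs_le: "(\<Sum>p\<in>irrs d. (1 / real q ^ degree p)\<^sup>2) \<le> 1"
proof -
  let ?g = "\<lambda>p :: 'a poly. (1 / real q ^ degree p)\<^sup>2"
  have "(\<Sum>p\<in>irrs d. ?g p) \<le> (\<Sum>p\<in>(\<Union>k\<in>{1..d}. monic_polys k). ?g p)"
  proof (rule sum_mono2)
    show "finite (\<Union>k\<in>{1..d}. monic_polys k :: 'a poly set)" using card_monic_polys[where 'a = 'a] by auto
    show "irrs d \<subseteq> (\<Union>k\<in>{1..d}. monic_polys k)"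
    proof
      fix p assume p: "p \<in> irrs d"
      then have "degree p \<in> {1..d}" "p \<in> monic_polys (degree p)"
        using irrs_degree_pos[OF p]
        by (auto simp: nonzero_irreducibles_def irreducibles_upto_def monic_polys_def monic_irreducible_def)
      then show "p \<in> (\<Union>k\<in>{1..d}. monic_polys k)" by blast
    qed
  qed auto
  also have "\<dots> = (\<Sum>k=1..d. \<Sum>p\<in>monic_polys k. ?g p)"
    by (rule sum.UNION_disjoint) (use card_monic_polys[where 'a = 'a] in \<open>auto simp: monic_polys_def\<close>)
  also have "\<dots> = (\<Sum>k=1..d. (1 / real q) ^ k)"
  proof (intro sum.cong refl)
    fix k
    have "(\<Sum>p\<in>monic_polys k. ?g p) = (\<Sum>p\<in>(monic_polys k :: 'a poly set). (1 / real q ^ k)\<^sup>2)"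
      by (intro sum.cong) (auto simp: monic_polys_def)
    also have "\<dots> = real q ^ k * (1 / real q ^ k)\<^sup>2" using card_monic_polys[where 'a = 'a, of k] by (simp add: q_card)
    also have "\<dots> = (1 / real q) ^ k" using q_gt by (simp add: power2_eq_square power_one_over field_simps)
    finally show "(\<Sum>p\<in>monic_polys k. ?g p) = (1 / real q) ^ k" .
  qed
  also have "\<dots> \<le> (\<Sum>k=1..d. (1 / 2) ^ k)"
    using inverse_power_le_half[OF q_gt, of 1] by (intro sum_mono power_mono) auto
  also have "\<dots> = 1 - (1 / 2) ^ d" by (induction d) auto
  also have "\<dots> \<le> 1" by simp
  finally show ?thesis .
qed

text \<open>A truncation of \<open>1 - u\<close> times the generating function of the probabilities.
  The leading factor is the weight of \<open>X\<close>: that polynomial contributes no series, but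
  its weight completes the Euler product.\<close>

definition approx :: "nat \<Rightarrow> real fps" where
  "approx d = (1 - fps_const (1 / real q) * fps_X ^ 1) * (\<Prod>p\<in>irrs d. local_factor q (degree p))"

definition approx_majorant :: "nat \<Rightarrow> real fps" where
  "approx_majorant d = abs_fps (1 - fps_const (1 / real q) * fps_X ^ 1) * (\<Prod>p\<in>irrs d. abs_fps (local_factor q (degree p)))"

definition approx_value :: "nat \<Rightarrow> real" where
  "approx_value d = (1 - 1 / real q) * (\<Prod>p\<in>irrs d. rr_value (1 / real q ^ degree p))"

lemma abs_sums_approx: "abs_sums (approx d) (approx_value d)"
  unfolding approx_def approx_value_def
  by (intro abs_sums_mult abs_sums_linear abs_sums_prod abs_sums_local_factor q_gt irrs_degree_pos) auto

lemma approx_le_majorant: "\<bar>approx d $ n\<bar> \<le> approx_majorant d $ n"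
  unfolding approx_def approx_majorant_def
  by (rule abs_fps_mult_le[OF _ abs_fps_prod_le]) (simp add: abs_fps_def)

lemma nonneg_majorant: "nonneg_fps (approx_majorant d)"
  unfolding approx_majorant_def by (intro nonneg_fps_mult nonneg_fps_prod nonneg_abs_fps)

text \<open>The additional factors have nonnegative coefficients and constant coefficient 1, so
  multiplying by them cannot lower a coefficient.\<close>

lemma majorant_mono:
  assumes "d \<le> e" shows "approx_majorant d $ n \<le> approx_majorant e $ n"
proof -
  let ?R = "\<Prod>p\<in>irrs e - irrs d. abs_fps (local_factor q (degree p))"
  have "approx_majorant e = approx_majorant d * ?R"
    unfolding approx_majorant_def prod.subset_diff[OF irrs_mono[OF assms] finite_irrs]
    by (simp only: mult_ac)
  moreover have "nonneg_fps ?R" by (intro nonneg_fps_prod nonneg_abs_fps)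
  moreover have "local_factor q (degree p) $ 0 = 1" if "p \<in> irrs e" for p
    using local_factor_eq[OF q_gt irrs_degree_pos[OF that]] by (simp add: rr_coeff_def)
  then have "?R $ 0 = 1" unfolding fps_prod_nth_0' by (intro prod.neutral) (simp add: abs_fps_def)
  ultimately show ?thesis
    using nonneg_fps_mult_mono[of "approx_majorant d" ?R n] nonneg_majorant[of d] by (simp add: nonneg_fps_def)
qed

text \<open>The factor 2 bounds \<open>1 + 1 / q\<close>. The product is bounded through
  \<open>1 + t <= exp t\<close>, whose exponents add up to at most \<open>3 * tail_const\<close> by
  \<open>sum_irrs_le\<close>, for every \<open>d\<close>.\<close>

lemma majorant_sums_bounded:
  "\<exists>v. abs_sums (approx_majorant d) v \<and> v \<le> 2 * exp (3 * tail_const)"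
proof -
  have "\<forall>k\<in>{0<..}. \<exists>v. abs_sums (abs_fps (local_factor q k)) v \<and> 0 \<le> v \<and> v \<le> 1 + 3 * tail_const * (1 / real q ^ k)\<^sup>2"
    using abs_sums_abs_local_factor[OF q_gt] by blast
  from bchoice[OF this] obtain v where v: "\<forall>k\<in>{0<..}. abs_sums (abs_fps (local_factor q k)) (v k) \<and> 0 \<le> v k \<and>
      v k \<le> 1 + 3 * tail_const * (1 / real q ^ k)\<^sup>2" by blast
  have vp: "abs_sums (abs_fps (local_factor q (degree p))) (v (degree p))" "0 \<le> v (degree p)"
      "v (degree p) \<le> 1 + 3 * tail_const * (1 / real q ^ degree p)\<^sup>2" if "p \<in> irrs d" for p
    using v irrs_degree_pos[OF that] by auto
  have "abs_fps (1 - fps_const (1 / real q) * fps_X ^ 1) = 1 - fps_const (- (1 / real q)) * fps_X ^ 1"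
    by (rule fps_ext) (auto simp: abs_fps_def fps_X_power_nth)
  then have "abs_sums (abs_fps (1 - fps_const (1 / real q) * fps_X ^ 1)) (1 + 1 / real q)"
    using abs_sums_linear[of 1 "- (1 / real q)"] by simp
  then have "abs_sums (approx_majorant d) ((1 + 1 / real q) * (\<Prod>p\<in>irrs d. v (degree p)))"
    unfolding approx_majorant_def using vp(1) by (intro abs_sums_mult abs_sums_prod)
  moreover have "(1 + 1 / real q) * (\<Prod>p\<in>irrs d. v (degree p)) \<le> 2 * exp (3 * tail_const)"
  proof (rule mult_mono)
    have "(\<Prod>p\<in>irrs d. v (degree p)) \<le> (\<Prod>p\<in>irrs d. exp (3 * tail_const * (1 / real q ^ degree p)\<^sup>2))"
      using vp by (intro prod_mono conjI) (auto intro: order_trans[OF _ exp_ge_add_one_self])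
    also have "\<dots> = exp (3 * tail_const * (\<Sum>p\<in>irrs d. (1 / real q ^ degree p)\<^sup>2))"
      by (simp only: exp_sum[OF finite_irrs] sum_distrib_left)
    also have "\<dots> \<le> exp (3 * tail_const * 1)"
      using sum_irrs_le tail_const_pos unfolding exp_le_cancel_iff by (intro mult_left_mono) auto
    finally show "(\<Prod>p\<in>irrs d. v (degree p)) \<le> exp (3 * tail_const)" by simp
    show "0 \<le> (\<Prod>p\<in>irrs d. v (degree p))" using vp(2) by (intro prod_nonneg) auto
  qed (use q_gt in auto)
  ultimately show ?thesis by blast
qed

definition limit_majorant :: "nat \<Rightarrow> real" where
  "limit_majorant n = (SUP d. approx_majorant d $ n)"

lemma sum_majorant_le: "(\<Sum>n<N. approx_majorant d $ n) \<le> 2 * exp (3 * tail_const)"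
proof -
  obtain v where v: "abs_sums (approx_majorant d) v" "v \<le> 2 * exp (3 * tail_const)"
    using majorant_sums_bounded by blast
  have "(\<Sum>n<N. approx_majorant d $ n) \<le> v"
    using v(1) nonneg_majorant[of d]
    by (auto simp: abs_sums_def sums_iff nonneg_fps_def intro!: sum_le_suminf)
  then show ?thesis using v(2) by linarith
qed

lemma bdd_majorant: "bdd_above (range (\<lambda>d. approx_majorant d $ n))"
proof (rule bdd_aboveI2)
  fix d
  have "approx_majorant d $ n \<le> (\<Sum>i<Suc n. approx_majorant d $ i)"
    using nonneg_majorant[of d] by (intro member_le_sum) (auto simp: nonneg_fps_def)
  also have "\<dots> \<le> 2 * exp (3 * tail_const)" by (rule sum_majorant_le)
  finally show "approx_majorant d $ n \<le> 2 * exp (3 * tail_const)" .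
qed

lemma approx_le_limit_majorant: "\<bar>approx d $ n\<bar> \<le> limit_majorant n"
  using approx_le_majorant[of d n] cSUP_upper[OF _ bdd_majorant, of d n]
  by (simp add: limit_majorant_def)

text \<open>The majorants increase with \<open>d\<close>, so their supremum is a limit and the bound
  on partial sums, which is uniform in \<open>d\<close>, passes to it.\<close>

lemma summable_limit_majorant: "summable limit_majorant"
proof (rule summableI_nonneg_bounded)
  show "0 \<le> limit_majorant n" for n using approx_le_limit_majorant[of 0 n] by linarith
  fix N
  have "(\<lambda>d. approx_majorant d $ n) \<longlonglongrightarrow> limit_majorant n" for n
    unfolding limit_majorant_def
    by (rule LIMSEQ_incseq_SUP[OF bdd_majorant incseq_SucI[OF majorant_mono]]) simp
  then have "(\<lambda>d. \<Sum>n<N. approx_majorant d $ n) \<longlonglongrightarrow> (\<Sum>n<N. limit_majorant n)"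
    by (intro tendsto_sum)
  then show "(\<Sum>n<N. limit_majorant n) \<le> 2 * exp (3 * tail_const)"
    by (rule LIMSEQ_le_const2) (use sum_majorant_le in blast)
qed

text \<open>The coefficients of \<open>1 - u\<close> times the generating function of the
  probabilities; their partial sums telescope back to the probabilities, so the sought limit is the
  sum of this series.\<close>

definition prob_diff :: "nat \<Rightarrow> real" where
  "prob_diff n = prob_semisimple TYPE('a) n - (if n = 0 then 0 else prob_semisimple TYPE('a) (n - 1))"

lemma sum_prob_diff: "(\<Sum>k\<le>n. prob_diff k) = prob_semisimple TYPE('a) n"
  by (induction n) (simp_all add: prob_diff_def)

definition sifted_fps :: "nat \<Rightarrow> real fps" where
  "sifted_fps d = Abs_fps (\<lambda>n. real (card (sifted (irreducibles_upto d) n :: 'a poly set)))"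

lemma sifted_fps_nth_0: "sifted_fps d $ 0 = 1"
  and sifted_fps_nth: "0 < n \<Longrightarrow> n \<le> d \<Longrightarrow> sifted_fps d $ n = 0"
  and sifted_fps_nth_le: "sifted_fps d $ n \<le> real q ^ n"
proof -
  have "\<forall>r\<in>irreducibles_upto d. monic_irreducible (r :: 'a poly)" by (simp add: irreducibles_upto_def)
  then show "sifted_fps d $ 0 = 1" by (simp add: sifted_fps_def card_sifted_0)
  show "0 < n \<Longrightarrow> n \<le> d \<Longrightarrow> sifted_fps d $ n = 0" by (simp add: sifted_fps_def card_sifted_upto)
  show "sifted_fps d $ n \<le> real q ^ n"
    using card_sifted_le[of "irreducibles_upto d :: 'a poly set" n]
    by (simp add: sifted_fps_def q_card flip: of_nat_power)
qed

text \<open>The sieve identity with \<open>c * u\<close> substituted for \<open>u\<close> and the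
  factor of \<open>X\<close> separated. It is used formally with \<open>c = 1 / q\<close>, and
  numerically at \<open>u = 1\<close> with \<open>c\<close> below \<open>1 / q\<close>.\<close>

lemma rescaled_euler_product:
  assumes "d \<ge> 1"
  shows "fps_rescale c (sifted_fps d) * (1 - fps_const (real q * c) * fps_X ^ 1) =
    (1 - fps_const c * fps_X ^ 1) * (\<Prod>p\<in>irrs d. 1 - fps_const (c ^ degree p) * fps_X ^ degree p)"
proof -
  have "sifted_fps d * (1 - fps_const (real q) * fps_X ^ 1)
      = (\<Prod>p\<in>(irreducibles_upto d :: 'a poly set). 1 - fps_const 1 * fps_X ^ degree p)"
    unfolding sifted_fps_def q_card
    using sifted_euler_product[OF finite_irreducibles_upto[where 'a = 'a], of d] by (simp add: irreducibles_upto_def)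
  then have "fps_rescale c (sifted_fps d * (1 - fps_const (real q) * fps_X ^ 1))
      = (\<Prod>p\<in>(irreducibles_upto d :: 'a poly set). 1 - fps_const (c ^ degree p) * fps_X ^ degree p)"
    by (simp only: fps_rescale_prod fps_rescale_linear mult_1)
  then show ?thesis
    unfolding fps_rescale_mult fps_rescale_linear irreducibles_upto_insert(1)[OF assms]
    using finite_irrs irreducibles_upto_insert(2) by simp
qed

text \<open>At \<open>c = 1 / q\<close> the weights multiply to \<open>1 - u\<close> times a
  rescaled sifted series. That series agrees with 1 up to degree \<open>d\<close>, so it does not
  affect the coefficient with \<open>n\<close> at most \<open>d\<close>.\<close>

lemma approx_nth:
  assumes "n \<le> d" "d \<ge> 1"
  shows "approx d $ n = prob_diff n"
proof -
  let ?S = "\<Prod>p\<in>irrs d. gl_fps q (degree p)" and ?M = "fps_rescale (1 / real q) (sifted_fps d)"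
  have S: "?S $ k = prob_semisimple TYPE('a) k" if "k \<le> d" for k
    using prob_semisimple_eq_coeff[OF that, where 'a = 'a] by (simp add: nonzero_irreducibles_def q_card)
  have "approx d = ((1 - fps_const (1 / real q) * fps_X ^ 1) *
      (\<Prod>p\<in>irrs d. 1 - fps_const ((1 / real q) ^ degree p) * fps_X ^ degree p)) * ?S"
    unfolding approx_def local_factor_def by (simp add: prod.distrib power_one_over mult.assoc)
  also have "\<dots> = ?M * ((1 - fps_X) * ?S)"
    unfolding rescaled_euler_product[OF assms(2), symmetric] using q_gt by (simp add: mult.assoc)
  finally have "approx d $ n = (\<Sum>i=0..n. ?M $ i * ((1 - fps_X) * ?S) $ (n - i))"
    by (simp add: fps_mult_nth)
  also have "\<dots> = (\<Sum>i\<in>{0}. ?M $ i * ((1 - fps_X) * ?S) $ (n - i))"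
    by (intro sum.mono_neutral_right) (use assms sifted_fps_nth in \<open>auto simp: fps_rescale_def\<close>)
  also have "\<dots> = ((1 - fps_X) * ?S) $ n" by (simp add: fps_rescale_def sifted_fps_nth_0)
  also have "\<dots> = ?S $ n - (if n = 0 then 0 else ?S $ (n - 1))"
    by (simp add: left_diff_distrib)
  also have "\<dots> = prob_diff n" using assms S[of n] S[of "n - 1"] by (simp add: prob_diff_def)
  finally show ?thesis .
qed

text \<open>Each coefficient of \<open>approx d\<close> is eventually constant in \<open>d\<close>,
  and \<open>limit_majorant\<close> dominates all of them, so Tannery's theorem identifies the limit
  of the values at \<open>u = 1\<close> with the sum of the limiting coefficients.\<close>

lemma prob_semisimple_limit:
  "(\<lambda>n. prob_semisimple TYPE('a) n) \<longlonglongrightarrow> suminf prob_diff" "approx_value \<longlonglongrightarrow> suminf prob_diff"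
proof -
  have lim: "(\<lambda>d. approx d $ n) \<longlonglongrightarrow> prob_diff n" for n
    by (rule tendsto_eventually, rule eventually_sequentiallyI[of "max n 1"]) (simp add: approx_nth)
  have "eventually (\<lambda>(k, n). norm (approx n $ k) \<le> limit_majorant k) (at_top \<times>\<^sub>F sequentially)"
    using approx_le_limit_majorant by (intro always_eventually) auto
  from tannerys_theorem[OF lim this summable_limit_majorant]
  have *: "summable (\<lambda>n. norm (prob_diff n))" "(\<lambda>n. \<Sum>k. approx n $ k) \<longlonglongrightarrow> suminf prob_diff" by auto
  have "(\<Sum>k. approx n $ k) = approx_value n" for n
    using abs_sums_approx[of n] by (simp add: abs_sums_def sums_iff)
  then show "approx_value \<longlonglongrightarrow> suminf prob_diff" using *(2) by simp
  show "(\<lambda>n. prob_semisimple TYPE('a) n) \<longlonglongrightarrow> suminf prob_diff"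
    using summable_LIMSEQ'[OF summable_norm_cancel[OF *(1)]] by (simp add: sum_prob_diff)
qed

section \<open>Evaluation of the limit\<close>

lemma sifted_value:
  assumes t: "0 < t" "real q * t < 1" and d: "d \<ge> 1"
  shows "(\<Sum>n. sifted_fps d $ n * t ^ n) * (1 - real q * t) = (1 - t) * (\<Prod>p\<in>irrs d. 1 - t ^ degree p)"
proof -
  let ?M = "fps_rescale t (sifted_fps d)"
  have nonneg: "sifted_fps d $ n \<ge> 0" for n by (simp add: sifted_fps_def)
  have bound: "\<bar>?M $ n\<bar> \<le> (real q * t) ^ n" for n
    using sifted_fps_nth_le[of d n] nonneg[of n] t by (simp add: fps_rescale_def power_mult_distrib mult.commute mult_right_mono)
  have "summable (\<lambda>n. (real q * t) ^ n)" using t by (intro summable_geometric) (simp add: abs_mult)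
  then have "summable (\<lambda>n. \<bar>?M $ n\<bar>)" by (rule summable_comparison_test'[of _ 0]) (use bound in simp)
  then have "abs_sums ?M (\<Sum>n. ?M $ n)"
    unfolding abs_sums_def using summable_sums[OF summable_rabs_cancel] by blast
  then have "abs_sums (?M * (1 - fps_const (real q * t) * fps_X ^ 1)) ((\<Sum>n. ?M $ n) * (1 - real q * t))"
    by (intro abs_sums_mult abs_sums_linear) auto
  moreover have "abs_sums ((1 - fps_const t * fps_X ^ 1) * (\<Prod>p\<in>irrs d. 1 - fps_const (t ^ degree p) * fps_X ^ degree p))
      ((1 - t) * (\<Prod>p\<in>irrs d. 1 - t ^ degree p))"
    by (intro abs_sums_mult abs_sums_linear abs_sums_prod irrs_degree_pos) auto
  ultimately have "(\<Sum>n. ?M $ n) * (1 - real q * t) = (1 - t) * (\<Prod>p\<in>irrs d. 1 - t ^ degree p)"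
    unfolding rescaled_euler_product[OF d] by (rule abs_sums_unique)
  then show ?thesis by (simp add: fps_rescale_def mult.commute)
qed

text \<open>The sifted series at \<open>t\<close> tends to 1: its coefficients of positive index
  vanish one after another as \<open>d\<close> grows, and the geometric series in
  \<open>q * t\<close> dominates. The two linear factors of the sieve identity remain.\<close>

lemma euler_product_limit:
  assumes t: "0 < t" "real q * t < 1"
  shows "(\<lambda>d. \<Prod>p\<in>irrs d. 1 - t ^ degree p) \<longlonglongrightarrow> (1 - real q * t) / (1 - t)"
proof -
  have "1 * t \<le> real q * t" using t q_gt by (intro mult_right_mono) auto
  then have t1: "t < 1" using t by linarith
  have lim: "(\<lambda>d. sifted_fps d $ n * t ^ n) \<longlonglongrightarrow> (if n = 0 then 1 else 0)" for n
    by (rule tendsto_eventually, rule eventually_sequentiallyI[of n])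
       (simp add: sifted_fps_nth_0 sifted_fps_nth)
  have "norm (sifted_fps d $ n * t ^ n) \<le> (real q * t) ^ n" for d n
  proof -
    have "sifted_fps d $ n * t ^ n \<ge> 0" using t by (simp add: sifted_fps_def)
    moreover have "sifted_fps d $ n * t ^ n \<le> real q ^ n * t ^ n"
      using sifted_fps_nth_le t by (intro mult_right_mono) auto
    ultimately show ?thesis by (simp add: power_mult_distrib)
  qed
  then have "eventually (\<lambda>(k, n). norm (sifted_fps n $ k * t ^ k) \<le> (real q * t) ^ k) (at_top \<times>\<^sub>F sequentially)"
    by (intro always_eventually) auto
  moreover have "summable (\<lambda>n. (real q * t) ^ n)" using t by (intro summable_geometric) (simp add: abs_mult)
  ultimately have "(\<lambda>d. \<Sum>n. sifted_fps d $ n * t ^ n) \<longlonglongrightarrow> (\<Sum>n. if n = 0 then 1 else 0)"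
    using tannerys_theorem[OF lim] by simp
  also have "(\<Sum>n :: nat. if n = 0 then 1 else 0 :: real) = 1"
    using suminf_finite[of "{0 :: nat}" "\<lambda>n. if n = 0 then 1 else 0 :: real"] by simp
  finally have "(\<lambda>d. (\<Sum>n. sifted_fps d $ n * t ^ n) * ((1 - real q * t) / (1 - t))) \<longlonglongrightarrow> 1 * ((1 - real q * t) / (1 - t))"
    by (intro tendsto_mult tendsto_const)
  moreover have "eventually (\<lambda>d. (\<Sum>n. sifted_fps d $ n * t ^ n) * ((1 - real q * t) / (1 - t))
      = (\<Prod>p\<in>irrs d. 1 - t ^ degree p)) sequentially"
    using eventually_ge_at_top[of 1]
  proof eventually_elim
    case (elim d)
    show ?case using sifted_value[OF t elim] t1 by (simp add: field_simps)
  qed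
  ultimately show ?thesis by (simp add: tendsto_cong)
qed

text \<open>The Rogers-Ramanujan product without its first exponent 1, paired as (4,6), (9,11), and
  so on. The pairing is shifted because the weight \<open>1 - x\<close> cancels the exponent
  1.\<close>

definition rr_partial :: "nat \<Rightarrow> real \<Rightarrow> real" where
  "rr_partial N x = (\<Prod>i<N. 1 / ((1 - x ^ (5 * i + 4)) * (1 - x ^ (5 * i + 6))))"

lemma rr_partial_limit:
  assumes x: "0 < x" "x < 1"
  shows "(\<lambda>N. rr_partial N x) \<longlonglongrightarrow> rr_value x"
proof -
  have pos: "1 - x ^ k > 0" if "k > 0" for k using x that by (simp add: power_less_one_iff)
  \<comment> \<open>Passing from the pairs (1,4), (6,9) to (4,6), (9,11) costs the first factor and
    one unpaired factor at the end; the latter tends to 1.\<close>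
  have shift: "(1 - x) * (\<Prod>i<Suc N. 1 / ((1 - x ^ (5 * i + 1)) * (1 - x ^ (5 * i + 4)))) * (1 - x ^ (5 * N + 4)) = rr_partial N x" for N
  proof (induction N)
    case 0
    show ?case using pos[of 1] pos[of 4] by (simp add: rr_partial_def)
  next
    case (Suc N)
    let ?p = "\<Prod>i<Suc N. 1 / ((1 - x ^ (5 * i + 1)) * (1 - x ^ (5 * i + 4)))"
    have e: "5 * Suc N + 1 = 5 * N + 6" by simp
    have nz: "1 - x ^ (5 * Suc N + 4) \<noteq> 0" "1 - x ^ (5 * N + 4) \<noteq> 0"
      using pos[of "5 * Suc N + 4"] pos[of "5 * N + 4"] by linarith+
    have "(1 - x) * (\<Prod>i<Suc (Suc N). 1 / ((1 - x ^ (5 * i + 1)) * (1 - x ^ (5 * i + 4)))) * (1 - x ^ (5 * Suc N + 4))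
        = (1 - x) * ?p * (1 / ((1 - x ^ (5 * N + 6)) * (1 - x ^ (5 * Suc N + 4)))) * (1 - x ^ (5 * Suc N + 4))"
      unfolding prod.lessThan_Suc[of _ "Suc N"] e by (simp only: mult.assoc)
    also have "\<dots> = (1 - x) * ?p * (1 / (1 - x ^ (5 * N + 6)))" using nz(1) by simp
    also have "\<dots> = ((1 - x) * ?p * (1 - x ^ (5 * N + 4))) * (1 / ((1 - x ^ (5 * N + 4)) * (1 - x ^ (5 * N + 6))))"
      using nz(2) by simp
    also have "\<dots> = rr_partial (Suc N) x"
      unfolding Suc.IH by (simp add: rr_partial_def)
    finally show ?case .
  qed
  have "(\<lambda>N. x ^ N) \<longlonglongrightarrow> 0" using x by (intro LIMSEQ_power_zero) simp
  then have "(\<lambda>N. x ^ (5 * N + 4)) \<longlonglongrightarrow> 0"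
    by (rule filterlim_compose[OF _ filterlim_subseq]) (simp add: strict_mono_def)
  then have "(\<lambda>N. (1 - x) * (\<Prod>i<Suc N. 1 / ((1 - x ^ (5 * i + 1)) * (1 - x ^ (5 * i + 4)))) * (1 - x ^ (5 * N + 4)))
      \<longlonglongrightarrow> (1 - x) * (\<Sum>s. x ^ s\<^sup>2 / qfac x s) * (1 - 0)"
    by (intro tendsto_mult tendsto_diff tendsto_const LIMSEQ_Suc[OF rogers_ramanujan[OF x]])
  then show ?thesis unfolding shift by (simp add: rr_value_def)
qed

lemma rr_term_ge_1:
  fixes x :: real
  assumes x: "0 < x" "x < 1" and "k > 0" "l > 0"
  shows "1 \<le> 1 / ((1 - x ^ k) * (1 - x ^ l))"
proof -
  have "0 < 1 - x ^ m" "1 - x ^ m \<le> 1" if "m > 0" for m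
    using x that by (simp_all add: power_less_one_iff)
  then have "0 < (1 - x ^ k) * (1 - x ^ l)" "(1 - x ^ k) * (1 - x ^ l) \<le> 1"
    using assms(3,4) by (intro mult_pos_pos mult_le_one; simp add: less_imp_le)+
  then show ?thesis by (simp only: le_divide_eq_1_pos)
qed

lemma rr_partial_pos:
  assumes x: "0 < x" "x < 1" shows "rr_partial N x \<ge> 1"
  unfolding rr_partial_def by (intro prod_ge_1 rr_term_ge_1 x) auto

lemma rr_partial_mono:
  assumes x: "0 < x" "x < 1" and "M \<le> N" shows "rr_partial M x \<le> rr_partial N x"
  using assms(3)
proof (rule lift_Suc_mono_le[rotated])
  fix n
  have "rr_partial n x * 1 \<le> rr_partial n x * (1 / ((1 - x ^ (5 * n + 4)) * (1 - x ^ (5 * n + 6))))"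
    using rr_partial_pos[OF x, of n] by (intro mult_left_mono rr_term_ge_1 x) auto
  then show "rr_partial n x \<le> rr_partial (Suc n) x" by (simp add: rr_partial_def)
qed

text \<open>For an array increasing in both indices each iterated limit is an upper bound of all
  entries, hence of the other iterated limit.\<close>

lemma mono_double_limit:
  fixes a :: "nat \<Rightarrow> nat \<Rightarrow> real"
  assumes "\<And>d. mono (a d)" "\<And>n. mono (\<lambda>d. a d n)"
    and "\<And>d. a d \<longlonglongrightarrow> A d" "\<And>n. (\<lambda>d. a d n) \<longlonglongrightarrow> B n" "A \<longlonglongrightarrow> L" "B \<longlonglongrightarrow> M"
  shows "L = M"
proof (rule antisym)
  have le: "a d n \<le> A d" "a d n \<le> B n" for d n
    using incseq_le[OF assms(1,3)] incseq_le[OF assms(2,4)] by auto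
  have "mono A" "mono B"
    using LIMSEQ_le[OF assms(3) assms(3)] LIMSEQ_le[OF assms(4) assms(4)] assms(1,2)
    by (auto simp: mono_def)
  then have "A d \<le> L" "B n \<le> M" for d n using incseq_le assms(5,6) by blast+
  then have bound: "a d n \<le> L" "a d n \<le> M" for d n using le order_trans by blast+
  then have "A d \<le> M" "B n \<le> L" for d n
    using LIMSEQ_le_const2[OF assms(3)] LIMSEQ_le_const2[OF assms(4)] by blast+
  then show "L \<le> M" "M \<le> L"
    using LIMSEQ_le_const2[OF assms(5)] LIMSEQ_le_const2[OF assms(6)] by blast+
qed

text \<open>The limit of the product over all irreducibles other than \<open>X\<close> of
  \<open>1 / (1 - q^(-r deg p))\<close>, for \<open>r\<close> at least 2; at \<open>r = 1\<close>
  the denominator is zero.\<close>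

definition rr_ratio :: "nat \<Rightarrow> real" where
  "rr_ratio r = (1 - 1 / real q ^ r) / (1 - 1 / real q ^ (r - 1))"

lemma euler_product_inverse_limit:
  assumes "r \<ge> 2"
  shows "(\<lambda>d. \<Prod>p\<in>irrs d. 1 / (1 - (1 / real q ^ degree p) ^ r)) \<longlonglongrightarrow> rr_ratio r"
proof -
  let ?t = "1 / real q ^ r"
  obtain s where r: "r = Suc s" "s \<ge> 1" using assms by (cases r) auto
  have qt: "real q * ?t = 1 / real q ^ s" using q_gt by (simp add: r)
  have lt: "1 / real q ^ s < 1" using q_gt r(2) by (simp add: one_less_power)
  have lim: "(\<lambda>d. \<Prod>p\<in>irrs d. 1 - ?t ^ degree p) \<longlonglongrightarrow> (1 - real q * ?t) / (1 - ?t)"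
    using q_gt qt lt by (intro euler_product_limit) auto
  have "1 / real q ^ r < 1" using q_gt r by (simp add: one_less_power del: power_Suc)
  then have "1 - ?t \<noteq> 0" by linarith
  moreover have "1 - real q * ?t \<noteq> 0" unfolding qt using lt by linarith
  ultimately have nz: "(1 - real q * ?t) / (1 - ?t) \<noteq> 0" by (metis divide_eq_0_iff)
  have "(\<lambda>d. 1 / (\<Prod>p\<in>irrs d. 1 - ?t ^ degree p)) \<longlonglongrightarrow> 1 / ((1 - real q * ?t) / (1 - ?t))"
    by (rule tendsto_divide[OF tendsto_const lim nz])
  moreover have "?t ^ k = (1 / real q ^ k) ^ r" for k by (simp add: power_one_over mult.commute flip: power_mult)
  ultimately show ?thesis unfolding qt by (simp add: rr_ratio_def r prod_dividef)
qed

text \<open>The array \<open>a d N\<close> truncates both the irreducibles, by degree, and the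
  Rogers-Ramanujan product, by length. All factors are at least 1, so it increases in both indices;
  \<open>rr_partial_limit\<close> handles the rows and \<open>euler_product_inverse_limit\<close>
  the columns.\<close>

lemma approx_value_limit:
  assumes V: "approx_value \<longlonglongrightarrow> V"
    and B: "(\<lambda>N. (1 - 1 / real q) * (\<Prod>i<N. rr_ratio (5 * i + 4) * rr_ratio (5 * i + 6))) \<longlonglongrightarrow> W"
  shows "V = W"
proof -
  let ?x = "\<lambda>p :: 'a poly. 1 / real q ^ degree p"
  define a where "a d N = (1 - 1 / real q) * (\<Prod>p\<in>irrs d. rr_partial N (?x p))" for d N
  have q0: "1 - 1 / real q \<ge> 0" using q_gt by simp
  have x: "0 < ?x p" "?x p < 1" if "p \<in> irrs d" for p d
    using inverse_power_le_half[OF q_gt irrs_degree_pos[OF that]] by linarith+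
  show ?thesis
  proof (rule mono_double_limit[of a approx_value _ V W])
    show "mono (a d)" for d
      unfolding a_def
      by (intro monoI mult_left_mono prod_mono conjI rr_partial_mono order_trans[OF zero_le_one rr_partial_pos] x q0)
    show "mono (\<lambda>d. a d N)" for N
      unfolding a_def
    proof (intro monoI mult_left_mono q0)
      fix d e :: nat assume "d \<le> e"
      have "(\<Prod>p\<in>irrs d. rr_partial N (?x p)) * 1 \<le> (\<Prod>p\<in>irrs d. rr_partial N (?x p)) * (\<Prod>p\<in>irrs e - irrs d. rr_partial N (?x p))"
      proof (rule mult_left_mono)
        show "1 \<le> (\<Prod>p\<in>irrs e - irrs d. rr_partial N (?x p))"
          by (intro prod_ge_1 rr_partial_pos) (use x[of _ e] in auto)
        show "0 \<le> (\<Prod>p\<in>irrs d. rr_partial N (?x p))"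
          by (intro prod_nonneg order_trans[OF zero_le_one rr_partial_pos] x)
      qed
      also have "\<dots> = (\<Prod>p\<in>irrs e. rr_partial N (?x p))"
        using prod.subset_diff[OF irrs_mono[OF \<open>d \<le> e\<close>] finite_irrs, of "\<lambda>p. rr_partial N (?x p)"]
        by (simp only: mult.commute)
      finally show "(\<Prod>p\<in>irrs d. rr_partial N (?x p)) \<le> (\<Prod>p\<in>irrs e. rr_partial N (?x p))" by simp
    qed
    show "a d \<longlonglongrightarrow> approx_value d" for d
      unfolding a_def approx_value_def
      by (intro tendsto_mult tendsto_const tendsto_prod rr_partial_limit x)
    show "(\<lambda>d. a d N) \<longlonglongrightarrow> (1 - 1 / real q) * (\<Prod>i<N. rr_ratio (5 * i + 4) * rr_ratio (5 * i + 6))" for N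
    proof -
      have "(\<lambda>d. \<Prod>i<N. (\<Prod>p\<in>irrs d. 1 / (1 - ?x p ^ (5 * i + 4))) * (\<Prod>p\<in>irrs d. 1 / (1 - ?x p ^ (5 * i + 6))))
          \<longlonglongrightarrow> (\<Prod>i<N. rr_ratio (5 * i + 4) * rr_ratio (5 * i + 6))"
        by (intro tendsto_prod tendsto_mult euler_product_inverse_limit) auto
      moreover have "(\<Prod>i<N. (\<Prod>p\<in>irrs d. 1 / (1 - ?x p ^ (5 * i + 4))) * (\<Prod>p\<in>irrs d. 1 / (1 - ?x p ^ (5 * i + 6))))
          = (\<Prod>p\<in>irrs d. rr_partial N (?x p))" for d
        unfolding rr_partial_def
        by (subst prod.swap) (simp add: prod.distrib [symmetric])
      ultimately show ?thesis unfolding a_def by (intro tendsto_mult tendsto_const) simp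
    qed
  qed fact+
qed

text \<open>Each block of five indices telescopes. With \<open>?y k\<close> as below, the residues
  2, 3, 0 contribute \<open>(?y 1 / ?y 3) * (?y 4 / ?y 5)\<close>, and trading the boundary term
  \<open>?y 1\<close> for \<open>?y 6\<close> turns this into the two values of
  \<open>rr_ratio\<close>. Index 0 contributes 1 by the convention in
  \<open>rr_factor\<close>.\<close>

lemma rr_factor_partial:
  "(\<Prod>r<5 * N + 1. rr_factor q r) * (1 - 1 / real q ^ (5 * N + 1)) =
    (1 - 1 / real q) * (\<Prod>i<N. rr_ratio (5 * i + 4) * rr_ratio (5 * i + 6))"
proof (induction N)
  case 0
  show ?case by (simp add: rr_factor_def)
next
  case (Suc N)
  let ?y = "\<lambda>k. 1 - 1 / real q ^ (5 * N + k)"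
  have nz: "?y k \<noteq> 0" if "k > 0" for k
  proof -
    have "real q ^ (5 * N + k) > 1" using q_gt that by (intro one_less_power) auto
    then show ?thesis by simp
  qed
  have s: "5 * N + 2 - 1 = 5 * N + 1" "5 * N + 3 - 1 = 5 * N + 2" "5 * N + 4 - 1 = 5 * N + 3"
    "5 * N + 5 - 1 = 5 * N + 4" "5 * N + 6 - 1 = 5 * N + 5" by simp_all
  have m: "(5 * N + 1) mod 5 = 1" "(5 * N + 2) mod 5 = 2" "(5 * N + 3) mod 5 = 3"
    "(5 * N + 4) mod 5 = 4" "(5 * N + 5) mod 5 = 0" by presburger+
  have f: "rr_factor q (5 * N + 1) = 1" "rr_factor q (5 * N + 2) = ?y 1 / ?y 2"
    "rr_factor q (5 * N + 3) = ?y 2 / ?y 3" "rr_factor q (5 * N + 4) = 1"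
    "rr_factor q (5 * N + 5) = ?y 4 / ?y 5"
    unfolding rr_factor_def s m by simp_all
  have g: "rr_ratio (5 * N + 4) = ?y 4 / ?y 3" "rr_ratio (5 * N + 6) = ?y 6 / ?y 5"
    unfolding rr_ratio_def s by simp_all
  have k: "5 * Suc N + 1 = Suc (5 * N + 5)" "5 * N + 5 = Suc (5 * N + 4)" "5 * N + 4 = Suc (5 * N + 3)"
    "5 * N + 3 = Suc (5 * N + 2)" "5 * N + 2 = Suc (5 * N + 1)" by simp_all
  let ?P = "\<lambda>k. \<Prod>r<k. rr_factor q r"
  have "?P (5 * Suc N + 1) = ?P (5 * N + 5) * rr_factor q (5 * N + 5)"
    by (subst k(1)) (rule prod.lessThan_Suc)
  also have "?P (5 * N + 5) = ?P (5 * N + 4) * rr_factor q (5 * N + 4)"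
    by (subst k(2)) (rule prod.lessThan_Suc)
  also have "?P (5 * N + 4) = ?P (5 * N + 3) * rr_factor q (5 * N + 3)"
    by (subst k(3)) (rule prod.lessThan_Suc)
  also have "?P (5 * N + 3) = ?P (5 * N + 2) * rr_factor q (5 * N + 2)"
    by (subst k(4)) (rule prod.lessThan_Suc)
  also have "?P (5 * N + 2) = ?P (5 * N + 1) * rr_factor q (5 * N + 1)"
    by (subst k(5)) (rule prod.lessThan_Suc)
  finally have P: "?P (5 * Suc N + 1) = ?P (5 * N + 1) * rr_factor q (5 * N + 1) * rr_factor q (5 * N + 2)
    * rr_factor q (5 * N + 3) * rr_factor q (5 * N + 4) * rr_factor q (5 * N + 5)" .
  have "A * 1 * (a / b) * (b / c) * 1 * (d / e) = A * (a / c) * (d / e)" if "b \<noteq> 0" for A a b c d e :: real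
    using that by simp
  from this[OF nz[OF zero_less_numeral]]
  have P: "?P (5 * Suc N + 1) = ?P (5 * N + 1) * (?y 1 / ?y 3) * (?y 4 / ?y 5)" unfolding P f .
  have "A * (a / b) * (c / d) * e = (A * a) * ((c / b) * (e / d))" for A a b c d e :: real
    by simp
  then have "(\<Prod>r<5 * Suc N + 1. rr_factor q r) * ?y 6 = ((\<Prod>r<5 * N + 1. rr_factor q r) * ?y 1) * ((?y 4 / ?y 3) * (?y 6 / ?y 5))"
    unfolding P .
  also have "\<dots> = (1 - 1 / real q) * (\<Prod>i<Suc N. rr_ratio (5 * i + 4) * rr_ratio (5 * i + 6))"
    unfolding Suc.IH g[symmetric] by simp
  finally show ?case by (simp add: add.commute)
qed

text \<open>With \<open>y = 1 / q ^ r\<close> a nontrivial factor differs from 1 by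
  \<open>(q - 1) * y / (1 - y)\<close>, which is at most \<open>2 * q * y\<close> since
  \<open>y\<close> is at most 1/2.\<close>

lemma rr_factor_convergent: "convergent_prod (rr_factor q)"
proof -
  have "summable (\<lambda>r. norm (rr_factor q r - 1))"
  proof (rule summable_comparison_test'[of "\<lambda>r. 2 * real q * (1 / real q) ^ r" 0])
    show "summable (\<lambda>r. 2 * real q * (1 / real q) ^ r)"
      using q_gt by (intro summable_mult summable_geometric) simp
    fix r :: nat
    show "norm (norm (rr_factor q r - 1)) \<le> 2 * real q * (1 / real q) ^ r"
    proof (cases "r \<ge> 1 \<and> r mod 5 \<in> {0, 2, 3}")
      case True
      then obtain s where r: "r = Suc s" by (cases r) auto
      define y where "y = 1 / real q ^ r"
      have y: "0 < y" "y \<le> 1 / 2" using inverse_power_le_half[OF q_gt, of r] r by (auto simp: y_def)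
      have "1 / real q ^ (r - 1) = real q * y" using q_gt by (simp add: y_def r)
      then have "rr_factor q r - 1 = (1 - real q * y) / (1 - y) - 1" using True by (simp add: rr_factor_def y_def)
      also have "\<dots> = - ((real q - 1) * y / (1 - y))" using y by (simp add: field_simps)
      finally have "\<bar>rr_factor q r - 1\<bar> = (real q - 1) * y / (1 - y)" using y q_gt by simp
      also have "\<dots> \<le> real q * y / (1 / 2)" using y q_gt by (intro frac_le mult_right_mono mult_nonneg_nonneg) auto
      finally show ?thesis by (simp add: y_def power_one_over mult.commute)
    qed (auto simp: rr_factor_def)
  qed
  then show ?thesis by (intro abs_convergent_prod_imp_convergent_prod) (simp add: abs_convergent_prod_conv_summable)
qed

lemma rr_product_limit:
  "(\<lambda>N. (1 - 1 / real q) * (\<Prod>i<N. rr_ratio (5 * i + 4) * rr_ratio (5 * i + 6))) \<longlonglongrightarrow> (\<Prod>r. rr_factor q r)"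
proof -
  have "(\<lambda>n. \<Prod>r<n. rr_factor q r) \<longlonglongrightarrow> (\<Prod>r. rr_factor q r)"
    using convergent_prod_LIMSEQ[OF rr_factor_convergent] by (simp add: LIMSEQ_lessThan_iff_atMost)
  \<comment> \<open>The telescoped formula is available at the cut-offs \<open>5 * N + 1\<close>,
    and its extra factor tends to 1, so this subsequence of the partial products is enough.\<close>
  then have "(\<lambda>N. \<Prod>r<5 * N + 1. rr_factor q r) \<longlonglongrightarrow> (\<Prod>r. rr_factor q r)"
    using LIMSEQ_subseq_LIMSEQ[of _ _ "\<lambda>N. 5 * N + 1"] by (fastforce simp: strict_mono_def o_def)
  moreover have "(\<lambda>N. (1 / real q) ^ N) \<longlonglongrightarrow> 0" using q_gt by (intro LIMSEQ_power_zero) simp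
  then have "(\<lambda>N. (1 / real q) ^ (5 * N + 1)) \<longlonglongrightarrow> 0"
    by (rule filterlim_compose[OF _ filterlim_subseq]) (simp add: strict_mono_def)
  then have "(\<lambda>N. 1 / real q ^ (5 * N + 1)) \<longlonglongrightarrow> 0" by (simp only: power_one_over)
  ultimately have "(\<lambda>N. (\<Prod>r<5 * N + 1. rr_factor q r) * (1 - 1 / real q ^ (5 * N + 1))) \<longlonglongrightarrow> (\<Prod>r. rr_factor q r) * (1 - 0)"
    by (intro tendsto_mult tendsto_diff tendsto_const)
  then show ?thesis unfolding rr_factor_partial by simp
qed

lemma prob_semisimple_tendsto:
  "(\<lambda>n. prob_semisimple TYPE('a) n) \<longlonglongrightarrow> (\<Prod>r. rr_factor q r)"
  using prob_semisimple_limit(1) approx_value_limit[OF prob_semisimple_limit(2) rr_product_limit] by simp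

end

theorem theorem4:
  fixes q :: nat
  assumes "q = CARD('a :: finite_field)"
  shows "convergent_prod (rr_factor q) \<and>
         (\<lambda>n. prob_semisimple TYPE('a) n) \<longlonglongrightarrow> (\<Prod>r. rr_factor q r)"
  using rr_factor_convergent[OF assms] prob_semisimple_tendsto[OF assms] by blast

end
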